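(* Let $\xi_0,\xi_1,\ldots$ be non-degenerate i.i.d. complex-valued random variables such that $\mathbb{E}\log(1+|\xi_0|)<\infty$. Let $\alpha>0$, $\beta\in\mathbb{R}$, and let $w_0,w_1,\ldots$ be a complex sequence satisfying $$\log|w_k|=-\alpha(k\log k-k)-\beta k+o(k),\qquad k\to\infty .$$ Consider the random entire function $W(z)=\sum_{k=0}^\infty\xi_kw_kz^k$. Then, with probability $1$, as $n\to\infty$ the random measure $\frac1n\mu_W(e^\beta n^\alpha\,\cdot)$ converges to the deterministic measure having the density $$z\mapsto\frac1{2\pi\alpha}|z|^{\frac1\alpha-2}$$ with respect to the Lebesgue measure on $\mathbb{C}$.
   Context: A random variable is non-degenerate if it is not almost surely equal to a constant. For an entire function $G\not\equiv0$, $\mu_G=\sum_{z:G(z)=0}n_G(z)\,\delta_z$ is the measure on $\mathbb{C}$ counting zeros with multiplicity $n_G(z)$. For a measure $\mu$ on $\mathbb{C}$ and $c>0$, $\mu(c\,\cdot)$ is the measure $B\mapsto\mu(cB)$. Random locally finite measures $\mu_n$ on $\mathbb{C}$ converge to $\mu$ with probability $1$ (a.s.) if, for every continuous compactly supported $\varphi:\mathbb{C}\to\mathbb{R}$, $\int\varphi\,d\mu_n\to\int\varphi\,d\mu$ a.s. *)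

theory Defs
  imports "HOL-Probability.Probability" "HOL-Complex_Analysis.Complex_Analysis"
begin

definition nondegenerate :: "'a measure \<Rightarrow> ('a \<Rightarrow> complex) \<Rightarrow> bool" where
  "nondegenerate M X \<longleftrightarrow> \<not> (\<exists>c. AE \<omega> in M. X \<omega> = c)"

text \<open>The multiplicity of a zero \<open>z\<close> is \<^const>\<open>zorder\<close>. The sum of weighted Dirac measures is a
  density with respect to counting measure on the zero set, pushed forward to the Borel
  sigma-algebra. This is meaningful only for \<open>G\<close> entire and not identically zero.\<close>

definition zero_measure :: "(complex \<Rightarrow> complex) \<Rightarrow> complex measure" where
  "zero_measure G =
     distr (density (count_space {z. G z = 0}) (\<lambda>z. of_nat (nat (zorder G z)))) borel (\<lambda>z. z)"

lemma emeasure_zero_measure: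
  assumes "B \<in> sets borel"
  shows "emeasure (zero_measure G) B =
    (\<integral>\<^sup>+ z. of_nat (nat (zorder G z)) * emeasure (return borel z) B \<partial>count_space {z. G z = 0})"
proof -
  have "emeasure (zero_measure G) B =
     emeasure (density (count_space {z. G z = 0}) (\<lambda>z. of_nat (nat (zorder G z))))
       (B \<inter> {z. G z = 0})"
    unfolding zero_measure_def using assms
    by (subst emeasure_distr) (auto simp: measurable_def)
  also have "\<dots> = (\<integral>\<^sup>+ z. of_nat (nat (zorder G z)) * emeasure (return borel z) B
                    \<partial>count_space {z. G z = 0})"
    using assms
    by (subst emeasure_density) (auto intro!: nn_integral_cong simp: indicator_def)
  finally show ?thesis .
qed

text \<open>The measure \<open>\<mu>(c \<cdot>)\<close>, that is \<open>B \<mapsto> \<mu>(c B)\<close>, as the image of \<open>\<mu>\<close> under \<open>z \<mapsto> z / c\<close>.\<close>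

definition dilate_measure :: "real \<Rightarrow> complex measure \<Rightarrow> complex measure" where
  "dilate_measure c \<mu> = distr \<mu> borel (\<lambda>z. z / of_real c)"

lemma emeasure_dilate_measure:
  assumes "c > 0" "sets \<mu> = sets borel" "B \<in> sets borel"
  shows "emeasure (dilate_measure c \<mu>) B = emeasure \<mu> ((\<lambda>z. of_real c * z) ` B)"
proof -
  have "(\<lambda>z. z / of_real c) -` B = (\<lambda>z. of_real c * z) ` B"
  proof (intro equalityI subsetI)
    fix z assume "z \<in> (\<lambda>z. z / of_real c) -` B"
    moreover have "z = of_real c * (z / of_real c)" using assms(1) by simp
    ultimately show "z \<in> (\<lambda>z. of_real c * z) ` B" by blast
  qed (use assms(1) in auto)
  moreover have "space \<mu> = UNIV"
    using sets_eq_imp_space_eq[OF assms(2)] by simp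
  moreover have "emeasure (dilate_measure c \<mu>) B =
      emeasure \<mu> ((\<lambda>z. z / of_real c) -` B \<inter> space \<mu>)"
    unfolding dilate_measure_def
  proof (rule emeasure_distr)
    have "(\<lambda>z::complex. z / of_real c) \<in> borel_measurable borel"
      using assms(1) by (intro borel_measurable_continuous_onI continuous_intros) auto
    then show "(\<lambda>z. z / of_real c) \<in> borel_measurable \<mu>"
      using assms(2) measurable_cong_sets by blast
  qed fact
  ultimately show ?thesis by simp
qed

text \<open>The exceptional null set may depend on the test function.\<close>

definition as_vague_limit ::
    "'a measure \<Rightarrow> (nat \<Rightarrow> 'a \<Rightarrow> complex measure) \<Rightarrow> complex measure \<Rightarrow> bool" where
  "as_vague_limit M \<mu> \<nu> \<longleftrightarrow>
     (\<forall>\<phi>::complex \<Rightarrow> real.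
        continuous_on UNIV \<phi> \<and> compact (closure {z. \<phi> z \<noteq> 0}) \<longrightarrow>
        (AE \<omega> in M. (\<lambda>n. \<integral>z. \<phi> z \<partial>\<mu> n \<omega>) \<longlonglongrightarrow> (\<integral>z. \<phi> z \<partial>\<nu>)))"

definition random_series ::
    "(nat \<Rightarrow> 'a \<Rightarrow> complex) \<Rightarrow> (nat \<Rightarrow> complex) \<Rightarrow> 'a \<Rightarrow> complex \<Rightarrow> complex" where
  "random_series \<xi> w \<omega> z = (\<Sum>k. \<xi> k \<omega> * w k * z ^ k)"

end

theory Submission
  imports Defs "HOL-Real_Asymp.Real_Asymp"
begin

text \<open>
  Put \<open>R\<^sub>n = e\<^bsup>\<beta>\<^esup> n\<^bsup>\<alpha>\<^esup>\<close>, \<open>q\<^sub>n(z) = (1/n) log \<bar>W(R\<^sub>n z)\<bar>\<close> and \<open>I(z) = \<alpha> \<bar>z\<bar>\<^bsup>1/\<alpha>\<^esup>\<close>. The logarithmic moment gives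
  \<open>\<bar>\<xi>\<^sub>k\<bar> \<le> C e\<^bsup>\<epsilon>k\<^esup>\<close> almost surely, whence \<open>q\<^sub>n \<le> I + \<epsilon>\<close> locally uniformly. For a lower bound, take
  two points with different moduli in a small disc. Replacing a single coefficient \<open>\<xi>\<^sub>k\<close>
  by an independent copy cannot keep \<open>W(R\<^sub>n z)\<close> small at both points for two different \<open>k\<close>
  among the order \<open>n\<close> dominant terms, so both values are small with probability \<open>O(1/n)\<close> only.
  This is summable along squares, and the gaps are filled because \<open>I\<close> is homogeneous.

  Thus every disc eventually contains a point with \<open>q\<^sub>n \<ge> I - \<epsilon>\<close>. The sub-mean value property
  of \<open>log \<bar>W\<bar>\<close> upgrades this to \<open>q\<^sub>n \<longlonglongrightarrow> I\<close> in \<open>L\<^sup>1\<close> on discs. By Jensen's formula averaged over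
  discs, the mean of \<open>q\<^sub>n\<close> over a disc minus its value at the centre is the zero measure smoothed
  by an explicit kernel, and the same holds for \<open>I\<close> and the limit measure, which is therefore
  the limit of the zero measures.
\<close>

section \<open>Circle means and radial integrals\<close>

text \<open>Nondegeneracy alone gives no density and no small-ball estimate, which is why the bad
  event is shown to be rare only polynomially. One evaluation point would not do: the changes caused
  by two different coefficients may cancel there. Between two circles their ratio changes by a power
  of the quotient of the radii, so they cannot cancel on both. Up to the random factor and
  \<open>exp (o(k))\<close>, the scaling makes the \<open>k\<close>-th term of
  \<open>W(R\<^sub>n z)\<close> of size \<open>exp (\<alpha> * (k * ln (y / k) + k))\<close> with
  \<open>y = n * cmod z powr (1 / \<alpha>)\<close>; the maximum, at \<open>k = y\<close>, is
  \<open>exp (n * I(z))\<close>, and it is so flat that all \<open>k\<close> near \<open>y\<close>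
  count. The lower bound holds only at some unspecified point of each disc, and logarithms have
  poles at the zeros, hence the passage to \<open>L\<^sup>1\<close>. Test functions are merely
  continuous, so no Laplacian can be moved onto them; disc mean minus central value takes its place,
  because it needs only \<open>L\<^sup>1\<close> convergence and because smoothing at a small scale
  hardly changes a uniformly continuous function. The price is a uniform bound on the normalised
  number of zeros in a disc.\<close>

lemma lborel_complex_eq_distr_vec:
  "(lborel :: complex measure) = distr (lborel :: (real^2) measure) borel (\<lambda>v. Complex (v $ 1) (v $ 2))"
proof (rule lborel_eqI)
  have m: "(\<lambda>v::real^2. Complex (v $ 1) (v $ 2)) \<in> borel_measurable lborel"
    unfolding Complex_eq by (intro borel_measurable_continuous_onI continuous_intros | simp)+
  fix l u :: complex assume lu: "\<And>b. b \<in> Basis \<Longrightarrow> l \<bullet> b \<le> u \<bullet> b"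
  have lu': "Re l \<le> Re u" "Im l \<le> Im u"
    using lu[of 1] lu[of \<i>] by (auto simp: Basis_complex_def inner_complex_def)
  let ?v = "\<lambda>z. (\<chi> i. if i = 1 then Re z else Im z) :: real^2"
  have "(\<lambda>v::real^2. Complex (v $ 1) (v $ 2)) -` box l u = box (?v l) (?v u)"
    by (auto simp: box_def Basis_complex_def inner_complex_def Basis_vec_def inner_axis axis_eq_axis forall_2)
  then have "emeasure (distr lborel borel (\<lambda>v::real^2. Complex (v $ 1) (v $ 2))) (box l u)
     = emeasure lborel (box (?v l) (?v u))"
    using m by (subst emeasure_distr) auto
  also have "\<dots> = (\<Prod>b\<in>Basis. (?v u - ?v l) \<bullet> b)"
    using lu' by (subst emeasure_lborel_box) (auto simp: Basis_vec_def inner_axis)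
  also have "(\<Prod>b\<in>Basis. (?v u - ?v l) \<bullet> b) = (Re u - Re l) * (Im u - Im l)"
    unfolding Basis_vec_def
    by (simp add: UNION_singleton_eq_range axis_eq_axis inj_on_def prod.reindex UNIV_2 inner_axis)
  also have "\<dots> = (\<Prod>b\<in>Basis. (u - l) \<bullet> b)"
    by (simp add: Basis_complex_def inner_complex_def)
  finally show "emeasure (distr lborel borel (\<lambda>v::real^2. Complex (v $ 1) (v $ 2))) (box l u)
     = (\<Prod>b\<in>Basis. (u - l) \<bullet> b)" by simp
qed simp

text \<open>Multiplication by a unimodular number is an orthogonal map of \<open>real^2\<close>, and
  such maps preserve the measure of boxes.\<close>

lemma distr_lborel_rotation:
  fixes c :: complex
  assumes c: "cmod c = 1"
  shows "distr lborel borel (\<lambda>z. c * z) = lborel"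
proof (rule lborel_eqI[symmetric])
  let ?T = "\<lambda>v::real^2. Complex (v $ 1) (v $ 2)"
  let ?V = "\<lambda>z. (\<chi> i. if i = 1 then Re z else Im z) :: real^2"
  have VT: "?V (?T v) = v" for v by (auto simp: vec_eq_iff forall_2)
  have TV: "?T (?V z) = z" for z by (simp add: complex_eq_iff)
  have mT: "?T \<in> borel_measurable lborel"
    unfolding Complex_eq by (intro borel_measurable_continuous_onI continuous_intros | simp)+
  have c0: "c \<noteq> 0" using c by auto
  fix l u :: complex assume lu: "\<And>b. b \<in> Basis \<Longrightarrow> l \<bullet> b \<le> u \<bullet> b"
  let ?S = "?T -` box l u"
  have S: "?S = box (?V l) (?V u)"
    by (auto simp: box_def Basis_complex_def inner_complex_def Basis_vec_def inner_axis axis_eq_axis forall_2)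
  \<comment> \<open>The preimage of a box under multiplication by \<open>c\<close> is its image
    under the inverse rotation, hence \<open>inverse c\<close>.\<close>
  let ?f = "\<lambda>v. ?V (inverse c * ?T v)"
  have normV: "norm (?V z) = cmod z" for z
    by (simp add: norm_vec_def L2_set_def sum_2 cmod_def)
  have normT: "cmod (?T v) = norm v" for v
    using normV[of "?T v"] by (simp only: VT)
  have lin: "linear ?f"
    by (rule linearI) (auto simp: vec_eq_iff algebra_simps add_divide_distrib)
  have orth: "orthogonal_transformation ?f"
    unfolding orthogonal_transformation using lin normV normT c
    by (simp add: norm_mult norm_inverse)
  have img: "?f ` ?S = ?T -` ((\<lambda>z. c * z) -` box l u)"
  proof (intro equalityI subsetI)
    fix v assume "v \<in> ?f ` ?S"
    then show "v \<in> ?T -` ((\<lambda>z. c * z) -` box l u)"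
      using c0 by (auto simp only: vimage_eq TV mult.assoc[symmetric] right_inverse[OF c0] mult_1)
  next
    fix v assume v: "v \<in> ?T -` ((\<lambda>z. c * z) -` box l u)"
    have "v = ?f (?V (c * ?T v))"
      by (simp only: TV mult.assoc[symmetric] left_inverse[OF c0] mult_1 VT)
    moreover have "?V (c * ?T v) \<in> ?S" using v by (simp only: vimage_eq TV)
    ultimately show "v \<in> ?f ` ?S" by (rule image_eqI)
  qed
  have cm: "(\<lambda>z. c * z) \<in> borel_measurable borel" by simp
  have B: "(\<lambda>z. c * z) -` box l u \<in> sets borel"
    using measurable_sets[OF cm, of "box l u"] by simp
  have Sm: "?S \<in> lmeasurable" unfolding S by simp
  have "emeasure (distr lborel borel (\<lambda>z. c * z)) (box l u) = emeasure lborel ((\<lambda>z. c * z) -` box l u)"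
    by (subst emeasure_distr) auto
  also have "\<dots> = emeasure lborel (?f ` ?S)"
    using mT B by (subst lborel_complex_eq_distr_vec, subst emeasure_distr) (auto simp: img)
  also have "\<dots> = emeasure lebesgue (?f ` ?S)"
    using measurable_sets[OF mT B] unfolding img by simp
  also have "\<dots> = measure lebesgue (?f ` ?S)"
    using measurable_orthogonal_image[OF orth Sm] by (intro emeasure_eq_measure2) (auto simp: fmeasurable_def)
  also have "measure lebesgue (?f ` ?S) = measure lebesgue ?S"
    by (rule measure_orthogonal_image[OF orth Sm])
  also have "ennreal \<dots> = emeasure lebesgue ?S"
    using Sm by (intro emeasure_eq_measure2[symmetric]) (auto simp: fmeasurable_def)
  also have "\<dots> = emeasure lborel ?S" unfolding S by simp
  also have "\<dots> = emeasure lborel (box l u)"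
    using mT by (subst lborel_complex_eq_distr_vec, subst emeasure_distr) auto
  also have "\<dots> = (\<Prod>b\<in>Basis. (u - l) \<bullet> b)"
    using lu by (subst emeasure_lborel_box) auto
  finally show "emeasure (distr lborel borel (\<lambda>z. c * z)) (box l u) = (\<Prod>b\<in>Basis. (u - l) \<bullet> b)" .
qed simp

lemma nn_integral_rotation_average:
  fixes H :: "complex \<Rightarrow> ennreal"
  assumes [measurable]: "H \<in> borel_measurable borel"
  shows "(\<integral>\<^sup>+z. (\<integral>\<^sup>+t\<in>{0..2*pi}. H (cis t * z) \<partial>lborel) \<partial>lborel)
     = ennreal (2 * pi) * (\<integral>\<^sup>+z. H z \<partial>lborel)"
proof -
  have [measurable]: "cis \<in> borel_measurable borel"
    by (intro borel_measurable_continuous_onI continuous_intros) 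
  have rot: "(\<integral>\<^sup>+z. H (cis t * z) \<partial>lborel) = (\<integral>\<^sup>+z. H z \<partial>lborel)" for t
  proof -
    have "(\<integral>\<^sup>+z. H z \<partial>lborel) = (\<integral>\<^sup>+z. H z \<partial>distr lborel borel (\<lambda>z. cis t * z))"
      by (subst distr_lborel_rotation) auto
    also have "\<dots> = (\<integral>\<^sup>+z. H (cis t * z) \<partial>lborel)"
      by (subst nn_integral_distr) auto
    finally show ?thesis ..
  qed
  have "(\<integral>\<^sup>+z. (\<integral>\<^sup>+t\<in>{0..2*pi}. H (cis t * z) \<partial>lborel) \<partial>lborel)
     = (\<integral>\<^sup>+t. (\<integral>\<^sup>+z. H (cis t * z) * indicator {0..2*pi} t \<partial>lborel) \<partial>lborel)"
    by (rule lborel_pair.Fubini'[symmetric]) measurable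
  also have "\<dots> = (\<integral>\<^sup>+t. (\<integral>\<^sup>+z. H z \<partial>lborel) * indicator {0..2*pi} t \<partial>lborel)"
    by (simp add: nn_integral_multc rot)
  also have "\<dots> = ennreal (2 * pi) * (\<integral>\<^sup>+z. H z \<partial>lborel)"
    by (simp add: nn_integral_cmult mult.commute)
  finally show ?thesis .
qed

text \<open>A zero-free \<open>g\<close> on a disc has a holomorphic logarithm \<open>h\<close>, so
  \<open>ln (cmod (g v))\<close> is \<open>Re (h v)\<close> and Cauchy's formula at 0 gives its
  mean; the real part appears below as the imaginary part of \<open>h v * \<i>\<close>.\<close>

lemma circle_mean_ln_norm:
  assumes g: "g holomorphic_on ball 0 R" and R: "1 < R" and nz: "\<And>v. v \<in> ball 0 R \<Longrightarrow> g v \<noteq> 0"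
  shows "((\<lambda>t. ln (cmod (g (cis t)))) has_integral 2 * pi * ln (cmod (g 0))) {0..2*pi}"
proof -
  obtain h where h: "h holomorphic_on ball 0 R" and gh: "\<And>v. v \<in> ball 0 R \<Longrightarrow> g v = exp (h v)"
    using contractible_imp_holomorphic_log[OF g convex_imp_contractible[OF convex_ball] nz] by blast
  have "((\<lambda>u. h u / (u - 0)) has_contour_integral (2 * of_real pi * \<i> * h 0)) (circlepath 0 1)"
  proof (rule Cauchy_integral_circlepath)
    show "continuous_on (cball 0 1) h"
      using h R by (intro holomorphic_on_imp_continuous_on) (auto intro: holomorphic_on_subset)
    show "h holomorphic_on ball 0 1" using h R by (auto intro: holomorphic_on_subset)
  qed simp
  then have "((\<lambda>t. h (cis t) * \<i>) has_integral (2 * of_real pi * \<i> * h 0)) {0..2*pi}"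
    unfolding circlepath_def by (subst (asm) has_contour_integral_part_circlepath_iff) (auto)
  from has_integral_linear[OF this bounded_linear_Im]
  have "((\<lambda>t. Im (h (cis t) * \<i>)) has_integral Im (2 * of_real pi * \<i> * h 0)) {0..2*pi}"
    unfolding o_def .
  moreover have "Im (h (cis t) * \<i>) = ln (cmod (g (cis t)))" for t
    using gh[of "cis t"] R by simp
  moreover have "Im (2 * of_real pi * \<i> * h 0) = 2 * pi * ln (cmod (g 0))"
    using gh[of 0] R by simp
  ultimately show ?thesis by simp
qed

lemma circle_mean_ln_dist:
  assumes "cmod z \<noteq> cmod w"
  shows "((\<lambda>t. ln (cmod (z - cis t * w))) has_integral 2 * pi * ln (max (cmod z) (cmod w))) {0..2*pi}"
proof (cases "cmod w < cmod z")
  case True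
  show ?thesis
  proof (cases "w = 0")
    case True
    then show ?thesis
      using has_integral_const_real[of "ln (cmod z)" 0 "2*pi"] by (simp add: algebra_simps max_def)
  next
    case False
    have "((\<lambda>t. ln (cmod (z - cis t * w))) has_integral 2 * pi * ln (cmod (z - 0 * w))) {0..2*pi}"
    proof (rule circle_mean_ln_norm)
      show "(\<lambda>v. z - v * w) holomorphic_on ball 0 (cmod z / cmod w)" by (intro holomorphic_intros)
      show "1 < cmod z / cmod w" using True False by simp
      fix v :: complex assume "v \<in> ball 0 (cmod z / cmod w)"
      then have "cmod (v * w) < cmod z" using False by (simp add: norm_mult field_simps)
      then show "z - v * w \<noteq> 0" by auto
    qed
    then show ?thesis using True by (simp add: max_def)
  qed
next
  case F: False
  then have lt: "cmod z < cmod w" using assms by simp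
  \<comment> \<open>Now \<open>z - v * w\<close> has a zero in the unit disc. On the circle its
    modulus equals that of the reflected function \<open>cnj z * v - cnj w\<close>, which has
    none.\<close>
  have eq: "cmod (z - cis t * w) = cmod (cnj z * cis t - cnj w)" for t
  proof -
    have "cmod (z - cis t * w) = cmod (cnj (z - cis t * w))" by (simp only: complex_mod_cnj)
    also have "\<dots> = cmod (cis t) * cmod (cnj (z - cis t * w))" by simp
    also have "\<dots> = cmod (cis t * cnj (z - cis t * w))" by (simp only: norm_mult)
    also have "cis t * cnj (z - cis t * w) = cnj z * cis t - (cis t * cis (-t)) * cnj w"
      by (simp add: algebra_simps cis_cnj del: cis_mult)
    also have "\<dots> = cnj z * cis t - cnj w" by (simp add: cis_mult)
    finally show ?thesis .
  qed
  show ?thesis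
  proof (cases "z = 0")
    case True
    then show ?thesis
      using has_integral_const_real[of "ln (cmod w)" 0 "2*pi"]
      by (simp add: algebra_simps max_def norm_mult)
  next
    case False
    have "((\<lambda>t. ln (cmod (cnj z * cis t - cnj w))) has_integral 2 * pi * ln (cmod (cnj z * 0 - cnj w))) {0..2*pi}"
    proof (rule circle_mean_ln_norm)
      show "(\<lambda>v. cnj z * v - cnj w) holomorphic_on ball 0 (cmod w / cmod z)" by (intro holomorphic_intros)
      show "1 < cmod w / cmod z" using lt False by simp
      fix v :: complex assume "v \<in> ball 0 (cmod w / cmod z)"
      then have "cmod (cnj z * v) < cmod (cnj w)" using False by (simp add: norm_mult field_simps)
      then show "cnj z * v - cnj w \<noteq> 0" by auto
    qed
    then show ?thesis using lt unfolding eq by (simp add: max_def)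
  qed
qed

text \<open>\<open>B\<close> bounds every distance that occurs, so the logarithm of the quotient is
  nonnegative and the mean becomes a nonnegative integral, to which Tonelli applies.\<close>

lemma nn_circle_mean_ln_dist:
  assumes ne: "cmod z \<noteq> cmod w" and B: "cmod z + cmod w \<le> B"
  shows "(\<integral>\<^sup>+t\<in>{0..2*pi}. ennreal (ln (B / cmod (z - cis t * w))) \<partial>lborel)
      = ennreal (2 * pi * ln (B / max (cmod z) (cmod w)))"
proof -
  have Bpos: "B > 0" using ne B by (smt (verit) norm_ge_zero)
  have zt: "cmod (z - cis t * w) > 0" for t using ne by (auto simp: norm_mult)
  have mx: "max (cmod z) (cmod w) > 0" using ne by (auto simp: max_def)
  have "((\<lambda>t. ln B - ln (cmod (z - cis t * w))) has_integral
       (2 * pi * ln B - 2 * pi * ln (max (cmod z) (cmod w)))) {0..2*pi}"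
    using has_integral_const_real[of "ln B" 0 "2*pi"]
    by (intro has_integral_diff circle_mean_ln_dist ne) (simp add: algebra_simps)
  then have "((\<lambda>t. ln (B / cmod (z - cis t * w))) has_integral (2 * pi * ln (B / max (cmod z) (cmod w)))) {0..2*pi}"
    using Bpos zt mx by (simp add: ln_div algebra_simps)
  moreover have "0 \<le> ln (B / cmod (z - cis t * w))" for t
  proof -
    have "cmod (z - cis t * w) \<le> B" using norm_triangle_ineq4[of z "cis t * w"] B by (simp add: norm_mult)
    then show ?thesis using zt[of t] by simp
  qed
  ultimately show ?thesis
    by (intro nn_integral_has_integral_lebesgue') auto
qed

section \<open>Null circles and polar coordinates\<close>

lemma AE_lborel_norm_neq: "AE w::complex in lborel. cmod w \<noteq> r"
proof -
  have "sphere (0::complex) r \<in> null_sets lborel"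
    using negligible_sphere[of "0::complex" r]
    by (simp add: null_sets_completion_iff negligible_iff_null_sets)
  from AE_not_in[OF this] show ?thesis by simp
qed

lemma norm_le_norm_plus_dist: "cmod w \<le> cmod z + dist z w"
  using norm_triangle_ineq[of z "w - z"] by (simp add: dist_norm norm_minus_commute)

lemma emeasure_ball_complex: "r \<ge> 0 \<Longrightarrow> emeasure lborel (ball (c::complex) r) = ennreal (pi * r^2)"
  using emeasure_ball[of r c] by (simp add: unit_ball_vol_2)

text \<open>The law of \<open>cmod z\<close> on the disc and the density \<open>2 * pi * s\<close>
  are finite measures that agree on all half-lines \<open>{x<..}\<close>: both give the area of an
  annulus. Clamping \<open>x\<close> to \<open>{0..T}\<close> lets one formula cover every
  \<open>x\<close>.\<close>

lemma nn_integral_radial: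
  assumes [measurable]: "G \<in> borel_measurable borel" and T: "T > 0"
  shows "(\<integral>\<^sup>+z\<in>ball 0 T. G (cmod z) \<partial>lborel)
     = (\<integral>\<^sup>+s. G s * ennreal (2 * pi * s) * indicator {0<..<T} s \<partial>lborel)"
proof -
  let ?M = "distr (density lborel (indicator (ball (0::complex) T))) borel cmod"
  let ?N = "density lborel (\<lambda>s. ennreal (2 * pi * s) * indicator {0<..<T} s)"
  define Y where "Y x = max 0 (min x T)" for x
  have eq: "emeasure ?M {x<..} = ennreal (pi * T^2 - pi * (Y x)^2)"
    "emeasure ?N {x<..} = ennreal (pi * T^2 - pi * (Y x)^2)" for x
  proof -
    let ?y = "Y x"
    have y: "0 \<le> ?y" "?y \<le> T" using T by (auto simp: Y_def)
    have cut: "s < T \<and> x < s \<longleftrightarrow> s < T \<and> \<not> s < ?y" if "0 \<le> s" "s \<noteq> 0" "s \<noteq> ?y" for s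
      using that T unfolding Y_def by linarith
    have mB: "cmod -` {x<..} \<in> sets borel"
      by (rule measurable_sets_borel[of cmod borel]) auto
    have "emeasure ?M {x<..} = emeasure (density lborel (indicator (ball (0::complex) T))) (cmod -` {x<..})"
      by (subst emeasure_distr) auto
    also have "\<dots> = emeasure lborel (ball (0::complex) T \<inter> (cmod -` {x<..}))"
      using mB by (subst emeasure_density) (measurable, simp_all add: indicator_inter_arith[symmetric])
    also have "emeasure lborel (ball (0::complex) T \<inter> (cmod -` {x<..})) = emeasure lborel (ball (0::complex) T - ball 0 ?y)"
    proof (rule emeasure_eq_AE)
      have "AE z::complex in lborel. cmod z \<noteq> ?y" by (rule AE_lborel_norm_neq)
      moreover have "AE z::complex in lborel. z \<noteq> 0"
        using AE_lborel_singleton by blast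
      ultimately show "AE z in lborel. (z \<in> ball (0::complex) T \<inter> (cmod -` {x<..})) = (z \<in> ball (0::complex) T - ball 0 ?y)"
      proof eventually_elim
        case (elim z)
        then show ?case using cut[of "cmod z"] by (simp add: not_less)
      qed
    qed (use mB in simp_all)
    also have "\<dots> = emeasure lborel (ball (0::complex) T) - emeasure lborel (ball (0::complex) ?y)"
      using y by (intro emeasure_Diff) (auto simp: emeasure_ball_complex)
    also have "\<dots> = ennreal (pi * T^2 - pi * ?y^2)"
      using y T by (simp add: emeasure_ball_complex ennreal_minus)
    finally show "emeasure ?M {x<..} = ennreal (pi * T^2 - pi * ?y^2)" .
    have "emeasure ?N {x<..} = (\<integral>\<^sup>+s. ennreal (2 * pi * s) * indicator {0<..<T} s * indicator {x<..} s \<partial>lborel)"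
      by (subst emeasure_density) auto
    also have "\<dots> = (\<integral>\<^sup>+s. ennreal (2 * pi * s) * indicator {?y..T} s \<partial>lborel)"
    proof (rule nn_integral_cong_AE)
      have "AE s in lborel. s \<noteq> T" "AE s in lborel. s \<noteq> ?y"
        using AE_lborel_singleton by blast+
      then show "AE s in lborel. ennreal (2 * pi * s) * indicator {0<..<T} s * indicator {x<..} s
          = ennreal (2 * pi * s) * indicator {?y..T} s"
      proof eventually_elim
        case (elim s)
        consider "s \<le> 0" | "s > 0" by linarith
        then show ?case
        proof cases
          case 1
          then show ?thesis by (simp add: ennreal_neg mult_nonneg_nonpos)
        next
          case 2
          have "s \<in> {0<..<T} \<and> s \<in> {x<..} \<longleftrightarrow> s \<in> {?y..T}"
            using cut[of s] elim 2 y by auto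
          then show ?thesis by (auto simp: indicator_def)
        qed
      qed
    qed
    also have "\<dots> = ennreal (pi * T^2 - pi * ?y^2)"
      using y by (intro nn_integral_FTC_Icc) (auto intro!: derivative_eq_intros)
    finally show "emeasure ?N {x<..} = ennreal (pi * T^2 - pi * ?y^2)" .
  qed
  have MN: "?M = ?N"
  proof (rule measure_eqI_lessThan)
    show "emeasure ?M {x<..} < \<infinity>" for x
      unfolding eq(1)[of x] by simp
    show "emeasure ?M {x<..} = emeasure ?N {x<..}" for x
      unfolding eq(1)[of x] eq(2)[of x] ..
  qed simp_all
  have Gm: "(\<lambda>z::complex. G (cmod z)) \<in> borel_measurable lborel"
    by (rule measurable_compose[OF _ assms(1)]) simp
  have "(\<integral>\<^sup>+s. G s \<partial>?M) = (\<integral>\<^sup>+z. G (cmod z) \<partial>density lborel (indicator (ball (0::complex) T)))"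
    by (rule nn_integral_distr) simp_all
  also have "\<dots> = (\<integral>\<^sup>+z. indicator (ball 0 T) z * G (cmod z) \<partial>lborel)"
    by (rule nn_integral_density[OF borel_measurable_indicator Gm]) simp
  finally have "(\<integral>\<^sup>+z\<in>ball 0 T. G (cmod z) \<partial>lborel) = (\<integral>\<^sup>+s. G s \<partial>?M)"
    by (simp add: mult.commute)
  also have "\<dots> = (\<integral>\<^sup>+s. G s * ennreal (2 * pi * s) * indicator {0<..<T} s \<partial>lborel)"
    unfolding MN by (subst nn_integral_density) (simp_all add: ac_simps)
  finally show ?thesis .
qed

section \<open>Logarithmic potentials of radial measures\<close>

lemma ball_borel_measurable [measurable]: "ball (a :: complex) r \<in> sets borel"
  by simp

text \<open>Away from the origin this is \<open>1 / (2 * pi)\<close> times the Laplacian of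
  \<open>cmod w powr p / p\<close>, so \<open>p = 1 / \<alpha>\<close> gives the density of the
  limit.\<close>

definition radial_density :: "real \<Rightarrow> complex \<Rightarrow> real" where
  "radial_density p w = p / (2 * pi) * cmod w powr (p - 2)"

lemma radial_density_nonneg: "p \<ge> 0 \<Longrightarrow> radial_density p w \<ge> 0"
  by (simp add: radial_density_def)

lemma borel_measurable_radial_density [measurable]: "radial_density p \<in> borel_measurable borel"
  unfolding radial_density_def[abs_def] by measurable

lemma nn_integral_radial_density:
  assumes p: "p > 0" and T: "T > 0" and [measurable]: "g \<in> borel_measurable borel"
    and g: "\<And>s. 0 < s \<Longrightarrow> s < T \<Longrightarrow> g s \<ge> 0"
    and I: "((\<lambda>s. g s * (p * s powr (p - 1))) has_integral I) {0..T}"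
  shows "(\<integral>\<^sup>+w\<in>ball 0 T. ennreal (g (cmod w)) * ennreal (radial_density p w) \<partial>lborel) = ennreal I"
proof -
  let ?G = "\<lambda>s. ennreal (g s) * ennreal (p / (2 * pi) * s powr (p - 2))"
  have "(\<integral>\<^sup>+w\<in>ball 0 T. ennreal (g (cmod w)) * ennreal (radial_density p w) \<partial>lborel)
     = (\<integral>\<^sup>+w\<in>ball 0 T. ?G (cmod w) \<partial>lborel)"
    by (simp add: radial_density_def)
  also have "\<dots> = (\<integral>\<^sup>+s. ?G s * ennreal (2 * pi * s) * indicator {0<..<T} s \<partial>lborel)"
    by (rule nn_integral_radial[OF _ T]) measurable
  also have "\<dots> = (\<integral>\<^sup>+s. ennreal (g s * (p * s powr (p - 1))) * indicator {0<..<T} s \<partial>lborel)"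
  proof (rule nn_integral_cong)
    fix s :: real
    show "?G s * ennreal (2 * pi * s) * indicator {0<..<T} s
        = ennreal (g s * (p * s powr (p - 1))) * indicator {0<..<T} s"
    proof (cases "s \<in> {0<..<T}")
      case True
      then have s: "s > 0" "s < T" by auto
      have "p / (2 * pi) * s powr (p - 2) * (2 * pi * s) = p * s powr (p - 1)"
        using s powr_mult_base[of s "p - 2"] by (simp add: field_simps)
      then show ?thesis
        using s p g[of s] by (simp add: ennreal_mult[symmetric] mult.assoc)
    qed simp
  qed
  also have "\<dots> = ennreal I"
  proof (rule nn_integral_has_integral_lebesgue')
    show "((\<lambda>s. g s * (p * s powr (p - 1))) has_integral I) {0<..<T}"
      using has_integral_Icc_iff_Ioo[of "\<lambda>s. g s * (p * s powr (p - 1))" I 0 T] I by simp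
    show "0 \<le> g x * (p * x powr (p - 1))" if "x \<in> {0<..<T}" for x
      using that g p by auto
  qed
  finally show ?thesis .
qed

lemma has_integral_log_radial:
  fixes p T x B :: real
  assumes p: "p > 0" and T: "T > 0" and x: "x \<ge> 0" and B: "B > 0"
  defines "m \<equiv> max x T"
  shows "((\<lambda>s. ln (B / max x s) * (p * s powr (p - 1))) has_integral
      (T powr p * ln (B / m) + (m powr p - x powr p) / p)) {0..T}"
proof -
  \<comment> \<open>Integration by parts: for \<open>s > x\<close> the second summand compensates
    the derivative of the logarithm, for \<open>s < x\<close> it is constant.\<close>
  let ?F = "\<lambda>s. s powr p * ln (B / max x s) + max x s powr p / p"
  have D: "((\<lambda>s. s powr p * ln (B / s) + s powr p / p) has_real_derivative
      ln (B / s) * (p * s powr (p - 1))) (at s)" if "s > 0" for s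
  proof -
    have l: "((\<lambda>s. ln (B / s)) has_real_derivative - (1 / s)) (at s)"
      using that B by (auto intro!: derivative_eq_intros simp: power2_eq_square divide_simps)
    note d = DERIV_add[OF DERIV_mult[OF has_real_derivative_powr[OF that, of p] l]
        DERIV_cdivide[OF has_real_derivative_powr[OF that, of p], of p]]
    have "s powr p = s * s powr (p - 1)" using that powr_mult_base[of s "p - 1"] by simp
    then have eq: "p * s powr (p - 1) * ln (B / s) + - (1 / s) * s powr p + p * s powr (p - 1) / p
        = ln (B / s) * (p * s powr (p - 1))"
      using that p by simp
    show ?thesis using d unfolding eq .
  qed
  have "((\<lambda>s. ln (B / max x s) * (p * s powr (p - 1))) has_integral (?F T - ?F 0)) {0..T}"
  proof (rule fundamental_theorem_of_calculus_interior_strong[where S = "{x}"])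
    fix s assume s: "s \<in> {0<..<T} - {x}"
    then consider "s < x" "s > 0" | "x < s" "s > 0" by fastforce
    then show "(?F has_vector_derivative ln (B / max x s) * (p * s powr (p - 1))) (at s)"
    proof cases
      case 1
      have "((\<lambda>s. s powr p * ln (B / x) + x powr p / p) has_real_derivative
          ln (B / x) * (p * s powr (p - 1))) (at s)"
        using 1 by (auto intro!: derivative_eq_intros)
      moreover have "\<forall>\<^sub>F t in nhds s. ?F t = t powr p * ln (B / x) + x powr p / p"
        using eventually_nhds_in_open[of "{..<x}" s] 1 by (auto elim!: eventually_mono simp: max_def)
      ultimately have "(?F has_real_derivative ln (B / x) * (p * s powr (p - 1))) (at s)"
        by (subst DERIV_cong_ev) auto
      then show ?thesis using 1 by (simp add: has_real_derivative_iff_has_vector_derivative max_def)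
    next
      case 2
      have "\<forall>\<^sub>F t in nhds s. ?F t = t powr p * ln (B / t) + t powr p / p"
        using eventually_nhds_in_open[of "{x<..}" s] 2 by (auto elim!: eventually_mono simp: max_def)
      then have "(?F has_real_derivative ln (B / s) * (p * s powr (p - 1))) (at s)"
        using D[OF 2(2)] by (subst DERIV_cong_ev) auto
      then show ?thesis using 2 by (simp add: has_real_derivative_iff_has_vector_derivative max_def)
    qed
  next
    show "continuous_on {0..T} ?F"
    proof (cases "x = 0")
      case False
      then show ?thesis using x p B
        by (intro continuous_intros continuous_on_powr') auto
    next
      case True
      \<comment> \<open>For \<open>x = 0\<close> the logarithm is unbounded at the origin and the
        power has to beat it. HOL's value of the antiderivative at 0 is 0, which matches the
        limit.\<close>
      have lim: "((\<lambda>s. s powr p * ln (B / s) + s powr p / p) \<longlongrightarrow> 0) (at_right 0)"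
        using p B by real_asymp
      have "continuous_on {0..T} (\<lambda>s. s powr p * ln (B / s) + s powr p / p)"
        unfolding continuous_on_eq_continuous_within
      proof
        fix s assume s: "s \<in> {0..T}"
        show "continuous (at s within {0..T}) (\<lambda>s. s powr p * ln (B / s) + s powr p / p)"
        proof (cases "s = 0")
          case True
          then show ?thesis
            using lim T p by (simp add: continuous_within at_within_Icc_at_right)
        next
          case False
          then have "s > 0" using s by auto
          show ?thesis
            by (rule continuous_at_imp_continuous_within[OF DERIV_isCont[OF D[OF \<open>s > 0\<close>]]])
        qed
      qed
      then show ?thesis
        by (rule continuous_on_eq) (use True in \<open>auto simp: max_def\<close>)
    qed
  qed (use T in auto)
  moreover have "?F T - ?F 0 = T powr p * ln (B / m) + (m powr p - x powr p) / p"
    using x p by (simp add: m_def diff_divide_distrib max_def)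
  ultimately show ?thesis by simp
qed

text \<open>The density is rotation invariant, so averaging the integral over all rotations replaces
  \<open>h\<close> by its circle mean \<open>K\<close>; only almost every circle matters, which
  allows for the singular one.\<close>

lemma nn_integral_circle_average:
  fixes h K :: "complex \<Rightarrow> ennreal"
  assumes [measurable]: "h \<in> borel_measurable borel" "K \<in> borel_measurable borel"
    and K: "AE w in lborel. w \<in> ball 0 T \<longrightarrow>
      (\<integral>\<^sup>+t\<in>{0..2*pi}. h (cis t * w) \<partial>lborel) = ennreal (2 * pi) * K w"
  shows "(\<integral>\<^sup>+w\<in>ball 0 T. h w * ennreal (radial_density p w) \<partial>lborel)
     = (\<integral>\<^sup>+w\<in>ball 0 T. K w * ennreal (radial_density p w) \<partial>lborel)"
proof -
  let ?H = "\<lambda>w. h w * ennreal (radial_density p w) * indicator (ball 0 T) w"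
  have [measurable]: "cis \<in> borel_measurable borel"
    by (intro borel_measurable_continuous_onI continuous_intros)
  have "ennreal (2 * pi) * (\<integral>\<^sup>+w. ?H w \<partial>lborel)
      = (\<integral>\<^sup>+w. (\<integral>\<^sup>+t\<in>{0..2*pi}. ?H (cis t * w) \<partial>lborel) \<partial>lborel)"
    by (rule nn_integral_rotation_average[symmetric]) measurable
  also have "\<dots> = (\<integral>\<^sup>+w. ennreal (2 * pi) * (K w * ennreal (radial_density p w) * indicator (ball 0 T) w) \<partial>lborel)"
  proof (rule nn_integral_cong_AE, use K in eventually_elim)
    case (elim w)
    have rd: "radial_density p (cis t * w) = radial_density p w" for t
      by (simp add: radial_density_def norm_mult)
    have ind: "(indicator (ball 0 T) (cis t * w) :: ennreal) = indicator (ball 0 T) w" for t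
      by (simp add: indicator_def norm_mult)
    show ?case
    proof (cases "w \<in> ball 0 T")
      case True
      have hm: "(\<lambda>t. h (cis t * w) * indicator {0..2*pi} t) \<in> borel_measurable lborel"
        by (intro borel_measurable_times_ennreal measurable_compose[OF _ assms(1)] borel_measurable_indicator) simp_all
      have "(\<integral>\<^sup>+t\<in>{0..2*pi}. ?H (cis t * w) \<partial>lborel)
         = (\<integral>\<^sup>+t. ennreal (radial_density p w) * (h (cis t * w) * indicator {0..2*pi} t) \<partial>lborel)"
        using True unfolding rd ind by (intro nn_integral_cong) (simp add: ac_simps)
      also have "\<dots> = ennreal (radial_density p w) * (ennreal (2 * pi) * K w)"
        unfolding nn_integral_cmult[OF hm] elim[rule_format, OF True] ..
      finally show ?thesis using True by (simp add: ac_simps)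
    next
      case False
      then show ?thesis by (simp add: ind)
    qed
  qed
  also have "\<dots> = ennreal (2 * pi) * (\<integral>\<^sup>+w\<in>ball 0 T. K w * ennreal (radial_density p w) \<partial>lborel)"
    by (rule nn_integral_cmult) measurable
  finally show ?thesis by (simp add: ennreal_mult_cancel_left)
qed

text \<open>Circle means turn \<open>cmod (z - w)\<close> into \<open>max (cmod z) (cmod w)\<close>,
  which leaves an explicit integral over the radius.\<close>

lemma nn_log_potential:
  assumes p: "p > 0" and T: "T > 0" and B: "B \<ge> cmod z + T"
  defines "m \<equiv> max (cmod z) T"
  shows "(\<integral>\<^sup>+w\<in>ball 0 T. ennreal (ln (B / cmod (z - w))) * ennreal (radial_density p w) \<partial>lborel)
     = ennreal (T powr p * ln (B / m) + (m powr p - cmod z powr p) / p)" (is "?L = ennreal ?R")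
proof -
  have B0: "B > 0" using B T by (smt (verit) norm_ge_zero)
  have "?L = (\<integral>\<^sup>+w\<in>ball 0 T. ennreal (ln (B / max (cmod z) (cmod w))) * ennreal (radial_density p w) \<partial>lborel)"
  proof (rule nn_integral_circle_average, measurable)
    show "AE w in lborel. w \<in> ball 0 T \<longrightarrow>
      (\<integral>\<^sup>+t\<in>{0..2*pi}. ennreal (ln (B / cmod (z - cis t * w))) \<partial>lborel)
        = ennreal (2 * pi) * ennreal (ln (B / max (cmod z) (cmod w)))"
      using AE_lborel_norm_neq[of "cmod z"]
    proof eventually_elim
      case (elim w)
      show ?case
      proof
        assume "w \<in> ball 0 T"
        then show "(\<integral>\<^sup>+t\<in>{0..2*pi}. ennreal (ln (B / cmod (z - cis t * w))) \<partial>lborel)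
            = ennreal (2 * pi) * ennreal (ln (B / max (cmod z) (cmod w)))"
          using elim B by (subst nn_circle_mean_ln_dist) (auto intro!: ennreal_mult')
      qed
    qed
  qed
  also have "\<dots> = ennreal ?R"
  proof (rule nn_integral_radial_density[OF p T, of "\<lambda>s. ln (B / max (cmod z) s)"])
    show "((\<lambda>s. ln (B / max (cmod z) s) * (p * s powr (p - 1))) has_integral ?R) {0..T}"
      unfolding m_def by (rule has_integral_log_radial) (use p T B0 in auto)
    fix s :: real assume s: "0 < s" "s < T"
    have "s \<le> B" "cmod z \<le> B" using s B T norm_ge_zero[of z] by linarith+
    then have "max (cmod z) s \<le> B" "max (cmod z) s > 0" using s by auto
    then show "0 \<le> ln (B / max (cmod z) s)" by simp
  qed measurable
  finally show ?thesis .
qed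

text \<open>For \<open>p = 1/\<alpha>\<close> this is the limit measure restricted to a disc, for \<open>p = 2\<close> it is \<open>1/\<pi>\<close> times
  Lebesgue measure on the disc.\<close>

definition radial_measure :: "real \<Rightarrow> real \<Rightarrow> complex measure" where
  "radial_measure p T = density lborel (\<lambda>w. ennreal (radial_density p w * indicator (ball 0 T) w))"

lemma sets_radial_measure [measurable_cong, simp]: "sets (radial_measure p T) = sets borel"
  by (simp add: radial_measure_def)

lemma space_radial_measure [simp]: "space (radial_measure p T) = UNIV"
  by (simp add: radial_measure_def)

lemma nn_integral_radial_measure:
  assumes "f \<in> borel_measurable borel" "p \<ge> 0"
  shows "(\<integral>\<^sup>+w. f w \<partial>radial_measure p T) = (\<integral>\<^sup>+w\<in>ball 0 T. f w * ennreal (radial_density p w) \<partial>lborel)"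
proof -
  have "(\<integral>\<^sup>+w. f w \<partial>radial_measure p T)
      = (\<integral>\<^sup>+w. ennreal (radial_density p w * indicator (ball 0 T) w) * f w \<partial>lborel)"
    unfolding radial_measure_def using assms(1) by (intro nn_integral_density) measurable
  also have "\<dots> = (\<integral>\<^sup>+w\<in>ball 0 T. f w * ennreal (radial_density p w) \<partial>lborel)"
    by (intro nn_integral_cong) (auto simp: indicator_def mult.commute)
  finally show ?thesis .
qed

lemma AE_radial_measure_ball: "AE w in radial_measure p T. w \<in> ball 0 T"
  unfolding radial_measure_def by (subst AE_density) (measurable, auto simp: indicator_def)

lemma AE_radial_measure_neq: "AE w in radial_measure p T. w \<noteq> z"
proof -
  have "AE w::complex in lborel. w \<noteq> z" using AE_lborel_singleton by blast
  then show ?thesis unfolding radial_measure_def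
    by (subst AE_density) (measurable, auto elim!: eventually_mono)
qed

lemma emeasure_radial_measure:
  assumes "p > 0" "T > 0"
  shows "emeasure (radial_measure p T) UNIV = ennreal (T powr p)"
proof -
  have "((\<lambda>s. 1 * (p * s powr (p - 1))) has_integral T powr p) {0..T}"
    using has_integral_mult_right[OF has_integral_powr_from_0[of "p - 1" T], of p] assms by simp
  then have "(\<integral>\<^sup>+w\<in>ball 0 T. ennreal 1 * ennreal (radial_density p w) \<partial>lborel) = ennreal (T powr p)"
    by (intro nn_integral_radial_density[of p T "\<lambda>_. 1"]) (use assms in auto)
  then have "(\<integral>\<^sup>+w. ennreal 1 \<partial>radial_measure p T) = ennreal (T powr p)"
    using assms by (subst nn_integral_radial_measure) auto
  then show ?thesis by simp
qed

lemma finite_measure_radial_measure: "p > 0 \<Longrightarrow> T > 0 \<Longrightarrow> finite_measure (radial_measure p T)"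
  by (rule finite_measureI) (simp add: emeasure_radial_measure)

lemma measure_radial_measure:
  "p > 0 \<Longrightarrow> T > 0 \<Longrightarrow> measure (radial_measure p T) UNIV = T powr p"
  by (simp add: measure_def emeasure_radial_measure)

text \<open>Logarithmic potential of \<open>radial_measure p T\<close> at distance \<open>x\<close>
  from 0. For \<open>x \<ge> T\<close> it is that of the whole mass \<open>T powr p\<close> placed
  at 0; for \<open>x \<le> T\<close> it is \<open>x powr p / p\<close>, the limiting growth, up to a
  constant.\<close>

definition log_potential :: "real \<Rightarrow> real \<Rightarrow> real \<Rightarrow> real" where
  "log_potential p T x = T powr p * ln (max x T) - (max x T powr p - x powr p) / p"

lemma log_potential_radial_measure:
  fixes z :: complex
  assumes p: "p > 0" and T: "T > 0"
  shows "integrable (radial_measure p T) (\<lambda>w. ln (cmod (z - w)))"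
    and "(\<integral>w. ln (cmod (z - w)) \<partial>radial_measure p T) = log_potential p T (cmod z)"
proof -
  interpret finite_measure "radial_measure p T" by (rule finite_measure_radial_measure[OF p T])
  \<comment> \<open>All distances from \<open>z\<close> to the disc are at most \<open>B\<close>, so
    the potential is the integral of the constant \<open>ln B\<close> minus a nonnegative integral
    already known.\<close>
  define B where "B = cmod z + T"
  define m where "m = max (cmod z) T"
  let ?R = "T powr p * ln (B / m) + (m powr p - cmod z powr p) / p"
  have m0: "m > 0" "m \<ge> cmod z" "m \<le> B" and B0: "B > 0" using T unfolding m_def B_def by (auto simp: max_def add_nonneg_pos)
  have R0: "?R \<ge> 0" using m0 p by (intro add_nonneg_nonneg mult_nonneg_nonneg divide_nonneg_nonneg) (auto intro!: powr_mono2)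
  have "(\<integral>\<^sup>+w. ennreal (ln (B / cmod (z - w))) \<partial>radial_measure p T) = ennreal ?R"
    using nn_log_potential[OF p T, where z = z and B = B] p
    by (subst nn_integral_radial_measure) (auto simp: B_def m_def)
  moreover have "AE w in radial_measure p T. 0 \<le> ln (B / cmod (z - w))"
    using AE_radial_measure_ball AE_radial_measure_neq[where p = p and T = T and z = z]
  proof eventually_elim
    case (elim w)
    then have "cmod (z - w) \<le> B" "cmod (z - w) > 0"
      using norm_triangle_ineq4[of z w] by (auto simp: B_def)
    then show ?case by simp
  qed
  ultimately have hb: "has_bochner_integral (radial_measure p T) (\<lambda>w. ln (B / cmod (z - w))) ?R"
    using R0 by (intro has_bochner_integral_nn_integral) auto
  have hc: "has_bochner_integral (radial_measure p T) (\<lambda>w. ln B) (T powr p * ln B)"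
    using measure_radial_measure[OF p T] by (auto simp: has_bochner_integral_iff)
  have "has_bochner_integral (radial_measure p T) (\<lambda>w. ln (cmod (z - w))) (T powr p * ln B - ?R)"
  proof (rule has_bochner_integral_cong_AE[THEN iffD1, OF _ _ _ has_bochner_integral_diff[OF hc hb]])
    show "AE w in radial_measure p T. ln B - ln (B / cmod (z - w)) = ln (cmod (z - w))"
      using AE_radial_measure_neq[where p = p and T = T and z = z] by eventually_elim (use B0 in \<open>simp add: ln_div\<close>)
  qed auto
  moreover have "T powr p * ln B - ?R = log_potential p T (cmod z)"
    using B0 m0 unfolding log_potential_def m_def[symmetric] by (simp add: ln_div algebra_simps)
  ultimately show "integrable (radial_measure p T) (\<lambda>w. ln (cmod (z - w)))"
    and "(\<integral>w. ln (cmod (z - w)) \<partial>radial_measure p T) = log_potential p T (cmod z)"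
    by (auto simp: has_bochner_integral_iff)
qed

section \<open>Jensen's formula averaged over discs\<close>

abbreviation disc_measure :: "real \<Rightarrow> complex measure" where
  "disc_measure r \<equiv> radial_measure 2 r"

lemma disc_measure_eq: "disc_measure r = density lborel (\<lambda>w. ennreal (1 / pi * indicator (ball 0 r) w))"
proof -
  \<comment> \<open>Since \<open>0 powr 0 = 0\<close> in HOL, the two densities differ at the
    origin, but only there.\<close>
  have "AE w::complex in lborel. w \<noteq> 0" using AE_lborel_singleton by blast
  then have "AE w in lborel. ennreal (radial_density 2 w * indicator (ball 0 r) w) = ennreal (1 / pi * indicator (ball 0 r) w)"
    by eventually_elim (simp add: radial_density_def)
  then show ?thesis unfolding radial_measure_def
    by (intro density_cong measurable_compose[OF _ measurable_ennreal] borel_measurable_times borel_measurable_const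
        borel_measurable_indicator) simp_all
qed

text \<open>The mean value property on every circle, averaged over the radii;
  \<open>r\<^sup>2\<close> is the mass of \<open>disc_measure r\<close>. A bound \<open>C\<close> is
  added during the proof to make the integrand nonnegative.\<close>

lemma disc_mean_ln_norm:
  assumes g: "g holomorphic_on UNIV" and r: "0 < r" "r < R" and nz: "\<And>z. z \<in> ball a R \<Longrightarrow> g z \<noteq> 0"
  shows "integrable (disc_measure r) (\<lambda>v. ln (cmod (g (a + v))))"
    and "(\<integral>v. ln (cmod (g (a + v))) \<partial>disc_measure r) = r\<^sup>2 * ln (cmod (g a))"
proof -
  interpret finite_measure "disc_measure r" by (rule finite_measure_radial_measure) (use r in auto)
  have gc: "continuous_on UNIV g" using g holomorphic_on_imp_continuous_on by blast
  have [measurable]: "g \<in> borel_measurable borel"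
    using gc by (rule borel_measurable_continuous_onI)
  have "continuous_on (cball a r) (\<lambda>z. ln (cmod (g z)))"
    using r nz by (intro continuous_intros continuous_on_subset[OF gc]) (auto simp: subset_eq)
  then have "bounded ((\<lambda>z. ln (cmod (g z))) ` cball a r)"
    by (intro compact_imp_bounded compact_continuous_image) auto
  then obtain C where C: "\<And>z. z \<in> cball a r \<Longrightarrow> \<bar>ln (cmod (g z))\<bar> \<le> C"
    unfolding bounded_iff by (metis image_eqI real_norm_def)
  let ?h = "\<lambda>v. ln (cmod (g (a + v))) + C"
  have hnn: "?h v \<ge> 0" if "v \<in> ball 0 r" for v
    using C[of "a + v"] that by (auto simp: dist_norm)
  have [measurable]: "cis \<in> borel_measurable borel"
    by (intro borel_measurable_continuous_onI continuous_intros)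
  have ha: "ln (cmod (g a)) + C \<ge> 0" using hnn[of 0] r by simp
  let ?H = "\<lambda>v. ennreal (?h v) * ennreal (radial_density 2 v) * indicator (ball 0 r) v"
  have circ: "(\<integral>\<^sup>+t\<in>{0..2*pi}. ennreal (?h (cis t * v)) \<partial>lborel) = ennreal (2 * pi * (ln (cmod (g a)) + C))"
    if v: "v \<in> ball 0 r" for v
  proof (rule nn_integral_has_integral_lebesgue')
    show "0 \<le> ?h (cis t * v)" for t using v by (intro hnn) (simp add: norm_mult)
    show "((\<lambda>t. ?h (cis t * v)) has_integral 2 * pi * (ln (cmod (g a)) + C)) {0..2*pi}"
    proof (cases "v = 0")
      case True
      then show ?thesis using has_integral_const_real[of "ln (cmod (g a)) + C" 0 "2*pi"] by simp
    next
      case False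
      have "((\<lambda>t. ln (cmod (g (a + cis t * v)))) has_integral 2 * pi * ln (cmod (g (a + 0 * v)))) {0..2*pi}"
      proof (rule circle_mean_ln_norm[where R = "R / cmod v" and g = "\<lambda>u. g (a + u * v)"])
        have "g \<circ> (\<lambda>u. a + u * v) holomorphic_on ball 0 (R / cmod v)"
          by (intro holomorphic_on_compose holomorphic_intros holomorphic_on_subset[OF g]) auto
        then show "(\<lambda>u. g (a + u * v)) holomorphic_on ball 0 (R / cmod v)" by (simp add: o_def)
        show "1 < R / cmod v" using v r False by simp
        fix u :: complex assume "u \<in> ball 0 (R / cmod v)"
        then show "g (a + u * v) \<noteq> 0"
          using False by (intro nz) (simp add: dist_norm norm_mult field_simps)
      qed
      from has_integral_add[OF this has_integral_const_real[of C 0 "2*pi"]]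
      show ?thesis by (simp add: algebra_simps)
    qed
  qed
  have "(\<integral>\<^sup>+v. ?H v \<partial>lborel) = (\<integral>\<^sup>+v. ennreal (ln (cmod (g a)) + C) * ennreal (radial_density 2 v) * indicator (ball 0 r) v \<partial>lborel)"
  proof (rule nn_integral_circle_average, measurable)
    show "AE v in lborel. v \<in> ball 0 r \<longrightarrow> (\<integral>\<^sup>+t\<in>{0..2*pi}. ennreal (?h (cis t * v)) \<partial>lborel)
        = ennreal (2 * pi) * ennreal (ln (cmod (g a)) + C)"
      using circ ha by (intro AE_I2) (simp add: ennreal_mult)
  qed
  also have "\<dots> = ennreal ((ln (cmod (g a)) + C) * r\<^sup>2)"
    using nn_integral_radial_measure[of "\<lambda>_. ennreal (ln (cmod (g a)) + C)" 2 r] emeasure_radial_measure[of 2 r] r ha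
    by (simp add: ennreal_mult)
  finally have "(\<integral>\<^sup>+v. ?H v \<partial>lborel) = ennreal ((ln (cmod (g a)) + C) * r\<^sup>2)" .
  then have "(\<integral>\<^sup>+v. ennreal (?h v) \<partial>disc_measure r) = ennreal ((ln (cmod (g a)) + C) * r\<^sup>2)"
    by (subst nn_integral_radial_measure) auto
  moreover have "AE v in disc_measure r. 0 \<le> ?h v"
    using AE_radial_measure_ball by eventually_elim (rule hnn)
  ultimately have hb: "has_bochner_integral (disc_measure r) ?h ((ln (cmod (g a)) + C) * r\<^sup>2)"
    using ha by (intro has_bochner_integral_nn_integral) auto
  have hc: "has_bochner_integral (disc_measure r) (\<lambda>w. C) (r\<^sup>2 * C)"
    using measure_radial_measure[of 2 r] r by (auto simp: has_bochner_integral_iff)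
  have "has_bochner_integral (disc_measure r) (\<lambda>v. ln (cmod (g (a + v)))) (r\<^sup>2 * ln (cmod (g a)))"
    using has_bochner_integral_diff[OF hb hc] by (simp add: algebra_simps)
  then show "integrable (disc_measure r) (\<lambda>v. ln (cmod (g (a + v))))"
    and "(\<integral>v. ln (cmod (g (a + v))) \<partial>disc_measure r) = r\<^sup>2 * ln (cmod (g a))"
    by (auto simp: has_bochner_integral_iff)
qed

lemma entire_factor_zeros:
  assumes G: "G holomorphic_on UNIV" and nz: "\<exists>z. G z \<noteq> 0" and A: "finite A"
  shows "\<exists>g. g holomorphic_on UNIV \<and> (\<forall>a\<in>A. g a \<noteq> 0) \<and>
    (\<forall>z. G z = g z * (\<Prod>a\<in>A. (z - a) ^ nat (zorder G a)))"
  using A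
proof (induction A)
  case empty
  then show ?case using G by auto
next
  case (insert b A)
  then obtain g where g: "g holomorphic_on UNIV" "\<forall>a\<in>A. g a \<noteq> 0"
    and Gg: "\<And>z. G z = g z * (\<Prod>a\<in>A. (z - a) ^ nat (zorder G a))" by blast
  define P where "P z = (\<Prod>a\<in>A. (z - a) ^ nat (zorder G a))" for z
  define n where "n = nat (zorder g b)"
  have Pb: "P b \<noteq> 0" unfolding P_def using insert by (auto simp: prod_zero_iff)
  have Ph: "P holomorphic_on UNIV" unfolding P_def[abs_def] by (intro holomorphic_intros)
  have gnz: "\<exists>w\<in>UNIV. g w \<noteq> 0" using nz Gg by auto
  obtain r where r: "r > 0" and zp: "zor_poly g b holomorphic_on cball b r"
    and eq: "\<And>w. w \<in> cball b r \<Longrightarrow> g w = zor_poly g b w * (w - b) ^ n \<and> zor_poly g b w \<noteq> 0"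
    using conjunct2[OF zorder_exist_zero[OF g(1) open_UNIV connected_UNIV UNIV_I gnz, of b]] unfolding n_def by blast
  \<comment> \<open>The quotient by \<open>(z - b) ^ n\<close>, continued across its removable
    singularity by \<open>zor_poly\<close>; for a point that is not a zero this covers
    \<open>n = 0\<close>.\<close>
  define h where "h z = (if z \<in> ball b r then zor_poly g b z else g z / (z - b) ^ n)" for z
  have h1: "h z = zor_poly g b z" if "z \<in> ball b r" for z using that by (simp add: h_def)
  have h2: "h z = g z / (z - b) ^ n" if "z \<noteq> b" for z
    using eq[of z] that by (auto simp: h_def)
  have "h holomorphic_on ball b r"
    using holomorphic_on_subset[OF zp ball_subset_cball] h1 by (subst holomorphic_cong[OF refl, of _ h "zor_poly g b"]) auto
  moreover have "h holomorphic_on (- {b})"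
  proof (subst holomorphic_cong[OF refl, of _ h "\<lambda>z. g z / (z - b) ^ n"])
    show "(\<lambda>z. g z / (z - b) ^ n) holomorphic_on - {b}"
      by (intro holomorphic_intros holomorphic_on_subset[OF g(1)]) auto
  qed (use h2 in auto)
  ultimately have "h holomorphic_on (ball b r \<union> - {b})"
    by (intro holomorphic_on_Un) auto
  also have "ball b r \<union> - {b} = UNIV" using r by auto
  finally have hh: "h holomorphic_on UNIV" .
  have gh: "g z = h z * (z - b) ^ n" for z
    using eq[of z] h1[of z] h2[of z] r by (cases "z = b") (auto simp: h_def)
  have hb: "h b \<noteq> 0" using h1[of b] eq[of b] r by auto
  have hA: "h a \<noteq> 0" if "a \<in> A" for a using g(2) gh[of a] that by auto
  \<comment> \<open>\<open>n\<close> was read off from \<open>g\<close>, from which other zeros are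
    already divided out. It is also the order of \<open>G\<close>, because the removed factor
    \<open>P\<close> does not vanish at \<open>b\<close>.\<close>
  have "zorder G b = int n"
  proof (rule zorder_eqI[of UNIV b "\<lambda>z. h z * P z"])
    show "(\<lambda>z. h z * P z) holomorphic_on UNIV" by (intro holomorphic_intros hh Ph)
    show "h b * P b \<noteq> 0" using hb Pb by simp
    show "G w = h w * P w * (w - b) powi int n" for w
      using Gg[of w] gh[of w] by (simp add: P_def power_int_of_nat)
  qed auto
  then have "nat (zorder G b) = n" by simp
  then have "G z = h z * (\<Prod>a\<in>insert b A. (z - a) ^ nat (zorder G a))" for z
    using insert.hyps Gg[of z] gh[of z] by simp
  then show ?case using hh hb hA by blast
qed

text \<open>Jensen's formula averaged over a disc: the zeros of \<open>f\<close> enter the mean of \<open>log \<bar>f\<bar>\<close> through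
  this kernel.\<close>

definition disc_kernel :: "real \<Rightarrow> complex \<Rightarrow> real" where
  "disc_kernel r w = log_potential 2 r (cmod w) / r\<^sup>2 - ln (cmod w)"

lemma disc_mean_ln_norm_factored:
  assumes g: "g holomorphic_on UNIV" and r: "0 < r" "r < R" and nz: "\<And>z. z \<in> ball a R \<Longrightarrow> g z \<noteq> 0"
    and A: "finite A" and f: "\<And>z. f z = g z * (\<Prod>i\<in>A. (z - b i) ^ m i)" and fa: "f a \<noteq> 0"
  shows "integrable (disc_measure r) (\<lambda>v. ln (cmod (f (a + v))))"
    and "(\<integral>v. ln (cmod (f (a + v))) \<partial>disc_measure r) = r\<^sup>2 * (ln (cmod (f a)) + (\<Sum>i\<in>A. m i * disc_kernel r (b i - a)))"
proof -
  \<comment> \<open>The alternative \<open>m i = 0\<close> is there for the point \<open>a\<close>: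
    from \<open>f a \<noteq> 0\<close> it only follows that \<open>a\<close> differs from those
    \<open>b i\<close> that occur with positive exponent.\<close>
  have ln_f: "ln (cmod (f z)) = ln (cmod (g z)) + (\<Sum>i\<in>A. m i * ln (cmod (b i - z)))"
    if "g z \<noteq> 0" "\<forall>i\<in>A. m i = 0 \<or> z \<noteq> b i" for z
  proof -
    have "ln (cmod (\<Prod>i\<in>A. (z - b i) ^ m i)) = (\<Sum>i\<in>A. ln (cmod ((z - b i) ^ m i)))"
      unfolding prod_norm[symmetric] by (rule ln_prod[OF A]) (use that in auto)
    also have "\<dots> = (\<Sum>i\<in>A. m i * ln (cmod (b i - z)))"
      by (intro sum.cong) (use that in \<open>auto simp: norm_power ln_realpow norm_minus_commute\<close>)
    finally have *: "ln (cmod (\<Prod>i\<in>A. (z - b i) ^ m i)) = (\<Sum>i\<in>A. m i * ln (cmod (b i - z)))" .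
    have "(\<Prod>i\<in>A. (z - b i) ^ m i) \<noteq> 0" using that A by (auto simp: prod_zero_iff)
    then show ?thesis unfolding f using that(1) by (simp add: norm_mult ln_mult *)
  qed
  have hb: "has_bochner_integral (disc_measure r) (\<lambda>v. ln (cmod (g (a + v))) + (\<Sum>i\<in>A. m i * ln (cmod ((b i - a) - v))))
     (r\<^sup>2 * ln (cmod (g a)) + (\<Sum>i\<in>A. m i * log_potential 2 r (cmod (b i - a))))"
    using disc_mean_ln_norm[OF g r nz] log_potential_radial_measure[of 2 r] r
    by (intro has_bochner_integral_add has_bochner_integral_sum has_bochner_integral_mult_right) (auto simp: has_bochner_integral_iff)
  have "has_bochner_integral (disc_measure r) (\<lambda>v. ln (cmod (f (a + v))))
     (r\<^sup>2 * ln (cmod (g a)) + (\<Sum>i\<in>A. m i * log_potential 2 r (cmod (b i - a))))"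
  proof (rule has_bochner_integral_cong_AE[THEN iffD1, OF _ _ _ hb])
    have "AE v in disc_measure r. \<forall>i\<in>A. v \<noteq> b i - a"
      using A by (intro AE_finite_allI AE_radial_measure_neq)
    then show "AE v in disc_measure r. ln (cmod (g (a + v))) + (\<Sum>i\<in>A. m i * ln (cmod ((b i - a) - v))) = ln (cmod (f (a + v)))"
      using AE_radial_measure_ball
    proof eventually_elim
      case (elim v)
      then show ?case using r
        by (subst ln_f) (auto intro!: nz simp: dist_norm algebra_simps)
    qed
    have gc: "g \<in> borel_measurable borel"
      using g holomorphic_on_imp_continuous_on borel_measurable_continuous_onI by blast
    then have [measurable]: "f \<in> borel_measurable borel"
      unfolding f[abs_def] by measurable
    show "(\<lambda>v. ln (cmod (f (a + v)))) \<in> borel_measurable (disc_measure r)" by measurable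
  qed (use hb in auto)
  moreover have "r\<^sup>2 * ln (cmod (g a)) + (\<Sum>i\<in>A. m i * log_potential 2 r (cmod (b i - a)))
     = r\<^sup>2 * (ln (cmod (f a)) + (\<Sum>i\<in>A. m i * disc_kernel r (b i - a)))"
  proof -
    have nz: "g a \<noteq> 0" "\<forall>i\<in>A. m i = 0 \<or> a \<noteq> b i" using fa A unfolding f by (auto simp: prod_zero_iff)
    show ?thesis
      unfolding ln_f[OF nz] disc_kernel_def using r
      by (simp add: sum_distrib_left sum_subtractf[symmetric] sum.distrib[symmetric] algebra_simps add_divide_distrib power2_eq_square)
  qed
  ultimately show "integrable (disc_measure r) (\<lambda>v. ln (cmod (f (a + v))))"
    and "(\<integral>v. ln (cmod (f (a + v))) \<partial>disc_measure r) = r\<^sup>2 * (ln (cmod (f a)) + (\<Sum>i\<in>A. m i * disc_kernel r (b i - a)))"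
    by (auto simp: has_bochner_integral_iff)
qed

section \<open>The disc kernel\<close>

text \<open>For \<open>w\<close> outside the disc the function \<open>ln (cmod (w - v))\<close> is
  harmonic in \<open>v\<close> on the disc, so mean and central value agree. This makes the
  smoothing local.\<close>

lemma disc_kernel_outside: "r > 0 \<Longrightarrow> r \<le> cmod w \<Longrightarrow> disc_kernel r w = 0"
  by (simp add: disc_kernel_def log_potential_def max_def)

lemma disc_kernel_inside:
  assumes "r > 0" "cmod w < r" "w \<noteq> 0"
  shows "disc_kernel r w = ln (r / cmod w) - (1 - (cmod w / r)\<^sup>2) / 2"
proof -
  have "log_potential 2 r (cmod w) = r\<^sup>2 * ln r - (r\<^sup>2 - (cmod w)\<^sup>2) / 2"
    using assms by (simp add: log_potential_def max_def)
  then show ?thesis using assms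
    by (simp add: disc_kernel_def ln_div diff_divide_distrib power_divide)
qed

text \<open>With \<open>u = cmod w / r\<close> this is
  \<open>ln (u\<^sup>2) \<le> u\<^sup>2 - 1\<close>, the sub-mean value property of the logarithm.
  At \<open>w = 0\<close> the true value is infinite, whereas \<open>ln 0 = 0\<close> in HOL leaves
  \<open>ln r - 1 / 2\<close>, possibly negative; hence the exclusion of the origin here and the
  almost-everywhere statements later.\<close>

lemma disc_kernel_nonneg:
  assumes "r > 0" "w \<noteq> 0"
  shows "disc_kernel r w \<ge> 0"
proof (cases "cmod w < r")
  case True
  let ?u = "cmod w / r"
  have u: "?u > 0" using assms by simp
  have "ln (?u\<^sup>2) \<le> ?u\<^sup>2 - 1" using u by (intro ln_le_minus_one zero_less_power)
  then have "2 * ln ?u \<le> ?u\<^sup>2 - 1" using assms by (simp add: ln_realpow)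
  moreover have "ln (r / cmod w) = - ln ?u" using assms by (simp add: ln_div)
  ultimately show ?thesis using disc_kernel_inside[OF assms(1) True assms(2)] by simp
qed (use assms disc_kernel_outside in auto)

text \<open>The constant is \<open>2 / 3 - 1 / 2\<close>, from \<open>ln 2 \<ge> 2 / 3\<close>. Any
  positive constant would serve to count zeros by means of the kernel.\<close>

lemma disc_kernel_lower:
  assumes "r > 0" "w \<noteq> 0" "cmod w \<le> r / 2"
  shows "disc_kernel r w \<ge> 1 / 6"
proof -
  have "2 \<le> r / cmod w" using assms by (simp add: field_simps)
  then have "ln 2 \<le> ln (r / cmod w)" by simp
  moreover have "ln (2::real) \<ge> 2/3" using ln2_ge_two_thirds by simp
  moreover have lt: "cmod w < r" using assms by simp
  moreover have "(cmod w / r)\<^sup>2 \<ge> 0" by simp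
  moreover have "1 / 6 \<le> L - (1 - q) / 2" if "l \<le> L" "2 / 3 \<le> l" "0 \<le> q" for l L q :: real
    using that by argo
  ultimately show ?thesis
    unfolding disc_kernel_inside[OF assms(1) lt assms(2)] by blast
qed

lemma borel_measurable_log_potential [measurable]: "log_potential p T \<in> borel_measurable borel"
  unfolding log_potential_def[abs_def] by measurable

lemma borel_measurable_disc_kernel [measurable]: "disc_kernel r \<in> borel_measurable borel"
  unfolding disc_kernel_def[abs_def] by measurable

lemma AE_lborel_neq: "AE w in lborel. w \<noteq> (z :: complex)"
  using AE_lborel_singleton by blast

lemma integrable_disc_measure_iff:
  fixes f :: "complex \<Rightarrow> real"
  assumes [measurable]: "f \<in> borel_measurable borel"
  shows "integrable (disc_measure r) f \<longleftrightarrow> integrable lborel (\<lambda>w. indicator (ball 0 r) w * f w)"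
proof -
  have "integrable (disc_measure r) f \<longleftrightarrow> integrable lborel (\<lambda>w. (1 / pi * indicator (ball 0 r) w) *\<^sub>R f w)"
    unfolding disc_measure_eq by (rule integrable_density) (auto intro!: borel_measurable_divide borel_measurable_indicator)
  also have "\<dots> \<longleftrightarrow> integrable lborel (\<lambda>w. (1 / pi) * (indicator (ball 0 r) w * f w))"
    by (simp add: mult.assoc)
  also have "\<dots> \<longleftrightarrow> integrable lborel (\<lambda>w. indicator (ball 0 r) w * f w)"
    by (rule integrable_mult_left_iff[THEN trans]) simp
  finally show ?thesis .
qed

lemma integrable_disc_kernel:
  assumes r: "r > 0"
  shows "integrable lborel (disc_kernel r)"
proof -
  interpret finite_measure "disc_measure r" by (rule finite_measure_radial_measure) (use r in auto)
  have 1: "integrable (disc_measure r) (\<lambda>w. log_potential 2 r (cmod w) / r\<^sup>2)"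
  proof (rule integrable_const_bound)
    show "AE w in disc_measure r. norm (log_potential 2 r (cmod w) / r\<^sup>2) \<le> \<bar>ln r\<bar> + 1"
      using AE_radial_measure_ball
    proof eventually_elim
      case (elim w)
      then have w: "cmod w < r" by simp
      define q where "q = (cmod w / r)\<^sup>2"
      have "log_potential 2 r (cmod w) / r\<^sup>2 = ln r - (1 - q) / 2" unfolding q_def
        using r w by (simp add: log_potential_def max_def diff_divide_distrib power_divide)
      moreover have "0 \<le> q" "q \<le> 1" unfolding q_def
        using w r by (auto intro!: power_le_one)
      moreover have "\<bar>ln r - (1 - q) / 2\<bar> \<le> \<bar>ln r\<bar> + 1" if "0 \<le> q" "q \<le> 1" for q
        using that by (auto simp: abs_if)
      ultimately show ?case by simp
    qed
  qed measurable
  have 2: "integrable (disc_measure r) (\<lambda>w. ln (cmod w))"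
    using log_potential_radial_measure(1)[of 2 r 0] r by simp
  have "integrable (disc_measure r) (disc_kernel r)"
    unfolding disc_kernel_def[abs_def] by (rule Bochner_Integration.integrable_diff[OF 1 2])
  then have "integrable lborel (\<lambda>w. indicator (ball 0 r) w * disc_kernel r w)"
    by (subst (asm) integrable_disc_measure_iff) auto
  also have "(\<lambda>w. indicator (ball 0 r) w * disc_kernel r w) = disc_kernel r"
    using disc_kernel_outside[OF r] by (auto simp: fun_eq_iff indicator_def)
  finally show ?thesis .
qed

lemma integral_disc_kernel_pos:
  assumes r: "r > 0"
  shows "(\<integral>w. disc_kernel r w \<partial>lborel) > 0"
proof -
  have i: "integrable lborel (\<lambda>w. 1 / 6 * indicator (ball (0::complex) (r / 2)) w :: real)"
    using r by (intro integrable_mult_right integrable_real_indicator) (auto simp: emeasure_ball_complex)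
  have "0 < 1 / 6 * measure lborel (ball (0::complex) (r / 2))"
    using r by simp
  also have "\<dots> = (\<integral>w. 1 / 6 * indicator (ball (0::complex) (r / 2)) w \<partial>lborel)"
    by simp
  also have "\<dots> \<le> (\<integral>w. disc_kernel r w \<partial>lborel)"
  proof (rule integral_mono_AE[OF i integrable_disc_kernel[OF r]])
    show "AE w in lborel. 1 / 6 * indicator (ball 0 (r / 2)) w \<le> disc_kernel r w"
      using AE_lborel_neq[of 0]
    proof eventually_elim
      case (elim w)
      then show ?case
        using disc_kernel_lower[OF r, of w] disc_kernel_nonneg[OF r, of w] by (auto simp: indicator_def)
    qed
  qed
  finally show ?thesis .
qed

section \<open>Convolution with the disc kernel\<close>

lemma lborel_integral_reflect_shift:
  fixes f :: "complex \<Rightarrow> real"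
  assumes [measurable]: "f \<in> borel_measurable borel"
  shows "(\<integral>a. f (w - a) \<partial>lborel) = (\<integral>a. f a \<partial>lborel)"
    and "integrable lborel (\<lambda>a. f (w - a)) \<longleftrightarrow> integrable lborel f"
proof -
  have d: "distr lborel borel (\<lambda>a::complex. w - a) = lborel"
  proof -
    have "distr lborel borel (\<lambda>a::complex. w - a) = distr (distr lborel borel (\<lambda>a. (-1) * a)) borel (\<lambda>a. w + a)"
      by (subst distr_distr) (auto simp: comp_def)
    also have "\<dots> = lborel"
      by (subst distr_lborel_rotation) (simp_all add: lborel_distr_plus)
    finally show ?thesis .
  qed
  have "(\<integral>a. f a \<partial>distr lborel borel (\<lambda>a::complex. w - a)) = (\<integral>a. f (w - a) \<partial>lborel)"
    by (rule integral_distr) measurable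
  then show "(\<integral>a. f (w - a) \<partial>lborel) = (\<integral>a. f a \<partial>lborel)" unfolding d by simp
  have "integrable (distr lborel borel (\<lambda>a::complex. w - a)) f \<longleftrightarrow> integrable lborel (\<lambda>a. f (w - a))"
    by (rule integrable_distr_eq) measurable
  then show "integrable lborel (\<lambda>a. f (w - a)) \<longleftrightarrow> integrable lborel f" unfolding d by simp
qed

text \<open>Fubini moves the kernel from \<mu> to \<phi>. The convolution of \<phi> with the kernel
  is within \<open>C * e\<close> of \<open>C * \<phi>\<close> at every point, because the kernel is
  nonnegative, has integral \<open>C\<close> and vanishes at distances of \<open>r\<close> or more.
  The kernel is unbounded, but its integral in \<open>a\<close> is \<open>C\<close> for each
  \<open>w\<close>, which yields joint integrability.\<close>

lemma kernel_smoothing: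
  fixes \<phi> :: "complex \<Rightarrow> real"
  assumes mu: "finite_measure \<mu>" "sets \<mu> = sets borel" and r: "r > 0"
    and phi: "\<phi> \<in> borel_measurable borel" "\<And>x. \<bar>\<phi> x\<bar> \<le> B"
    and osc: "\<And>x y. dist x y \<le> r \<Longrightarrow> \<bar>\<phi> x - \<phi> y\<bar> \<le> e"
  defines "C \<equiv> (\<integral>w. disc_kernel r w \<partial>lborel)"
  shows "\<bar>C * (\<integral>w. \<phi> w \<partial>\<mu>) - (\<integral>a. \<phi> a * (\<integral>w. disc_kernel r (w - a) \<partial>\<mu>) \<partial>lborel)\<bar>
     \<le> C * e * measure \<mu> UNIV"
    and "integrable lborel (\<lambda>a. \<phi> a * (\<integral>w. disc_kernel r (w - a) \<partial>\<mu>))"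
proof -
  interpret finite_measure \<mu> by (rule mu)
  interpret pair_sigma_finite \<mu> "lborel :: complex measure" ..
  note [measurable_cong] = mu(2)
  note [measurable] = phi(1)
  have space: "space \<mu> = UNIV" using sets_eq_imp_space_eq[OF mu(2)] by simp
  have C: "C > 0" unfolding C_def by (rule integral_disc_kernel_pos[OF r])
  have e: "e \<ge> 0" using osc[of 0 0] r by simp
  have B: "B \<ge> 0" using phi(2)[of 0] by linarith
  have kint: "integrable lborel (\<lambda>a. disc_kernel r (w - a))" "(\<integral>a. disc_kernel r (w - a) \<partial>lborel) = C"
    "AE a in lborel. disc_kernel r (w - a) \<ge> 0" for w
  proof -
    show "integrable lborel (\<lambda>a. disc_kernel r (w - a))" "(\<integral>a. disc_kernel r (w - a) \<partial>lborel) = C"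
      unfolding C_def using integrable_disc_kernel[OF r] by (subst lborel_integral_reflect_shift; simp)+
    show "AE a in lborel. disc_kernel r (w - a) \<ge> 0"
      using AE_lborel_neq[of w] by eventually_elim (rule disc_kernel_nonneg[OF r], auto)
  qed
  have pint: "integrable lborel (\<lambda>a. \<phi> a * disc_kernel r (w - a))" for w
  proof (rule Bochner_Integration.integrable_bound[OF integrable_mult_right[OF kint(1)[of w], of B]])
    show "AE a in lborel. norm (\<phi> a * disc_kernel r (w - a)) \<le> norm (B * disc_kernel r (w - a))"
      using phi(2) B by (intro AE_I2) (auto simp: abs_mult intro!: mult_right_mono)
  qed measurable
  let ?f = "\<lambda>(w, a). \<phi> a * disc_kernel r (w - a)"
  have int: "integrable (\<mu> \<Otimes>\<^sub>M lborel) ?f"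
  proof (rule Fubini_integrable)
    show "integrable \<mu> (\<lambda>w. \<integral>a. norm (?f (w, a)) \<partial>lborel)"
    proof (rule integrable_const_bound)
      show "AE w in \<mu>. norm (\<integral>a. norm (?f (w, a)) \<partial>lborel) \<le> B * C"
      proof (rule AE_I2)
        fix w
        have "norm (\<integral>a. norm (?f (w, a)) \<partial>lborel) = (\<integral>a. norm (?f (w, a)) \<partial>lborel)" by simp
        also have "\<dots> \<le> (\<integral>a. B * disc_kernel r (w - a) \<partial>lborel)"
        proof (rule integral_mono_AE)
          show "AE a in lborel. norm (?f (w, a)) \<le> B * disc_kernel r (w - a)"
            using kint(3)[of w] by eventually_elim (use phi(2) in \<open>auto simp: abs_mult intro!: mult_right_mono\<close>)
        qed (use pint[of w] kint(1)[of w] in auto)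
        also have "\<dots> = B * C" using kint(2)[of w] by simp
        finally show "norm (\<integral>a. norm (?f (w, a)) \<partial>lborel) \<le> B * C" .
      qed
    qed measurable
    show "AE w in \<mu>. integrable lborel (\<lambda>a. ?f (w, a))" using pint by simp
  qed measurable
  show "integrable lborel (\<lambda>a. \<phi> a * (\<integral>w. disc_kernel r (w - a) \<partial>\<mu>))"
    using integrable_snd[OF int] by simp
  have "(\<integral>a. \<phi> a * (\<integral>w. disc_kernel r (w - a) \<partial>\<mu>) \<partial>lborel) = (\<integral>a. (\<integral>w. \<phi> a * disc_kernel r (w - a) \<partial>\<mu>) \<partial>lborel)"
    by simp
  also have "\<dots> = (\<integral>w. (\<integral>a. \<phi> a * disc_kernel r (w - a) \<partial>lborel) \<partial>\<mu>)"
    by (rule Fubini_integral[OF int])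
  finally have eq: "(\<integral>a. \<phi> a * (\<integral>w. disc_kernel r (w - a) \<partial>\<mu>) \<partial>lborel)
      = (\<integral>w. (\<integral>a. \<phi> a * disc_kernel r (w - a) \<partial>lborel) \<partial>\<mu>)" .
  have pw: "\<bar>C * \<phi> w - (\<integral>a. \<phi> a * disc_kernel r (w - a) \<partial>lborel)\<bar> \<le> C * e" for w
  proof -
    have "C * \<phi> w - (\<integral>a. \<phi> a * disc_kernel r (w - a) \<partial>lborel)
        = (\<integral>a. \<phi> w * disc_kernel r (w - a) - \<phi> a * disc_kernel r (w - a) \<partial>lborel)"
      using kint(1,2)[of w] pint[of w] by (subst Bochner_Integration.integral_diff) auto
    also have "\<bar>\<dots>\<bar> \<le> (\<integral>a. \<bar>\<phi> w * disc_kernel r (w - a) - \<phi> a * disc_kernel r (w - a)\<bar> \<partial>lborel)"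
      by (rule integral_abs_bound)
    also have "\<dots> \<le> (\<integral>a. e * disc_kernel r (w - a) \<partial>lborel)"
    proof (rule integral_mono_AE)
      show "AE a in lborel. \<bar>\<phi> w * disc_kernel r (w - a) - \<phi> a * disc_kernel r (w - a)\<bar> \<le> e * disc_kernel r (w - a)"
        using kint(3)[of w]
      proof eventually_elim
        case (elim a)
        show ?case
        proof (cases "dist w a \<le> r")
          case True
          have "\<bar>\<phi> w * disc_kernel r (w - a) - \<phi> a * disc_kernel r (w - a)\<bar> = \<bar>\<phi> w - \<phi> a\<bar> * disc_kernel r (w - a)"
            using elim by (simp add: left_diff_distrib[symmetric] abs_mult)
          then show ?thesis using osc[OF True] elim by (simp add: mult_right_mono)
        next
          case False
          then have "disc_kernel r (w - a) = 0"
            by (intro disc_kernel_outside[OF r]) (simp add: dist_norm)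
          then show ?thesis by simp
        qed
      qed
    qed (use kint(1)[of w] pint[of w] in auto)
    also have "\<dots> = C * e" using kint(2)[of w] by simp
    finally show ?thesis .
  qed
  have phii: "integrable \<mu> \<phi>" using phi(2) by (intro integrable_const_bound[of _ B]) auto
  have inn: "integrable \<mu> (\<lambda>w. \<integral>a. \<phi> a * disc_kernel r (w - a) \<partial>lborel)"
    using integrable_fst[OF int] by simp
  have "\<bar>C * (\<integral>w. \<phi> w \<partial>\<mu>) - (\<integral>w. (\<integral>a. \<phi> a * disc_kernel r (w - a) \<partial>lborel) \<partial>\<mu>)\<bar>
      = \<bar>\<integral>w. C * \<phi> w - (\<integral>a. \<phi> a * disc_kernel r (w - a) \<partial>lborel) \<partial>\<mu>\<bar>"
    using phii inn by simp
  also have "\<dots> \<le> (\<integral>w. \<bar>C * \<phi> w - (\<integral>a. \<phi> a * disc_kernel r (w - a) \<partial>lborel)\<bar> \<partial>\<mu>)"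
    by (rule integral_abs_bound)
  also have "\<dots> \<le> (\<integral>w. C * e \<partial>\<mu>)"
    using phii inn pw by (intro integral_mono) auto
  also have "\<dots> = C * e * measure \<mu> UNIV" by (simp add: space mult.commute)
  finally show "\<bar>C * (\<integral>w. \<phi> w \<partial>\<mu>) - (\<integral>a. \<phi> a * (\<integral>w. disc_kernel r (w - a) \<partial>\<mu>) \<partial>lborel)\<bar>
     \<le> C * e * measure \<mu> UNIV" unfolding eq .
qed

text \<open>On \<open>ball 0 T\<close> the function \<open>cmod z powr p / p\<close> is the
  potential of \<open>radial_measure p T\<close> minus the constant \<open>K\<close>. Exchanging the
  two integrals gives the potentials of the disc, and \<open>K\<close> cancels against the central
  value.\<close>

lemma disc_mean_radial_potential:
  fixes a :: complex
  assumes p: "p > 0" and r: "r > 0" and a: "cmod a + r < T"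
  shows "integrable (disc_measure r) (\<lambda>v. cmod (a + v) powr p / p)"
    and "(\<integral>v. cmod (a + v) powr p / p \<partial>disc_measure r) / r\<^sup>2 - cmod a powr p / p
       = (\<integral>w. disc_kernel r (w - a) \<partial>radial_measure p T)"
proof -
  have T: "T > 0" using a r by (smt (verit) norm_ge_zero)
  interpret D: finite_measure "disc_measure r" by (rule finite_measure_radial_measure) (use r in auto)
  interpret N: finite_measure "radial_measure p T" by (rule finite_measure_radial_measure) (use p T in auto)
  interpret P: pair_sigma_finite "disc_measure r" "radial_measure p T" ..
  define K where "K = T powr p * ln T - T powr p / p"
  have pot: "(\<integral>w. ln (cmod (z - w)) \<partial>radial_measure p T) = cmod z powr p / p + K" if "cmod z \<le> T" for z
    using that p by (subst log_potential_radial_measure(2)[OF p T]) (simp add: log_potential_def max_def K_def diff_divide_distrib)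
  have inner: "(\<integral>v. ln (cmod (a + v - w)) \<partial>disc_measure r) = log_potential 2 r (cmod (w - a))" for w
  proof -
    have "cmod (a + v - w) = cmod ((w - a) - v)" for v by (metis diff_diff_eq norm_minus_commute)
    then show ?thesis using log_potential_radial_measure(2)[of 2 r "w - a"] r by simp
  qed
  define B where "B = 2 * T"
  let ?f = "\<lambda>(v, w). ln (cmod (a + v - w))"
  have int: "integrable (disc_measure r \<Otimes>\<^sub>M radial_measure p T) ?f"
  proof (rule P.Fubini_integrable)
    show "integrable (disc_measure r) (\<lambda>v. \<integral>w. norm (?f (v, w)) \<partial>radial_measure p T)"
    proof (rule D.integrable_const_bound)
      show "AE v in disc_measure r. norm (\<integral>w. norm (?f (v, w)) \<partial>radial_measure p T)
          \<le> 2 * \<bar>ln B\<bar> * T powr p + \<bar>K\<bar>"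
        using AE_radial_measure_ball
      proof eventually_elim
        case (elim v)
        then have av: "cmod (a + v) \<le> T" using a norm_triangle_ineq[of a v] by simp
        note lp = log_potential_radial_measure(1)[OF p T, of "a + v"]
        have "(\<integral>w. norm (?f (v, w)) \<partial>radial_measure p T) \<le> (\<integral>w. \<bar>ln B\<bar> + (\<bar>ln B\<bar> - ln (cmod (a + v - w))) \<partial>radial_measure p T)"
        proof (rule integral_mono_AE)
          show "AE w in radial_measure p T. norm (?f (v, w)) \<le> \<bar>ln B\<bar> + (\<bar>ln B\<bar> - ln (cmod (a + v - w)))"
            using AE_radial_measure_ball AE_radial_measure_neq[where z = "a + v" and p = p and T = T]
          proof eventually_elim
            case (elim w)
            then have "cmod (a + v - w) \<le> B" "cmod (a + v - w) > 0"
              using av norm_triangle_ineq4[of "a + v" w] by (auto simp: B_def)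
            then have "ln (cmod (a + v - w)) \<le> ln B" using T by (simp add: B_def)
            then show ?case by simp
          qed
        qed (use lp in auto)
        also have "\<dots> = 2 * \<bar>ln B\<bar> * T powr p - (cmod (a + v) powr p / p + K)"
          using lp pot[OF av] measure_radial_measure[OF p T] by simp
        also have "\<dots> \<le> 2 * \<bar>ln B\<bar> * T powr p + \<bar>K\<bar>" using divide_nonneg_pos[OF powr_ge_zero[of "cmod (a + v)" p] p] by linarith
        finally show ?case by simp
      qed
    qed measurable
    show "AE v in disc_measure r. integrable (radial_measure p T) (\<lambda>w. ?f (v, w))"
      using log_potential_radial_measure(1)[OF p T] by simp
  qed measurable
  have AEeq: "AE v in disc_measure r. (\<integral>w. ln (cmod (a + v - w)) \<partial>radial_measure p T) = cmod (a + v) powr p / p + K"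
    using AE_radial_measure_ball
  proof eventually_elim
    case (elim v)
    then show ?case using a norm_triangle_ineq[of a v] by (intro pot) simp
  qed
  have i1: "integrable (disc_measure r) (\<lambda>v. cmod (a + v) powr p / p + K)"
    using P.integrable_fst[OF int] by (rule integrable_cong_AE_imp) (use AEeq in auto)
  then show i2: "integrable (disc_measure r) (\<lambda>v. cmod (a + v) powr p / p)"
    using Bochner_Integration.integrable_diff[OF i1, of "\<lambda>_. K"] by simp
  have "(\<integral>v. cmod (a + v) powr p / p \<partial>disc_measure r) + r\<^sup>2 * K
      = (\<integral>v. cmod (a + v) powr p / p + K \<partial>disc_measure r)"
    using i2 measure_radial_measure[of 2 r] r by simp
  also have "\<dots> = (\<integral>v. (\<integral>w. ln (cmod (a + v - w)) \<partial>radial_measure p T) \<partial>disc_measure r)"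
    using AEeq by (intro integral_cong_AE) auto
  also have "\<dots> = (\<integral>w. (\<integral>v. ln (cmod (a + v - w)) \<partial>disc_measure r) \<partial>radial_measure p T)"
    using P.Fubini_integral[OF int] by simp
  also have "\<dots> = (\<integral>w. log_potential 2 r (cmod (w - a)) \<partial>radial_measure p T)" by (simp only: inner)
  finally have A: "(\<integral>v. cmod (a + v) powr p / p \<partial>disc_measure r) + r\<^sup>2 * K
      = (\<integral>w. log_potential 2 r (cmod (w - a)) \<partial>radial_measure p T)" .
  have "integrable (radial_measure p T) (\<lambda>w. \<integral>v. ln (cmod (a + v - w)) \<partial>disc_measure r)"
    using P.integrable_snd[OF int] by simp
  then have j1: "integrable (radial_measure p T) (\<lambda>w. log_potential 2 r (cmod (w - a)))"
    by (simp only: inner)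
  have "(\<integral>w. ln (cmod (w - a)) \<partial>radial_measure p T) = cmod a powr p / p + K"
    using pot[of a] a r by (simp add: norm_minus_commute)
  moreover have j2: "integrable (radial_measure p T) (\<lambda>w. ln (cmod (w - a)))"
    using log_potential_radial_measure(1)[OF p T, of a] by (simp add: norm_minus_commute)
  ultimately have "(\<integral>w. disc_kernel r (w - a) \<partial>radial_measure p T)
      = ((\<integral>v. cmod (a + v) powr p / p \<partial>disc_measure r) + r\<^sup>2 * K) / r\<^sup>2 - (cmod a powr p / p + K)"
    unfolding disc_kernel_def A using j1 j2 by simp
  also have "\<dots> = (\<integral>v. cmod (a + v) powr p / p \<partial>disc_measure r) / r\<^sup>2 - cmod a powr p / p"
    using r by (simp add: add_divide_distrib)
  finally show "(\<integral>v. cmod (a + v) powr p / p \<partial>disc_measure r) / r\<^sup>2 - cmod a powr p / p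
       = (\<integral>w. disc_kernel r (w - a) \<partial>radial_measure p T)" by simp
qed

section \<open>Zeros of functions with given logarithmic asymptotics\<close>

lemma finite_zeros_ball:
  assumes f: "f holomorphic_on UNIV" and nz: "\<exists>z. f z \<noteq> (0::complex)"
  shows "finite {z \<in> ball 0 T. f z = 0}"
proof (cases "\<exists>z. f z = 0")
  case True
  have "\<not> f constant_on UNIV" using True nz unfolding constant_on_def by (metis UNIV_I)
  then have "finite {z \<in> cball 0 T. f z = 0}"
    by (intro holomorphic_compact_finite_zeros[OF f open_UNIV connected_UNIV]) auto
  then show ?thesis by (rule rev_finite_subset) auto
qed auto

lemma AE_nonzero_ball:
  assumes f: "f holomorphic_on UNIV" and nz: "\<exists>z. f z \<noteq> (0::complex)"
  shows "AE z in lborel. z \<in> ball 0 T \<longrightarrow> f z \<noteq> 0"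
proof -
  have "AE z in lborel. \<forall>b\<in>{z \<in> ball 0 T. f z = 0}. z \<noteq> b"
    using finite_zeros_ball[OF f nz] by (intro AE_finite_allI AE_lborel_neq)
  then show ?thesis by eventually_elim auto
qed

text \<open>Only the finitely many zeros in \<open>ball 0 T\<close> are divided out; the remaining
  factor is zero-free on \<open>ball a (T - cmod a)\<close>, which has radius above
  \<open>r\<close>. The index set does not depend on \<open>a\<close>, so the sum is an integral
  against one measure for all \<open>a\<close>.\<close>

lemma disc_mean_entire:
  assumes f: "f holomorphic_on UNIV" and r: "r > 0" and a: "cmod a + r < T" and fa: "f a \<noteq> (0::complex)"
  shows "integrable (disc_measure r) (\<lambda>v. ln (cmod (f (a + v))))"
    and "(\<integral>v. ln (cmod (f (a + v))) \<partial>disc_measure r)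
      = r\<^sup>2 * (ln (cmod (f a)) + (\<Sum>b\<in>{z \<in> ball 0 T. f z = 0}. nat (zorder f b) * disc_kernel r (b - a)))"
proof -
  let ?A = "{z \<in> ball 0 T. f z = 0}"
  have nz: "\<exists>z. f z \<noteq> 0" using fa by blast
  have A: "finite ?A" by (rule finite_zeros_ball[OF f nz])
  obtain g where g: "g holomorphic_on UNIV" "\<forall>b\<in>?A. g b \<noteq> 0"
    and fg: "\<And>z. f z = g z * (\<Prod>b\<in>?A. (z - b) ^ nat (zorder f b))"
    using entire_factor_zeros[OF f nz A] by blast
  have gnz: "g z \<noteq> 0" if "z \<in> ball a (T - cmod a)" for z
  proof (cases "f z = 0")
    case True
    have "cmod z \<le> cmod a + dist a z" by (rule norm_le_norm_plus_dist)
    then have "z \<in> ?A" using True that by simp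
    then show ?thesis using g(2) by blast
  next
    case False
    then show ?thesis using fg[of z] by auto
  qed
  have r2: "r < T - cmod a" using a by simp
  note * = disc_mean_ln_norm_factored[OF g(1) r r2 gnz A fg fa]
  show "integrable (disc_measure r) (\<lambda>v. ln (cmod (f (a + v))))" by (rule *(1))
  show "(\<integral>v. ln (cmod (f (a + v))) \<partial>disc_measure r)
      = r\<^sup>2 * (ln (cmod (f a)) + (\<Sum>b\<in>?A. nat (zorder f b) * disc_kernel r (b - a)))" by (rule *(2))
qed

lemma disc_mean_entire_ge:
  assumes f: "f holomorphic_on UNIV" and r: "r > 0" and fa: "f a \<noteq> (0::complex)"
  shows "(\<integral>v. ln (cmod (f (a + v))) \<partial>disc_measure r) \<ge> r\<^sup>2 * ln (cmod (f a))"
proof -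
  have "(\<Sum>b\<in>{z \<in> ball 0 (cmod a + r + 1). f z = 0}. nat (zorder f b) * disc_kernel r (b - a)) \<ge> 0"
    using fa by (intro sum_nonneg mult_nonneg_nonneg disc_kernel_nonneg[OF r]) auto
  then show ?thesis
    using disc_mean_entire(2)[OF f r, of a "cmod a + r + 1"] fa r by (simp add: mult_left_mono)
qed

lemma nn_integral_disc_shift:
  assumes [measurable]: "F \<in> borel_measurable borel"
  shows "(\<integral>\<^sup>+w\<in>ball z s. F w \<partial>lborel) = ennreal pi * (\<integral>\<^sup>+v. F (z + v) \<partial>disc_measure s)"
proof -
  have "(\<integral>\<^sup>+v. F (z + v) \<partial>disc_measure s) = (\<integral>\<^sup>+v. ennreal (1 / pi * indicator (ball 0 s) v) * F (z + v) \<partial>lborel)"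
    unfolding disc_measure_eq by (rule nn_integral_density) (auto intro!: borel_measurable_divide borel_measurable_indicator)
  also have "\<dots> = (\<integral>\<^sup>+v. ennreal (1 / pi) * (F (z + v) * indicator (ball z s) (z + v)) \<partial>lborel)"
    by (intro nn_integral_cong) (auto simp: indicator_def dist_norm mult.commute)
  also have "\<dots> = ennreal (1 / pi) * (\<integral>\<^sup>+v. F (z + v) * indicator (ball z s) (z + v) \<partial>lborel)"
    by (rule nn_integral_cmult) measurable
  also have "(\<integral>\<^sup>+v. F (z + v) * indicator (ball z s) (z + v) \<partial>lborel)
      = (\<integral>\<^sup>+w. F w * indicator (ball z s) w \<partial>distr lborel borel ((+) z))"
    by (rule nn_integral_distr[symmetric]) measurable
  also have "\<dots> = (\<integral>\<^sup>+w\<in>ball z s. F w \<partial>lborel)"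
    by (simp add: lborel_distr_plus)
  finally have "ennreal pi * (\<integral>\<^sup>+v. F (z + v) \<partial>disc_measure s)
      = (ennreal pi * ennreal (1 / pi)) * (\<integral>\<^sup>+w\<in>ball z s. F w \<partial>lborel)"
    by (simp add: mult.assoc)
  then show ?thesis by (simp add: ennreal_mult[symmetric])
qed

text \<open>Each point of \<open>ball 0 T\<close> lies in \<open>ball a \<rho>\<close> for a set of
  centres \<open>a\<close> of area \<open>pi * \<rho>\<^sup>2\<close>, all of them in
  \<open>ball 0 (T + \<rho>)\<close>. Integrating the local bound over the centres gives a global
  one without counting overlaps of a cover.\<close>

lemma nn_integral_ball_average:
  fixes F :: "complex \<Rightarrow> ennreal"
  assumes [measurable]: "F \<in> borel_measurable borel" and \<rho>: "\<rho> > 0" and T: "T > 0"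
    and M: "\<And>a. a \<in> ball 0 (T + \<rho>) \<Longrightarrow> (\<integral>\<^sup>+z\<in>ball a \<rho>. F z \<partial>lborel) \<le> M"
  shows "ennreal (pi * \<rho>\<^sup>2) * (\<integral>\<^sup>+z\<in>ball 0 T. F z \<partial>lborel) \<le> ennreal (pi * (T + \<rho>)\<^sup>2) * M"
proof -
  have "open {p :: complex \<times> complex. dist (fst p) (snd p) < \<rho>}"
    by (intro open_Collect_less continuous_intros)
  then have [measurable]: "{p :: complex \<times> complex. dist (fst p) (snd p) < \<rho>} \<in> sets (borel \<Otimes>\<^sub>M borel)"
    unfolding borel_prod by (rule borel_open)
  let ?k = "\<lambda>z a. indicator {p :: complex \<times> complex. dist (fst p) (snd p) < \<rho>} (z, a) :: ennreal"
  have "ennreal (pi * \<rho>\<^sup>2) * (\<integral>\<^sup>+z\<in>ball 0 T. F z \<partial>lborel)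
      = (\<integral>\<^sup>+z. F z * indicator (ball 0 T) z * ennreal (pi * \<rho>\<^sup>2) \<partial>lborel)"
    by (subst mult.commute, rule nn_integral_multc[symmetric]) measurable
  also have "\<dots> = (\<integral>\<^sup>+z. F z * indicator (ball 0 T) z * (\<integral>\<^sup>+a. ?k z a \<partial>lborel) \<partial>lborel)"
  proof (rule nn_integral_cong)
    fix z :: complex
    have "(\<integral>\<^sup>+a. ?k z a \<partial>lborel) = (\<integral>\<^sup>+a. indicator (ball z \<rho>) a \<partial>lborel)"
      by (intro nn_integral_cong) (simp add: indicator_def)
    then show "F z * indicator (ball 0 T) z * ennreal (pi * \<rho>\<^sup>2) = F z * indicator (ball 0 T) z * (\<integral>\<^sup>+a. ?k z a \<partial>lborel)"
      using \<rho> by (simp add: emeasure_ball_complex)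
  qed
  also have "\<dots> = (\<integral>\<^sup>+z. (\<integral>\<^sup>+a. F z * indicator (ball 0 T) z * ?k z a \<partial>lborel) \<partial>lborel)"
    by (intro nn_integral_cong nn_integral_cmult[symmetric]) measurable
  also have "\<dots> = (\<integral>\<^sup>+a. (\<integral>\<^sup>+z. F z * indicator (ball 0 T) z * ?k z a \<partial>lborel) \<partial>lborel)"
    by (rule lborel_pair.Fubini') measurable
  also have "\<dots> \<le> (\<integral>\<^sup>+a. M * indicator (ball (0::complex) (T + \<rho>)) a \<partial>lborel)"
  proof (rule nn_integral_mono)
    fix a :: complex
    show "(\<integral>\<^sup>+z. F z * indicator (ball 0 T) z * ?k z a \<partial>lborel) \<le> M * indicator (ball 0 (T + \<rho>)) a"
    proof (cases "a \<in> ball 0 (T + \<rho>)")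
      case True
      have "(\<integral>\<^sup>+z. F z * indicator (ball 0 T) z * ?k z a \<partial>lborel) \<le> (\<integral>\<^sup>+z\<in>ball a \<rho>. F z \<partial>lborel)"
        by (intro nn_integral_mono) (auto simp: indicator_def dist_commute)
      then show ?thesis using M[OF True] True by simp
    next
      case False
      have "F z * indicator (ball 0 T) z * ?k z a = 0" for z
      proof -
        have "cmod a \<le> cmod z + dist z a" by (rule norm_le_norm_plus_dist)
        then show ?thesis using False by (auto simp: indicator_def)
      qed
      then show ?thesis by (simp only: nn_integral_0_iff_AE mult_zero_left nn_integral_const) simp
    qed
  qed
  also have "\<dots> = ennreal (pi * (T + \<rho>)\<^sup>2) * M"
    using \<rho> T by (subst nn_integral_cmult) (measurable, simp add: emeasure_ball_complex mult.commute)
  finally show ?thesis .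
qed

lemma AE_disc_measure_shift:
  assumes "AE w in lborel. w \<in> ball z s \<longrightarrow> P w" "Measurable.pred borel P"
  shows "AE v in disc_measure s. P (z + v)"
proof -
  have "AE w in distr lborel borel ((+) z). w \<in> ball z s \<longrightarrow> P w" using assms(1) unfolding lborel_distr_plus .
  then have "AE v in lborel. z + v \<in> ball z s \<longrightarrow> P (z + v)"
    using assms(2) by (subst (asm) AE_distr_iff) measurable
  then show ?thesis
    unfolding disc_measure_eq
    by (subst AE_density) (auto intro!: borel_measurable_divide borel_measurable_indicator measurable_compose[OF _ measurable_ennreal] elim!: eventually_mono simp: dist_norm indicator_def)
qed

lemma AE_disc_measure_nonzero:
  assumes f: "f holomorphic_on UNIV" and nz: "\<exists>z. f z \<noteq> (0::complex)"
  shows "AE v in disc_measure s. f (z + v) \<noteq> 0"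
proof (rule AE_disc_measure_shift)
  show "AE w in lborel. w \<in> ball z s \<longrightarrow> f w \<noteq> 0"
    using AE_nonzero_ball[OF f nz, of "cmod z + s"]
  proof eventually_elim
    case (elim w)
    have "cmod w \<le> cmod z + dist z w" by (rule norm_le_norm_plus_dist)
    then show ?case using elim by auto
  qed
  have [measurable]: "f \<in> borel_measurable borel"
    by (intro borel_measurable_continuous_onI holomorphic_on_imp_continuous_on f)
  show "Measurable.pred borel (\<lambda>w. f w \<noteq> 0)" by measurable
qed

text \<open>The deterministic input: an upper bound everywhere, a lower bound at some point of each
  fixed disc. Both concern \<open>cmod (f n z)\<close> and not its logarithm, since
  \<open>ln 0 = 0\<close> in HOL would give the zeros of \<open>f n\<close> a wrong value.\<close>

locale log_asymptotics =
  fixes f :: "nat \<Rightarrow> complex \<Rightarrow> complex" and J :: "complex \<Rightarrow> real"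
  assumes entire: "\<And>n. f n holomorphic_on UNIV"
    and J: "continuous_on UNIV J"
    and upper: "\<And>T e. e > 0 \<Longrightarrow> \<forall>\<^sub>F n in sequentially. \<forall>z\<in>ball 0 T. cmod (f n z) \<le> exp (real n * (J z + e))"
    and lower: "\<And>a d e. d > 0 \<Longrightarrow> e > 0 \<Longrightarrow>
       \<forall>\<^sub>F n in sequentially. \<exists>z\<in>ball a d. exp (real n * (J z - e)) \<le> cmod (f n z)"
begin

section \<open>The normalised logarithms in \<open>L\<^sup>1\<close>\<close>

definition q :: "nat \<Rightarrow> complex \<Rightarrow> real" where "q n z = ln (cmod (f n z)) / real n"

lemma q_measurable [measurable]: "q n \<in> borel_measurable borel"
proof -
  have [measurable]: "f n \<in> borel_measurable borel"
    by (intro borel_measurable_continuous_onI holomorphic_on_imp_continuous_on entire)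
  show ?thesis unfolding q_def[abs_def] by measurable
qed

lemma J_measurable [measurable]: "J \<in> borel_measurable borel"
  using J by (rule borel_measurable_continuous_onI)

lemma q_le: "n > 0 \<Longrightarrow> f n z \<noteq> 0 \<Longrightarrow> cmod (f n z) \<le> exp (real n * x) \<Longrightarrow> q n z \<le> x"
  unfolding q_def using ln_mono[of "cmod (f n z)" "exp (real n * x)"] by (simp add: field_simps)

lemma q_ge: "n > 0 \<Longrightarrow> exp (real n * x) \<le> cmod (f n z) \<Longrightarrow> f n z \<noteq> 0 \<and> x \<le> q n z"
proof -
  assume n: "n > 0" and le: "exp (real n * x) \<le> cmod (f n z)"
  have nz: "f n z \<noteq> 0" using le exp_gt_zero[of "real n * x"] by auto
  have "ln (exp (real n * x)) \<le> ln (cmod (f n z))" using le nz by (subst ln_le_cancel_iff) auto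
  then show ?thesis using n nz unfolding q_def by (simp add: field_simps)
qed

lemma J_bounded: "\<exists>K. \<forall>z\<in>cball a s. \<bar>J z\<bar> \<le> K"
proof -
  have "bounded (J ` cball a s)"
    by (intro compact_imp_bounded compact_continuous_image continuous_on_subset[OF J]) auto
  then show ?thesis unfolding bounded_iff by (metis image_eqI real_norm_def)
qed

lemma J_disc_integrable:
  assumes "s > 0" shows "integrable (disc_measure s) (\<lambda>v. J (z + v))"
proof -
  interpret finite_measure "disc_measure s" by (rule finite_measure_radial_measure) (use assms in auto)
  obtain K where K: "\<And>w. w \<in> cball z s \<Longrightarrow> \<bar>J w\<bar> \<le> K" using J_bounded[of z s] by blast
  show ?thesis
  proof (rule integrable_const_bound)
    show "AE v in disc_measure s. norm (J (z + v)) \<le> K"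
      using AE_radial_measure_ball by eventually_elim (auto intro!: K simp: dist_norm)
  qed measurable
qed

text \<open>By the upper bound the integrand is nonnegative almost everywhere, so bounding its
  integral needs only a lower bound for the mean of \<open>q n\<close>, and the sub-mean value
  property gives one from the single good point \<open>z\<close>. Each of the three assumptions
  costs one \<open>e\<close>; the result is rounded up to \<open>4 * e\<close>.\<close>

lemma local_L1_bound:
  assumes n: "n > 0" and s: "s > 0" and e: "e > 0"
    and good: "exp (real n * (J z - e)) \<le> cmod (f n z)"
    and osc: "\<And>w. w \<in> ball z s \<Longrightarrow> J w \<le> J z + e"
    and up: "\<And>w. w \<in> ball z s \<Longrightarrow> cmod (f n w) \<le> exp (real n * (J w + e))"
  shows "(\<integral>\<^sup>+w\<in>ball z s. ennreal (J w + e - q n w) \<partial>lborel) \<le> ennreal (pi * s\<^sup>2 * (4 * e))"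
proof -
  interpret finite_measure "disc_measure s" by (rule finite_measure_radial_measure) (use s in auto)
  have qz: "f n z \<noteq> 0" "J z - e \<le> q n z" using q_ge[OF n good] by auto
  let ?h = "\<lambda>v. J (z + v) + e - q n (z + v)"
  have iq: "integrable (disc_measure s) (\<lambda>v. q n (z + v))"
    unfolding q_def using disc_mean_entire(1)[OF entire s _ qz(1), of "cmod z + s + 1"] by simp
  have iJ: "integrable (disc_measure s) (\<lambda>v. J (z + v))" by (rule J_disc_integrable[OF s])
  have ih: "integrable (disc_measure s) ?h" using iq iJ by simp
  have Q: "(\<integral>v. q n (z + v) \<partial>disc_measure s) \<ge> s\<^sup>2 * q n z"
  proof -
    have "(\<integral>v. q n (z + v) \<partial>disc_measure s) = (\<integral>v. ln (cmod (f n (z + v))) \<partial>disc_measure s) / real n"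
      unfolding q_def by simp
    also have "\<dots> \<ge> s\<^sup>2 * ln (cmod (f n z)) / real n"
      using disc_mean_entire_ge[OF entire s qz(1)] by (intro divide_right_mono) auto
    finally show ?thesis by (simp add: q_def)
  qed
  have m: "measure (disc_measure s) UNIV = s\<^sup>2" using measure_radial_measure[of 2 s] s by simp
  have "(\<integral>v. J (z + v) \<partial>disc_measure s) \<le> (\<integral>v. J z + e \<partial>disc_measure s)"
  proof (rule integral_mono_AE[OF iJ])
    show "AE v in disc_measure s. J (z + v) \<le> J z + e"
      using AE_radial_measure_ball by eventually_elim (rule osc, simp add: dist_norm)
  qed simp
  also have "\<dots> = s\<^sup>2 * (J z + e)" using m by simp
  finally have JJ: "(\<integral>v. J (z + v) \<partial>disc_measure s) \<le> s\<^sup>2 * (J z + e)" .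
  have "(\<integral>v. ?h v \<partial>disc_measure s) = (\<integral>v. J (z + v) \<partial>disc_measure s) + s\<^sup>2 * e - (\<integral>v. q n (z + v) \<partial>disc_measure s)"
    using iJ iq m by simp
  also have "\<dots> \<le> s\<^sup>2 * (J z + e) + s\<^sup>2 * e - s\<^sup>2 * (J z - e)"
    using JJ Q mult_left_mono[OF qz(2), of "s\<^sup>2"] by simp
  also have "\<dots> \<le> s\<^sup>2 * (4 * e)" using e by (simp add: algebra_simps)
  finally have I: "(\<integral>v. ?h v \<partial>disc_measure s) \<le> s\<^sup>2 * (4 * e)" .
  have AEnz: "AE v in disc_measure s. f n (z + v) \<noteq> 0"
    by (rule AE_disc_measure_nonzero[OF entire]) (use qz(1) in blast)
  have nn: "AE v in disc_measure s. 0 \<le> ?h v"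
    using AEnz AE_radial_measure_ball
  proof eventually_elim
    case (elim v)
    have "q n (z + v) \<le> J (z + v) + e"
      using elim by (intro q_le n up) (auto simp: dist_norm)
    then show ?case by simp
  qed
  have "(\<integral>\<^sup>+w\<in>ball z s. ennreal (J w + e - q n w) \<partial>lborel) = ennreal pi * (\<integral>\<^sup>+v. ennreal (?h v) \<partial>disc_measure s)"
    by (rule nn_integral_disc_shift) measurable
  also have "(\<integral>\<^sup>+v. ennreal (?h v) \<partial>disc_measure s) = ennreal (\<integral>v. ?h v \<partial>disc_measure s)"
    by (rule nn_integral_eq_integral[OF ih nn])
  also have "ennreal pi * \<dots> \<le> ennreal pi * ennreal (s\<^sup>2 * (4 * e))"
    using I by (intro mult_left_mono ennreal_leI) auto
  also have "\<dots> = ennreal (pi * s\<^sup>2 * (4 * e))" using e by (simp add: ennreal_mult[symmetric] mult.assoc)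
  finally show ?thesis .
qed

lemma L1_small:
  assumes T: "T > 0" and e: "e > 0"
  shows "\<forall>\<^sub>F n in sequentially. (\<integral>\<^sup>+z\<in>ball 0 T. ennreal \<bar>q n z - J z\<bar> \<partial>lborel)
     \<le> ennreal (36 * pi * (T + 1)\<^sup>2 * e + pi * T\<^sup>2 * e)"
proof -
  have "uniformly_continuous_on (cball 0 (T + 3)) J"
    by (intro compact_uniformly_continuous continuous_on_subset[OF J]) auto
  then obtain d where d: "d > 0" and dJ: "\<And>x y. x \<in> cball 0 (T + 3) \<Longrightarrow> y \<in> cball 0 (T + 3) \<Longrightarrow> dist x y < d \<Longrightarrow> dist (J x) (J y) < e"
    using e unfolding uniformly_continuous_on_def by metis
  \<comment> \<open>A point \<open>a\<close> is \<open>\<rho>\<close>-close to a net point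
    \<open>c\<close>, and \<open>c\<close> is \<open>\<rho>\<close>-close to a good point
    \<open>z\<close>, so \<open>ball a \<rho>\<close> lies in \<open>ball z (3 * \<rho>)\<close>.
    Hence \<open>3 * \<rho>\<close> has to be below the modulus of continuity \<open>d\<close>, and
    below 1 to stay in \<open>ball 0 (T + 3)\<close>.\<close>
  define \<rho> where "\<rho> = min (1 / 4) (d / 4)"
  have \<rho>: "\<rho> > 0" "\<rho> \<le> 1 / 4" "3 * \<rho> < d" using d by (auto simp: \<rho>_def)
  have "cball (0::complex) (T + 1) \<subseteq> (\<Union>c\<in>cball 0 (T + 1). ball c \<rho>)" using \<rho> by auto
  then obtain D where D: "D \<subseteq> cball (0::complex) (T + 1)" "finite D" "cball (0::complex) (T + 1) \<subseteq> (\<Union>c\<in>D. ball c \<rho>)"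
    using compactE_image[OF compact_cball, of "cball 0 (T + 1)" "\<lambda>c. ball c \<rho>" 0 "T + 1"] by (metis open_ball)
  \<comment> \<open>The lower bound is eventual for each disc separately; the finite net makes it
    simultaneous for all centres.\<close>
  have "\<forall>\<^sub>F n in sequentially. \<forall>c\<in>D. \<exists>z\<in>ball c \<rho>. exp (real n * (J z - e)) \<le> cmod (f n z)"
    using D(2) lower[OF \<rho>(1) e] by (simp add: eventually_ball_finite_distrib)
  moreover have "\<forall>\<^sub>F n in sequentially. \<forall>z\<in>ball 0 (T + 3). cmod (f n z) \<le> exp (real n * (J z + e))"
    by (rule upper[OF e])
  ultimately show ?thesis using eventually_gt_at_top[of 0]
  proof eventually_elim
    case (elim n)
    define F where "F w = ennreal (J w + e - q n w)" for w
    have [measurable]: "F \<in> borel_measurable borel" unfolding F_def by measurable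
    have loc: "(\<integral>\<^sup>+z\<in>ball a \<rho>. F z \<partial>lborel) \<le> ennreal (pi * (3 * \<rho>)\<^sup>2 * (4 * e))"
      if a: "a \<in> ball 0 (T + \<rho>)" for a
    proof -
      have "a \<in> cball 0 (T + 1)" using a \<rho> by simp
      then obtain c where c: "c \<in> D" "dist c a < \<rho>" using D(3) by auto
      then obtain z where z: "dist c z < \<rho>" "exp (real n * (J z - e)) \<le> cmod (f n z)" using elim(1) by auto
      have az: "dist a z < 2 * \<rho>" using c z dist_triangle[of a z c] by (simp add: dist_commute)
      have za: "cmod z < T + 2" using c(1) D(1) z(1) \<rho> norm_triangle_ineq[of c "z - c"]
        by (auto simp: dist_norm norm_minus_commute subset_eq)
      have w: "w \<in> ball 0 (T + 3) \<and> J w \<le> J z + e" if "w \<in> ball z (3 * \<rho>)" for w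
      proof -
        have "cmod w \<le> cmod z + dist z w" by (rule norm_le_norm_plus_dist)
        then have 1: "cmod w < T + 3" using that za \<rho> by auto
        have "dist (J w) (J z) < e" using that 1 za \<rho> by (intro dJ) (auto simp: dist_commute)
        then show ?thesis using 1 by (simp add: dist_real_def)
      qed
      have "(\<integral>\<^sup>+z\<in>ball a \<rho>. F z \<partial>lborel) \<le> (\<integral>\<^sup>+w\<in>ball z (3 * \<rho>). F w \<partial>lborel)"
      proof (intro nn_integral_mono mult_left_mono)
        fix w
        have "w \<in> ball z (3 * \<rho>)" if "w \<in> ball a \<rho>"
          using that az dist_triangle[of z w a] by (simp add: dist_commute)
        then show "indicator (ball a \<rho>) w \<le> (indicator (ball z (3 * \<rho>)) w :: ennreal)" by (auto simp: indicator_def)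
      qed simp
      also have "\<dots> \<le> ennreal (pi * (3 * \<rho>)\<^sup>2 * (4 * e))"
        unfolding F_def using elim(2,3) z(2) w \<rho> e by (intro local_L1_bound) auto
      finally show ?thesis .
    qed
    have "ennreal (pi * \<rho>\<^sup>2) * (\<integral>\<^sup>+z\<in>ball 0 T. F z \<partial>lborel)
        \<le> ennreal (pi * (T + \<rho>)\<^sup>2) * ennreal (pi * (3 * \<rho>)\<^sup>2 * (4 * e))"
      by (rule nn_integral_ball_average[OF _ \<rho>(1) T loc]) measurable
    also have "\<dots> \<le> ennreal (pi * (T + 1)\<^sup>2) * ennreal (pi * (3 * \<rho>)\<^sup>2 * (4 * e))"
      using T \<rho> by (intro mult_right_mono ennreal_leI mult_left_mono power_mono) auto
    \<comment> \<open>Here \<open>36 = 9 * 4\<close>, from the enlarged radius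
      \<open>3 * \<rho>\<close> and the local bound; \<open>\<rho>\<^sup>2\<close> cancels, so the
      bound does not depend on the net.\<close>
    also have "\<dots> = ennreal (pi * \<rho>\<^sup>2) * ennreal (36 * pi * (T + 1)\<^sup>2 * e)"
      using e by (simp add: ennreal_mult[symmetric] power_mult_distrib algebra_simps)
    finally have F: "(\<integral>\<^sup>+z\<in>ball 0 T. F z \<partial>lborel) \<le> ennreal (36 * pi * (T + 1)\<^sup>2 * e)"
      using \<rho> by (subst (asm) ennreal_mult_le_mult_iff) auto
    have nz: "\<exists>z. f n z \<noteq> 0"
    proof -
      have "0 \<in> cball (0::complex) (T + 1)" using T by simp
      then obtain c where "c \<in> D" using D(3) by blast
      then obtain z where "exp (real n * (J z - e)) \<le> cmod (f n z)" using elim(1) by blast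
      then show ?thesis using q_ge[OF elim(3)] by blast
    qed
    have "(\<integral>\<^sup>+z\<in>ball 0 T. ennreal \<bar>q n z - J z\<bar> \<partial>lborel)
        \<le> (\<integral>\<^sup>+z. F z * indicator (ball 0 T) z + ennreal e * indicator (ball 0 T) z \<partial>lborel)"
    proof (rule nn_integral_mono_AE)
      show "AE z in lborel. ennreal \<bar>q n z - J z\<bar> * indicator (ball 0 T) z \<le> F z * indicator (ball 0 T) z + ennreal e * indicator (ball 0 T) z"
        using AE_nonzero_ball[OF entire nz, of T]
      proof eventually_elim
        case (elim z)
        show ?case
        proof (cases "z \<in> ball 0 T")
          \<comment> \<open>As \<open>q n z \<le> J z + e\<close>, the absolute difference is at
            most \<open>(J z + e - q n z) + e\<close>; the last \<open>e\<close> contributes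
            \<open>pi * T\<^sup>2 * e\<close>.\<close>
          case True
          have "q n z \<le> J z + e"
            using True elim \<open>\<forall>z\<in>ball 0 (T + 3). cmod (f n z) \<le> exp (real n * (J z + e))\<close> \<open>0 < n\<close> by (intro q_le) auto
          then have "ennreal \<bar>q n z - J z\<bar> \<le> F z + ennreal e"
            unfolding F_def using e by (subst ennreal_plus[symmetric]) (auto intro!: ennreal_leI)
          then show ?thesis using True by simp
        qed simp
      qed
    qed
    also have "\<dots> = (\<integral>\<^sup>+z\<in>ball 0 T. F z \<partial>lborel) + (\<integral>\<^sup>+z\<in>ball (0::complex) T. ennreal e \<partial>lborel)"
      by (rule nn_integral_add) measurable
    also have "(\<integral>\<^sup>+z\<in>ball (0::complex) T. ennreal e \<partial>lborel) = ennreal (pi * T\<^sup>2 * e)"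
      using T e by (subst nn_integral_cmult) (measurable, simp add: emeasure_ball_complex ennreal_mult[symmetric] mult.commute)
    also have "(\<integral>\<^sup>+z\<in>ball 0 T. F z \<partial>lborel) + ennreal (pi * T\<^sup>2 * e)
        \<le> ennreal (36 * pi * (T + 1)\<^sup>2 * e) + ennreal (pi * T\<^sup>2 * e)"
      by (rule add_right_mono[OF F])
    also have "\<dots> = ennreal (36 * pi * (T + 1)\<^sup>2 * e + pi * T\<^sup>2 * e)"
      using e by (intro ennreal_plus[symmetric]) auto
    finally show ?case .
  qed
qed

end

section \<open>Counting zeros and convergence of their smoothed measures\<close>

context log_asymptotics begin

text \<open>Jensen's formula around a good point \<open>z\<close> of the unit disc. The radius
  \<open>2 * (T + 1)\<close> puts every zero of \<open>ball 0 T\<close> within half the radius of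
  \<open>z\<close>, where the kernel is at least \<open>1 / 6\<close>; the kernel sum is at most
  \<open>real n * (2 * K + 2)\<close>, whence \<open>12 * K + 12\<close>.\<close>

lemma zeros_mass_bounded:
  assumes T: "T > 0"
  shows "\<exists>K. \<forall>\<^sub>F n in sequentially. (\<Sum>b\<in>{z \<in> ball 0 T. f n z = 0}. nat (zorder (f n) b) / real n) \<le> K"
proof -
  define r where "r = 2 * (T + 1)"
  define T' where "T' = r + 2"
  have r: "r > 0" using T by (simp add: r_def)
  interpret finite_measure "disc_measure r" by (rule finite_measure_radial_measure) (use r in auto)
  obtain K where K: "\<And>z. z \<in> cball 0 T' \<Longrightarrow> \<bar>J z\<bar> \<le> K" using J_bounded[of 0 T'] by blast
  have "\<forall>\<^sub>F n in sequentially. \<exists>z\<in>ball 0 1. exp (real n * (J z - 1)) \<le> cmod (f n z)"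
    by (rule lower) auto
  moreover have "\<forall>\<^sub>F n in sequentially. \<forall>z\<in>ball 0 T'. cmod (f n z) \<le> exp (real n * (J z + 1))"
    by (rule upper) auto
  ultimately have "\<forall>\<^sub>F n in sequentially. (\<Sum>b\<in>{z \<in> ball 0 T. f n z = 0}. nat (zorder (f n) b) / real n) \<le> 12 * K + 12"
    using eventually_gt_at_top[of 0]
  proof eventually_elim
    case (elim n)
    then obtain z where z: "cmod z < 1" "exp (real n * (J z - 1)) \<le> cmod (f n z)" by auto
    have n: "n > 0" by fact
    have fz: "f n z \<noteq> 0" "J z - 1 \<le> q n z" using q_ge[OF n z(2)] by auto
    let ?m = "\<lambda>b. real (nat (zorder (f n) b))"
    let ?A = "{z \<in> ball 0 T. f n z = 0}" and ?A' = "{z \<in> ball 0 T'. f n z = 0}"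
    have zr: "cmod z + r < T'" using z by (simp add: T'_def)
    note dm = disc_mean_entire[OF entire r zr fz(1)]
    have "(\<integral>v. ln (cmod (f n (z + v))) \<partial>disc_measure r) \<le> (\<integral>v. real n * (K + 1) \<partial>disc_measure r)"
    proof (rule integral_mono_AE[OF dm(1)])
      have "AE v in disc_measure r. f n (z + v) \<noteq> 0"
        by (rule AE_disc_measure_nonzero[OF entire]) (use fz(1) in blast)
      then show "AE v in disc_measure r. ln (cmod (f n (z + v))) \<le> real n * (K + 1)"
        using AE_radial_measure_ball
      proof eventually_elim
        case (elim v)
        have w: "cmod (z + v) < T'" using elim(2) zr norm_triangle_ineq[of z v] by simp
        have "q n (z + v) \<le> J (z + v) + 1"
          using elim(1) w \<open>\<forall>z\<in>ball 0 T'. cmod (f n z) \<le> exp (real n * (J z + 1))\<close> by (intro q_le n) auto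
        also have "\<dots> \<le> K + 1" using K[of "z + v"] w by auto
        finally show ?case using n by (simp add: q_def field_simps)
      qed
    qed simp
    also have "\<dots> = r\<^sup>2 * (real n * (K + 1))" using measure_radial_measure[of 2 r] r by simp
    finally have "r\<^sup>2 * (ln (cmod (f n z)) + (\<Sum>b\<in>?A'. ?m b * disc_kernel r (b - z))) \<le> r\<^sup>2 * (real n * (K + 1))"
      unfolding dm(2) .
    then have 1: "ln (cmod (f n z)) + (\<Sum>b\<in>?A'. ?m b * disc_kernel r (b - z)) \<le> real n * (K + 1)"
      using r by simp
    have "\<bar>J z\<bar> \<le> K" using z r by (intro K) (simp add: T'_def)
    then have "- K - 1 \<le> q n z" using fz(2) by linarith
    then have 2: "real n * (- K - 1) \<le> ln (cmod (f n z))" using n by (simp add: q_def field_simps)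
    have A': "finite ?A'" by (rule finite_zeros_ball[OF entire]) (use fz in blast)
    have "(\<Sum>b\<in>?A. ?m b * (1 / 6)) \<le> (\<Sum>b\<in>?A. ?m b * disc_kernel r (b - z))"
    proof (intro sum_mono mult_left_mono disc_kernel_lower r)
      fix b assume b: "b \<in> ?A"
      then show "b - z \<noteq> 0" using fz(1) by auto
      show "cmod (b - z) \<le> r / 2" using b z norm_triangle_ineq4[of b z] by (simp add: r_def)
    qed simp
    also have "\<dots> \<le> (\<Sum>b\<in>?A'. ?m b * disc_kernel r (b - z))"
    proof (rule sum_mono2[OF A'])
      show "?A \<subseteq> ?A'" using T by (auto simp: T'_def r_def)
      show "0 \<le> ?m b * disc_kernel r (b - z)" if "b \<in> ?A' - ?A" for b
        using that fz(1) by (intro mult_nonneg_nonneg disc_kernel_nonneg[OF r]) auto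
    qed
    also have "\<dots> \<le> real n * (2 * K + 2)" using 1 2 by (simp add: algebra_simps)
    finally have "(\<Sum>b\<in>?A. ?m b) \<le> real n * (12 * K + 12)"
      by (simp add: sum_divide_distrib[symmetric] algebra_simps)
    then show ?case using n by (simp add: sum_divide_distrib[symmetric] field_simps)
  qed
  then show ?thesis by blast
qed

end

text \<open>Truncated to \<open>ball 0 T\<close>, so that it is a finite Borel measure and can be
  smoothed; \<open>n\<close> is only the normalisation.\<close>

definition zero_sum_measure :: "(complex \<Rightarrow> complex) \<Rightarrow> real \<Rightarrow> nat \<Rightarrow> complex measure" where
  "zero_sum_measure f T n = distr (point_measure {z \<in> ball 0 T. f z = 0}
      (\<lambda>b. ennreal (nat (zorder f b) / real n))) borel (\<lambda>b. b)"

lemma sets_zero_sum_measure [simp, measurable_cong]: "sets (zero_sum_measure f T n) = sets borel"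
  by (simp add: zero_sum_measure_def)

lemma integral_zero_sum_measure:
  fixes \<psi> :: "complex \<Rightarrow> real"
  assumes A: "finite {z \<in> ball 0 T. f z = 0}" and psi: "\<psi> \<in> borel_measurable borel"
  shows "(\<integral>b. \<psi> b \<partial>zero_sum_measure f T n)
     = (\<Sum>b\<in>{z \<in> ball 0 T. f z = 0}. nat (zorder f b) / real n * \<psi> b)"
proof -
  let ?P = "point_measure {z \<in> ball 0 T. f z = 0} (\<lambda>b. ennreal (nat (zorder f b) / real n))"
  have "(\<lambda>b. b) \<in> measurable ?P borel" by (simp add: measurable_def space_point_measure sets_point_measure)
  then have "(\<integral>b. \<psi> b \<partial>zero_sum_measure f T n) = (\<integral>b. \<psi> b \<partial>?P)"
    unfolding zero_sum_measure_def by (rule integral_distr[OF _ psi])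
  also have "\<dots> = (\<Sum>b\<in>{z \<in> ball 0 T. f z = 0}. (nat (zorder f b) / real n) *\<^sub>R \<psi> b)"
    by (rule lebesgue_integral_point_measure_finite[OF A]) simp
  finally show ?thesis by simp
qed

lemma finite_zero_sum_measure:
  assumes A: "finite {z \<in> ball 0 T. f z = 0}"
  shows "finite_measure (zero_sum_measure f T n)"
    and "measure (zero_sum_measure f T n) UNIV = (\<Sum>b\<in>{z \<in> ball 0 T. f z = 0}. nat (zorder f b) / real n)"
proof -
  let ?P = "point_measure {z \<in> ball 0 T. f z = 0} (\<lambda>b. ennreal (nat (zorder f b) / real n))"
  have m: "(\<lambda>b. b) \<in> measurable ?P borel" by (simp add: measurable_def space_point_measure sets_point_measure)
  have "emeasure ?P (space ?P) = (\<Sum>b\<in>{z \<in> ball 0 T. f z = 0}. ennreal (nat (zorder f b) / real n))"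
    by (simp only: space_point_measure emeasure_point_measure_finite[OF A order_refl])
  also have "\<dots> \<noteq> \<infinity>" by (subst sum_ennreal) simp_all
  finally have "finite_measure ?P" by (rule finite_measureI)
  then show *: "finite_measure (zero_sum_measure f T n)"
    unfolding zero_sum_measure_def by (rule finite_measure.finite_measure_distr[OF _ m])
  have "(\<integral>b. 1 \<partial>zero_sum_measure f T n) = measure (zero_sum_measure f T n) UNIV"
    using sets_eq_imp_space_eq[OF sets_zero_sum_measure[of f T n]] by simp
  then show "measure (zero_sum_measure f T n) UNIV = (\<Sum>b\<in>{z \<in> ball 0 T. f z = 0}. nat (zorder f b) / real n)"
    using integral_zero_sum_measure[OF A, of "\<lambda>_. 1" n] by simp
qed

text \<open>The margin 2 in \<open>T\<close> exceeds every smoothing radius used, so a disc centred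
  in the support of \<phi> stays in \<open>ball 0 T\<close> and the truncated measures
  suffice.\<close>

theorem zeros_equidistribution:
  fixes \<phi> :: "complex \<Rightarrow> real"
  assumes p: "p > 0" and LA: "log_asymptotics f (\<lambda>z. cmod z powr p / p)"
    and phi: "continuous_on UNIV \<phi>" and supp: "\<And>z. cmod z \<ge> T0 \<Longrightarrow> \<phi> z = 0" and T0: "T0 > 0"
    and T: "T = T0 + 2"
  shows "(\<lambda>n. \<Sum>b\<in>{z \<in> ball 0 T. f n z = 0}. nat (zorder (f n) b) / real n * \<phi> b)
     \<longlonglongrightarrow> (\<integral>z. \<phi> z \<partial>radial_measure p T)"
proof (rule LIMSEQ_I, goal_cases)
  case (1 \<eta>)
  let ?J = "\<lambda>z. cmod z powr p / p"
  interpret log_asymptotics f ?J by (rule LA)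
  have Tpos: "T > 0" using T T0 by simp
  interpret N: finite_measure "radial_measure p T" by (rule finite_measure_radial_measure[OF p Tpos])
  have phim [measurable]: "\<phi> \<in> borel_measurable borel" using phi by (rule borel_measurable_continuous_onI)
  have "bounded (\<phi> ` cball 0 T0)"
    by (intro compact_imp_bounded compact_continuous_image continuous_on_subset[OF phi]) auto
  then obtain B0 where B0: "\<And>z. z \<in> cball 0 T0 \<Longrightarrow> \<bar>\<phi> z\<bar> \<le> B0" unfolding bounded_iff by (metis image_eqI real_norm_def)
  define B where "B = max B0 1"
  have B: "\<bar>\<phi> z\<bar> \<le> B" "B > 0" for z
    using B0[of z] supp[of z] by (auto simp: B_def not_le intro: le_max_iff_disj[THEN iffD2])
       (metis abs_zero le_max_iff_disj linorder_linear order_trans zero_le_one)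
  obtain K where K: "\<forall>\<^sub>F n in sequentially. (\<Sum>b\<in>{z \<in> ball 0 T. f n z = 0}. nat (zorder (f n) b) / real n) \<le> K"
    using zeros_mass_bounded[OF Tpos] by blast
  \<comment> \<open>Smoothing costs at most \<open>C * \<omega>\<close> times the two total masses,
    bounded by \<open>K\<close> and \<open>T powr p\<close>; this choice keeps the sum below
    \<open>C * \<eta> / 4\<close>. Adding 1 keeps the denominator positive.\<close>
  define \<omega> where "\<omega> = \<eta> / (4 * (\<bar>K\<bar> + T powr p + 1))"
  have den: "\<bar>K\<bar> + T powr p + 1 > 0" by (simp add: add_nonneg_pos)
  have \<omega>: "\<omega> > 0" using 1 den by (simp add: \<omega>_def)
  have "uniformly_continuous_on (cball 0 (T0 + 1)) \<phi>"
    by (intro compact_uniformly_continuous continuous_on_subset[OF phi]) auto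
  then obtain d where d: "d > 0" and dphi: "\<And>x y. x \<in> cball 0 (T0 + 1) \<Longrightarrow> y \<in> cball 0 (T0 + 1) \<Longrightarrow> dist x y < d \<Longrightarrow> dist (\<phi> x) (\<phi> y) < \<omega>"
    using \<omega> unfolding uniformly_continuous_on_def by metis
  \<comment> \<open>\<open>r < d\<close> controls the oscillation of \<phi>.
    \<open>r \<le> 1\<close> ensures that if one of two \<open>r\<close>-close points leaves
    \<open>cball 0 (T0 + 1)\<close>, then \<phi> vanishes at both.\<close>
  define r where "r = min 1 (d / 2)"
  have r: "r > 0" "r \<le> 1" "r < d" using d by (auto simp: r_def)
  have osc: "\<bar>\<phi> x - \<phi> y\<bar> \<le> \<omega>" if "dist x y \<le> r" for x y
  proof (cases "x \<in> cball 0 (T0 + 1) \<and> y \<in> cball 0 (T0 + 1)")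
    case True
    then have "dist (\<phi> x) (\<phi> y) < \<omega>" using that r by (intro dphi) auto
    then show ?thesis by (simp add: dist_real_def)
  next
    case False
    have "cmod x \<le> cmod y + dist x y" "cmod y \<le> cmod x + dist x y"
      using norm_triangle_ineq[of y "x - y"] norm_triangle_ineq[of x "y - x"] by (auto simp: dist_norm norm_minus_commute)
    then have "cmod x \<ge> T0" "cmod y \<ge> T0" using False that r by auto
    then show ?thesis using supp \<omega> by simp
  qed
  define C where "C = (\<integral>w. disc_kernel r w \<partial>lborel)"
  have C: "C > 0" unfolding C_def by (rule integral_disc_kernel_pos[OF r(1)])
  define X where "X = (\<integral>a. \<phi> a * (\<integral>w. disc_kernel r (w - a) \<partial>radial_measure p T) \<partial>lborel)"
  note sm = kernel_smoothing[OF N.finite_measure_axioms sets_radial_measure r(1) phim B(1) osc]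
  have X: "\<bar>C * (\<integral>w. \<phi> w \<partial>radial_measure p T) - X\<bar> \<le> C * \<omega> * T powr p"
    using sm(1) measure_radial_measure[OF p Tpos] by (simp add: C_def X_def)
  \<comment> \<open>With \<open>c2 * e\<close> a bound for the \<open>L\<^sup>1\<close> distance of
    \<open>q n\<close> and the growth on \<open>ball 0 T\<close>, \<open>c1\<close> collects the
    factors: \<open>T0\<^sup>2 / r\<^sup>2\<close> from the disc means integrated over
    \<open>ball 0 T0\<close>, and 1 from the central values.\<close>
  define c1 where "c1 = B * (T0\<^sup>2 / r\<^sup>2 + 1)"
  have c1: "c1 > 0" using B(2) by (simp add: c1_def add_nonneg_pos)
  define c2 where "c2 = 36 * pi * (T + 1)\<^sup>2 + pi * T\<^sup>2"
  have c2: "c2 > 0" using Tpos by (simp add: c2_def add_pos_nonneg)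
  define e where "e = C * \<eta> / (4 * c1 * c2)"
  have e: "e > 0" using C 1 c1 c2 by (simp add: e_def)
  have "\<forall>\<^sub>F n in sequentially. \<exists>z\<in>ball 0 1. exp (real n * (?J z - 1)) \<le> cmod (f n z)"
    by (rule lower) auto
  moreover note K L1_small[OF Tpos e]
  ultimately have "\<forall>\<^sub>F n in sequentially. norm ((\<Sum>b\<in>{z \<in> ball 0 T. f n z = 0}. nat (zorder (f n) b) / real n * \<phi> b)
      - (\<integral>z. \<phi> z \<partial>radial_measure p T)) < \<eta>"
    using eventually_gt_at_top[of 0]
  proof eventually_elim
    case (elim n)
    have n: "n > 0" by fact
    have nz: "\<exists>z. f n z \<noteq> 0" using elim(1) q_ge[OF n] by blast
    let ?A = "{z \<in> ball 0 T. f n z = 0}"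
    have A: "finite ?A" by (rule finite_zeros_ball[OF entire nz])
    let ?\<mu> = "zero_sum_measure (f n) T n"
    interpret Z: finite_measure ?\<mu> by (rule finite_zero_sum_measure[OF A])
    define S where "S = (\<Sum>b\<in>?A. nat (zorder (f n) b) / real n * \<phi> b)"
    define Kn where "Kn a = (\<integral>w. disc_kernel r (w - a) \<partial>?\<mu>)" for a
    define Kr where "Kr a = (\<integral>w. disc_kernel r (w - a) \<partial>radial_measure p T)" for a
    define Xn where "Xn = (\<integral>a. \<phi> a * Kn a \<partial>lborel)"
    note smn = kernel_smoothing[OF Z.finite_measure_axioms sets_zero_sum_measure r(1) phim B(1) osc]
    have S: "S = (\<integral>w. \<phi> w \<partial>?\<mu>)" unfolding S_def by (rule integral_zero_sum_measure[OF A phim, symmetric])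
    have "\<bar>C * S - Xn\<bar> \<le> C * \<omega> * measure ?\<mu> UNIV"
      using smn(1) by (simp add: C_def Xn_def S Kn_def)
    also have "measure ?\<mu> UNIV \<le> K"
      unfolding finite_zero_sum_measure(2)[OF A] by (rule elim(2))
    then have "C * \<omega> * measure ?\<mu> UNIV \<le> C * \<omega> * K" using C \<omega> by (intro mult_left_mono) auto
    finally have Sn: "\<bar>C * S - Xn\<bar> \<le> C * \<omega> * K" .
    let ?u = "\<lambda>z. q n z - ?J z"
    let ?L = "\<integral>\<^sup>+z\<in>ball 0 T. ennreal \<bar>?u z\<bar> \<partial>lborel"
    have L: "?L \<le> ennreal (c2 * e)" using elim(3) by (simp add: c2_def algebra_simps)
    have um [measurable]: "?u \<in> borel_measurable borel" by measurable
    \<comment> \<open>Both smoothed measures are disc mean minus central value, of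
      \<open>q n\<close> and of the growth, so their difference is the same operation applied to
      \<open>?u\<close>. The mean is bounded uniformly in \<open>a\<close> by the
      \<open>L\<^sup>1\<close> norm; the central value is kept and integrated later.\<close>
    have diff: "\<bar>Kn a - Kr a\<bar> \<le> c2 * e / (pi * r\<^sup>2) + \<bar>?u a\<bar>" if a: "cmod a < T0" "f n a \<noteq> 0" for a
    proof -
      have ar: "cmod a + r < T" using a r T by simp
      note dm = disc_mean_entire[OF entire r(1) ar a(2)]
      note dr = disc_mean_radial_potential[OF p r(1) ar]
      have Kr: "Kr a = (\<integral>v. ?J (a + v) \<partial>disc_measure r) / r\<^sup>2 - ?J a"
        unfolding Kr_def by (rule dr(2)[symmetric])
      have "Kn a = (\<Sum>b\<in>?A. nat (zorder (f n) b) / real n * disc_kernel r (b - a))"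
        unfolding Kn_def by (rule integral_zero_sum_measure[OF A]) measurable
      also have "\<dots> = (\<Sum>b\<in>?A. nat (zorder (f n) b) * disc_kernel r (b - a)) / real n"
        by (simp add: sum_divide_distrib)
      also have "(\<Sum>b\<in>?A. nat (zorder (f n) b) * disc_kernel r (b - a))
          = (\<integral>v. ln (cmod (f n (a + v))) \<partial>disc_measure r) / r\<^sup>2 - ln (cmod (f n a))"
        using r unfolding dm(2) by simp
      also have "(\<dots>) / real n = (\<integral>v. q n (a + v) \<partial>disc_measure r) / r\<^sup>2 - q n a"
        unfolding q_def using n by (simp add: diff_divide_distrib)
      finally have Kn: "Kn a = (\<integral>v. q n (a + v) \<partial>disc_measure r) / r\<^sup>2 - q n a" .
      have iq: "integrable (disc_measure r) (\<lambda>v. q n (a + v))" unfolding q_def using dm(1) by simp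
      have iu: "integrable (disc_measure r) (\<lambda>v. ?u (a + v))" using iq dr(1) by simp
      have KK: "Kn a - Kr a = (\<integral>v. ?u (a + v) \<partial>disc_measure r) / r\<^sup>2 - ?u a"
        unfolding Kn Kr using iq dr(1) by (simp add: diff_divide_distrib)
      have "\<bar>\<integral>v. ?u (a + v) \<partial>disc_measure r\<bar> \<le> c2 * e / pi"
      proof -
        have "ennreal pi * ennreal \<bar>\<integral>v. ?u (a + v) \<partial>disc_measure r\<bar>
            \<le> ennreal pi * (\<integral>\<^sup>+v. ennreal \<bar>?u (a + v)\<bar> \<partial>disc_measure r)"
          using integral_norm_bound_ennreal[OF iu] by (intro mult_left_mono) auto
        also have "\<dots> = (\<integral>\<^sup>+w\<in>ball a r. ennreal \<bar>?u w\<bar> \<partial>lborel)"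
          by (rule nn_integral_disc_shift[symmetric]) measurable
        also have "\<dots> \<le> ?L"
        proof (intro nn_integral_mono mult_left_mono)
          fix w
          have "cmod w \<le> cmod a + dist a w" by (rule norm_le_norm_plus_dist)
          then show "indicator (ball a r) w \<le> (indicator (ball 0 T) w :: ennreal)"
            using ar by (auto simp: indicator_def)
        qed simp
        also note L
        finally have "ennreal (pi * \<bar>\<integral>v. ?u (a + v) \<partial>disc_measure r\<bar>) \<le> ennreal (c2 * e)"
          by (simp add: ennreal_mult)
        then have "pi * \<bar>\<integral>v. ?u (a + v) \<partial>disc_measure r\<bar> \<le> c2 * e"
          using c2 e by (subst (asm) ennreal_le_iff) auto
        then show ?thesis by (simp add: field_simps)
      qed
      then have le: "\<bar>(\<integral>v. ?u (a + v) \<partial>disc_measure r) / r\<^sup>2\<bar> \<le> c2 * e / pi / r\<^sup>2"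
        unfolding abs_divide abs_power2 by (rule divide_right_mono) simp
      have "\<bar>Kn a - Kr a\<bar> \<le> \<bar>(\<integral>v. ?u (a + v) \<partial>disc_measure r) / r\<^sup>2\<bar> + \<bar>?u a\<bar>"
        unfolding KK by (rule abs_triangle_ineq4)
      also have "\<dots> \<le> c2 * e / pi / r\<^sup>2 + \<bar>?u a\<bar>" by (rule add_right_mono[OF le])
      finally show ?thesis by (simp only: divide_divide_eq_left)
    qed
    have intd: "integrable lborel (\<lambda>a. \<phi> a * Kn a)" "integrable lborel (\<lambda>a. \<phi> a * Kr a)"
      using smn(2) sm(2) by (simp_all add: Kn_def Kr_def)
    have "ennreal \<bar>Xn - X\<bar> \<le> ennreal (c1 * (c2 * e))"
    proof -
      have "Xn - X = (\<integral>a. \<phi> a * Kn a - \<phi> a * Kr a \<partial>lborel)"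
        unfolding Xn_def X_def Kr_def[symmetric] using intd by simp
      then have "ennreal \<bar>Xn - X\<bar> \<le> (\<integral>\<^sup>+a. ennreal \<bar>\<phi> a * Kn a - \<phi> a * Kr a\<bar> \<partial>lborel)"
        using integral_norm_bound_ennreal[OF Bochner_Integration.integrable_diff[OF intd]] by simp
      also have "\<dots> \<le> (\<integral>\<^sup>+a. ennreal (B * (c2 * e / (pi * r\<^sup>2))) * indicator (ball 0 T0) a
          + ennreal B * (ennreal \<bar>?u a\<bar> * indicator (ball 0 T) a) \<partial>lborel)"
      proof (rule nn_integral_mono_AE)
        show "AE a in lborel. ennreal \<bar>\<phi> a * Kn a - \<phi> a * Kr a\<bar> \<le> ennreal (B * (c2 * e / (pi * r\<^sup>2))) * indicator (ball 0 T0) a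
          + ennreal B * (ennreal \<bar>?u a\<bar> * indicator (ball 0 T) a)"
          using AE_nonzero_ball[OF entire nz, of T]
        proof eventually_elim
          case (elim a)
          show ?case
          proof (cases "cmod a < T0")
            case True
            then have fa: "f n a \<noteq> 0" "a \<in> ball 0 T" using elim T by auto
            have "\<bar>\<phi> a * Kn a - \<phi> a * Kr a\<bar> = \<bar>\<phi> a\<bar> * \<bar>Kn a - Kr a\<bar>"
              by (simp add: right_diff_distrib[symmetric] abs_mult)
            also have "\<dots> \<le> B * (c2 * e / (pi * r\<^sup>2) + \<bar>?u a\<bar>)"
              using B diff[OF True fa(1)] by (intro mult_mono) auto
            also have "\<dots> = B * (c2 * e / (pi * r\<^sup>2)) + B * \<bar>?u a\<bar>" by (rule distrib_left)
            finally have "ennreal \<bar>\<phi> a * Kn a - \<phi> a * Kr a\<bar> \<le> ennreal (B * (c2 * e / (pi * r\<^sup>2)) + B * \<bar>?u a\<bar>)"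
              by (rule ennreal_leI)
            also have "\<dots> = ennreal (B * (c2 * e / (pi * r\<^sup>2))) + ennreal B * ennreal \<bar>?u a\<bar>"
              using B c2 e by (subst ennreal_plus) (auto simp: ennreal_mult)
            finally show ?thesis using True fa by simp
          next
            case False
            then show ?thesis using supp[of a] by simp
          qed
        qed
      qed
      also have "\<dots> = (\<integral>\<^sup>+a\<in>ball (0::complex) T0. ennreal (B * (c2 * e / (pi * r\<^sup>2))) \<partial>lborel)
          + (\<integral>\<^sup>+a. ennreal B * (ennreal \<bar>?u a\<bar> * indicator (ball 0 T) a) \<partial>lborel)"
        by (rule nn_integral_add) measurable
      also have "(\<integral>\<^sup>+a\<in>ball (0::complex) T0. ennreal (B * (c2 * e / (pi * r\<^sup>2))) \<partial>lborel)
          = ennreal (B * (T0\<^sup>2 / r\<^sup>2) * (c2 * e))"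
        using T0 B(2) c2 e r by (subst nn_integral_cmult) (measurable, simp add: emeasure_ball_complex ennreal_mult[symmetric])
      also have "(\<integral>\<^sup>+a. ennreal B * (ennreal \<bar>?u a\<bar> * indicator (ball 0 T) a) \<partial>lborel) = ennreal B * ?L"
        by (rule nn_integral_cmult) measurable
      also have "ennreal (B * (T0\<^sup>2 / r\<^sup>2) * (c2 * e)) + ennreal B * ?L
          \<le> ennreal (B * (T0\<^sup>2 / r\<^sup>2) * (c2 * e)) + ennreal B * ennreal (c2 * e)"
        by (intro add_left_mono mult_left_mono L) simp
      also have "\<dots> = ennreal (c1 * (c2 * e))"
        using B(2) c2 e unfolding c1_def
        by (simp add: ennreal_mult[symmetric] ennreal_plus[symmetric] algebra_simps del: ennreal_plus)
      finally show ?thesis .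
    qed
    then have XX: "\<bar>Xn - X\<bar> \<le> c1 * (c2 * e)"
      using c1 c2 e by (subst (asm) ennreal_le_iff) auto
    let ?I = "\<integral>z. \<phi> z \<partial>radial_measure p T"
    have "C * \<bar>S - ?I\<bar> = \<bar>C * S - C * ?I\<bar>" using C by (simp add: right_diff_distrib[symmetric] abs_mult)
    also have "\<dots> \<le> C * \<omega> * K + C * \<omega> * T powr p + c1 * (c2 * e)" using Sn X XX by linarith
    also have "\<dots> = C * (\<omega> * (K + T powr p)) + C * \<eta> / 4"
      using c1 c2 by (simp add: e_def algebra_simps)
    also have "\<dots> \<le> C * (\<omega> * (\<bar>K\<bar> + T powr p + 1)) + C * \<eta> / 4"
      using C \<omega> by (intro add_right_mono mult_left_mono) auto
    also have "\<omega> * (\<bar>K\<bar> + T powr p + 1) = \<eta> / 4"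
    proof -
      have "\<eta> / (4 * D) * D = \<eta> / 4" if "D > 0" for D using that by simp
      then show ?thesis unfolding \<omega>_def using den by blast
    qed
    also have "C * (\<eta> / 4) + C * \<eta> / 4 < C * \<eta>" using C 1 by simp
    finally have "\<bar>S - ?I\<bar> < \<eta>" using C by simp
    then show ?case by (simp add: S_def)
  qed
  then show ?case by (simp add: eventually_sequentially)
qed

section \<open>Anti-concentration\<close>

text \<open>Take a point \<open>x0\<close> of the support and a set of positive mass at distance at
  least \<open>3 * d\<close> from it. Any \<open>x\<close> within \<open>2 * d\<close> of
  \<open>x0\<close> is far from that set, any other \<open>x\<close> is far from
  \<open>ball x0 d\<close>.\<close>

lemma nondegenerate_spread:
  fixes N :: "complex measure"
  assumes N: "prob_space N" "sets N = sets borel" and nd: "\<not> (\<exists>c. AE x in N. x = c)"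
  shows "\<exists>c>0. \<exists>d>0. \<forall>x. measure N {y. d \<le> dist x y} \<ge> c"
proof -
  interpret prob_space N by (rule N)
  have [measurable_cong]: "sets N = sets borel" by (rule N)
  have space: "space N = UNIV" using sets_eq_imp_space_eq[OF N(2)] by simp
  \<comment> \<open>If every point had a null neighbourhood, countably many of these would cover the
    plane by Lindelof's theorem.\<close>
  obtain x0 where x0: "\<And>e. e > 0 \<Longrightarrow> measure N (ball x0 e) > 0"
  proof (rule ccontr)
    assume "\<not> thesis"
    then have "\<forall>x. \<exists>e>0. \<not> measure N (ball x e) > 0" using that by blast
    then obtain e where e: "\<And>x. e x > 0" "\<And>x. measure N (ball x (e x)) = 0"
      by (metis measure_nonneg order_le_less)
    obtain F where F: "F \<subseteq> range (\<lambda>x. ball x (e x))" "countable F" "\<Union>F = (\<Union>x. ball x (e x))"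
      using Lindelof[of "range (\<lambda>x. ball x (e x))"] by auto
    have "\<Union>F = UNIV" using F(3) e(1) by (metis UNIV_eq_I UN_I UNIV_I centre_in_ball)
    moreover have "(\<Union>U\<in>F. U) \<in> null_sets N"
    proof (rule null_sets_UN'[OF F(2)])
      show "U \<in> null_sets N" if "U \<in> F" for U
        using that F(1) e(2) by (auto simp: null_sets_def emeasure_eq_measure N(2))
    qed
    ultimately have "emeasure N UNIV = 0" by auto
    then show False using emeasure_space_1 space by simp
  qed
  have "\<exists>d>0. measure N {y. 3 * d \<le> dist x0 y} > 0"
  proof (rule ccontr)
    assume "\<not> ?thesis"
    then have z: "measure N {y. 3 * d \<le> dist x0 y} = 0" if "d > 0" for d
      using that by (metis measure_nonneg order_le_less)
    have "AE y in N. \<forall>n::nat. \<not> 3 * (1 / Suc n) \<le> dist x0 y"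
    proof (subst AE_all_countable, intro allI)
      fix n :: nat
      have "{y. 3 * (1 / Suc n) \<le> dist x0 y} \<in> null_sets N"
      proof (rule null_setsI)
        show "emeasure N {y. 3 * (1 / Suc n) \<le> dist x0 y} = 0"
          using z[of "1 / Suc n"] by (simp add: emeasure_eq_measure)
        show "{y. 3 * (1 / Suc n) \<le> dist x0 y} \<in> sets N"
          unfolding N(2) by (intro borel_closed closed_Collect_le continuous_intros)
      qed
      then show "AE y in N. \<not> 3 * (1 / Suc n) \<le> dist x0 y" using AE_not_in by fastforce
    qed
    then have "AE y in N. y = x0"
    proof eventually_elim
      case (elim y)
      show "y = x0"
      proof (rule ccontr)
        assume "y \<noteq> x0"
        then have "dist x0 y / 3 > 0" by simp
        then obtain n where "inverse (real (Suc n)) < dist x0 y / 3" using reals_Archimedean by blast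
        then have "3 * (1 / real (Suc n)) < dist x0 y" by (simp add: inverse_eq_divide)
        then show False using elim by (meson less_imp_le)
      qed
    qed
    then show False using nd by blast
  qed
  then obtain d where d: "d > 0" "measure N {y. 3 * d \<le> dist x0 y} > 0" by blast
  let ?c = "min (measure N {y. 3 * d \<le> dist x0 y}) (measure N (ball x0 d))"
  have meas: "{y. d \<le> dist x y} \<in> sets N" for x
    unfolding N(2) by (intro borel_closed closed_Collect_le continuous_intros)
  have "?c \<le> measure N {y. d \<le> dist x y}" for x
  proof (cases "dist x0 x < 2 * d")
    case True
    have "{y. 3 * d \<le> dist x0 y} \<subseteq> {y. d \<le> dist x y}"
    proof
      fix y assume "y \<in> {y. 3 * d \<le> dist x0 y}"
      then show "y \<in> {y. d \<le> dist x y}" using True dist_triangle[of x0 y x] by auto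
    qed
    then have "measure N {y. 3 * d \<le> dist x0 y} \<le> measure N {y. d \<le> dist x y}"
      by (intro finite_measure_mono meas)
    then show ?thesis by simp
  next
    case False
    have "ball x0 d \<subseteq> {y. d \<le> dist x y}"
    proof
      fix y assume "y \<in> ball x0 d"
      then show "y \<in> {y. d \<le> dist x y}"
        using False dist_triangle[of x0 x y] dist_commute[of x y] by auto
    qed
    then have "measure N (ball x0 d) \<le> measure N {y. d \<le> dist x y}"
      by (intro finite_measure_mono meas)
    then show ?thesis by simp
  qed
  moreover have "?c > 0" using d x0[of d] by simp
  ultimately show ?thesis using d(1) by blast
qed

text \<open>After prepending \<open>y\<close> to \<open>x\<close>, the exchange is the transposition
  of the coordinates 0 and \<open>Suc k\<close> of one i.i.d. sequence, which preserves the product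
  measure.\<close>

lemma (in sequence_space) distr_swap_coordinate:
  "distr (M \<Otimes>\<^sub>M S) (M \<Otimes>\<^sub>M S) (\<lambda>(y, x). (x k, x(k := y))) = M \<Otimes>\<^sub>M S"
proof -
  define c where "c = (\<lambda>(y::'a, x::nat \<Rightarrow> 'a). case_nat y x)"
  define i where "i = (\<lambda>v::nat \<Rightarrow> 'a. (v 0, \<lambda>n. v (Suc n)))"
  define t where "t = (\<lambda>v::nat \<Rightarrow> 'a. \<lambda>n. v (Transposition.transpose 0 (Suc k) n))"
  have c [measurable]: "c \<in> measurable (M \<Otimes>\<^sub>M S) S"
    unfolding c_def by measurable
  have i [measurable]: "i \<in> measurable S (M \<Otimes>\<^sub>M S)"
    unfolding i_def by (intro measurable_Pair measurable_PiM_single') (auto simp: space_PiM)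
  have t [measurable]: "t \<in> measurable S S"
    unfolding t_def by (intro measurable_PiM_single') (auto simp: space_PiM)
  have St: "distr S S t = S"
    using distr_PiM_reindex[of "UNIV :: nat set" "\<lambda>_. M" "Transposition.transpose 0 (Suc k)" UNIV] prob_space_axioms
    by (simp add: t_def M.prob_space_axioms restrict_UNIV)
  have Sc: "distr (M \<Otimes>\<^sub>M S) S c = S" unfolding c_def by (rule PiM_iter)
  have ic: "i (c p) = p" for p by (cases p) (simp add: i_def c_def)
  have Si: "distr S (M \<Otimes>\<^sub>M S) i = M \<Otimes>\<^sub>M S"
    by (subst Sc[symmetric], subst distr_distr) (simp_all add: comp_def ic distr_id2)
  have "(\<lambda>(y, x). (x k, x(k := y))) = (\<lambda>p. i (t (c p)))"
    by (auto simp: fun_eq_iff i_def t_def c_def Transposition.transpose_def split: nat.splits)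
  then have "distr (M \<Otimes>\<^sub>M S) (M \<Otimes>\<^sub>M S) (\<lambda>(y, x). (x k, x(k := y)))
      = distr (distr (distr (M \<Otimes>\<^sub>M S) S c) S t) (M \<Otimes>\<^sub>M S) i"
    by (simp add: distr_distr comp_def)
  also have "\<dots> = M \<Otimes>\<^sub>M S" by (simp add: Sc St Si)
  finally show ?thesis .
qed

text \<open>With a fresh variable \<open>y\<close>, the events that \<open>x(k := y)\<close> lies in \<open>A\<close> while \<open>x k\<close> and \<open>y\<close> are far apart
  are disjoint for different \<open>k\<close>, and each of them has probability at least \<open>c\<close> times that of \<open>A\<close>
  because \<open>x k\<close> and \<open>y\<close> are exchangeable.\<close>

lemma iid_anti_concentration:
  fixes N :: "complex measure" and c d :: real
  assumes N: "prob_space N" "sets N = sets borel"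
    and c: "\<And>x. measure N {y. d \<le> dist x y} \<ge> c" "c > 0"
    and A: "A \<in> sets (Pi\<^sub>M UNIV (\<lambda>_::nat. N))" and B: "finite B"
    and sep: "\<And>x y j k. j \<in> B \<Longrightarrow> k \<in> B \<Longrightarrow> j < k \<Longrightarrow> x(j := y) \<in> A \<Longrightarrow> x(k := y) \<in> A \<Longrightarrow>
       d \<le> dist (x j) y \<Longrightarrow> d \<le> dist (x k) y \<Longrightarrow> False"
  shows "real (card B) * c * measure (Pi\<^sub>M UNIV (\<lambda>_::nat. N)) A \<le> 1"
proof -
  interpret N: prob_space N by (rule N)
  interpret sequence_space N by unfold_locales
  interpret Q: pair_prob_space N S ..
  have [measurable_cong]: "sets N = sets borel" by (rule N)
  have space: "space N = UNIV" using sets_eq_imp_space_eq[OF N(2)] by simp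
  have spaceS: "space S = UNIV" by (auto simp: space_PiM space)
  define E where "E k = {p. (snd p)(k := fst p) \<in> A \<and> d \<le> dist (snd p k) (fst p)}" for k
  define F where "F k = {p. snd p \<in> A \<and> d \<le> dist (snd p k) (fst p)}" for k
  let ?s = "\<lambda>k (y, x). (x k, x(k := y)) :: complex \<times> (nat \<Rightarrow> complex)"
  have spaceQ: "space (N \<Otimes>\<^sub>M S) = UNIV" by (simp add: space_pair_measure space spaceS)
  have s: "?s k \<in> measurable (N \<Otimes>\<^sub>M S) (N \<Otimes>\<^sub>M S)" for k
  proof -
    have c: "(\<lambda>p. snd p i) \<in> measurable (N \<Otimes>\<^sub>M S) N" for i :: nat
      by (rule measurable_compose[OF measurable_snd]) simp
    have "(\<lambda>p. if i = k then fst p else snd p i) \<in> measurable (N \<Otimes>\<^sub>M S) N" for i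
      using c[of i] by (cases "i = k") simp_all
    then have m: "(\<lambda>p. (snd p k, \<lambda>i. if i = k then fst p else snd p i)) \<in> measurable (N \<Otimes>\<^sub>M S) (N \<Otimes>\<^sub>M S)"
      by (intro measurable_Pair measurable_PiM_single' c) (auto simp: space_PiM space)
    have eq: "?s k = (\<lambda>p. (snd p k, \<lambda>i. if i = k then fst p else snd p i))"
      by (auto simp: fun_eq_iff)
    show ?thesis unfolding eq by (rule m)
  qed
  have [measurable]: "A \<in> sets S" by (rule A)
  have F: "F k \<in> sets (N \<Otimes>\<^sub>M S)" for k
  proof -
    have "{p \<in> space (N \<Otimes>\<^sub>M S). snd p \<in> A \<and> d \<le> dist (snd p k) (fst p)} \<in> sets (N \<Otimes>\<^sub>M S)"
      by measurable
    then show ?thesis by (simp add: F_def spaceQ)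
  qed
  have EF: "E k = ?s k -` F k \<inter> space (N \<Otimes>\<^sub>M S)" for k
    by (auto simp: E_def F_def spaceQ dist_commute)
  have E: "E k \<in> sets (N \<Otimes>\<^sub>M S)" for k
    unfolding EF by (rule measurable_sets[OF s F])
  \<comment> \<open>The swap turns \<open>E k\<close> into \<open>F k\<close>, where membership in
    \<open>A\<close> no longer involves \<open>y\<close>; for fixed \<open>x\<close> in
    \<open>A\<close> the lower bound \<open>c\<close> applies to \<open>y\<close> alone.\<close>
  have mE: "emeasure (N \<Otimes>\<^sub>M S) (E k) \<ge> ennreal (c * measure S A)" for k
  proof -
    have "emeasure (N \<Otimes>\<^sub>M S) (E k) = emeasure (distr (N \<Otimes>\<^sub>M S) (N \<Otimes>\<^sub>M S) (?s k)) (F k)"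
      unfolding EF by (rule emeasure_distr[symmetric, OF s F])
    also have "\<dots> = emeasure (N \<Otimes>\<^sub>M S) (F k)" by (subst distr_swap_coordinate) simp
    also have "\<dots> = (\<integral>\<^sup>+x. emeasure N ((\<lambda>y. (y, x)) -` F k) \<partial>S)"
      by (rule Q.emeasure_pair_measure_alt2[OF F])
    also have "\<dots> \<ge> (\<integral>\<^sup>+x. ennreal c * indicator A x \<partial>S)"
    proof (rule nn_integral_mono)
      fix x
      have "(\<lambda>y. (y, x)) -` F k = {y. d \<le> dist (x k) y}" if "x \<in> A"
        using that by (auto simp: F_def)
      then show "ennreal c * indicator A x \<le> emeasure N ((\<lambda>y. (y, x)) -` F k)"
        using c(1)[of "x k"] by (auto simp: N.emeasure_eq_measure ennreal_leI split: split_indicator)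
    qed
    also have "(\<integral>\<^sup>+x. ennreal c * indicator A x \<partial>S) = ennreal (c * measure S A)"
      using c(2) by (simp add: nn_integral_cmult emeasure_eq_measure ennreal_mult)
    finally show ?thesis .
  qed
  have disj: "disjoint_family_on E B"
    unfolding disjoint_family_on_def
  proof (intro ballI impI equals0I)
    fix j k p assume jk: "j \<in> B" "k \<in> B" "j \<noteq> k" and p: "p \<in> E j \<inter> E k"
    then have a: "(snd p)(j := fst p) \<in> A" "(snd p)(k := fst p) \<in> A"
      "d \<le> dist (snd p j) (fst p)" "d \<le> dist (snd p k) (fst p)" by (auto simp: E_def)
    show False
    proof (cases "j < k")
      case True
      then show ?thesis using sep[of j k "snd p" "fst p"] jk a by blast
    next
      case False
      then show ?thesis using sep[of k j "snd p" "fst p"] jk a by auto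
    qed
  qed
  have "ennreal (card B * (c * measure S A)) = (\<Sum>k\<in>B. ennreal (c * measure S A))"
    using c(2) by (simp add: ennreal_mult ennreal_of_nat_eq_real_of_nat)
  also have "\<dots> \<le> (\<Sum>k\<in>B. emeasure (N \<Otimes>\<^sub>M S) (E k))" by (intro sum_mono mE)
  also have "\<dots> = emeasure (N \<Otimes>\<^sub>M S) (\<Union>k\<in>B. E k)"
    by (rule sum_emeasure) (use E disj B in auto)
  also have "\<dots> \<le> 1" by (rule Q.emeasure_le_1)
  finally show ?thesis using c(2) by (simp add: mult.assoc)
qed

section \<open>Growth of the random series\<close>

lemma eventually_le_imp_le_mult:
  fixes a b :: "nat \<Rightarrow> real"
  assumes ev: "\<forall>\<^sub>F k in sequentially. a k \<le> b k" and b: "\<And>k. b k > 0"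
  shows "\<exists>C>0. \<forall>k. a k \<le> C * b k"
proof -
  obtain k0 where k0: "\<And>k. k \<ge> k0 \<Longrightarrow> a k \<le> b k" using ev by (auto simp: eventually_sequentially)
  define C where "C = 1 + (\<Sum>k<k0. \<bar>a k\<bar> / b k)"
  have s: "(\<Sum>k<k0. \<bar>a k\<bar> / b k) \<ge> 0" by (intro sum_nonneg divide_nonneg_pos b) auto
  have "a k \<le> C * b k" for k
  proof (cases "k < k0")
    case True
    have "\<bar>a k\<bar> / b k \<le> (\<Sum>k<k0. \<bar>a k\<bar> / b k)"
      using True b by (intro member_le_sum divide_nonneg_pos) auto
    then have "\<bar>a k\<bar> / b k \<le> C" by (simp add: C_def)
    then have "\<bar>a k\<bar> \<le> C * b k" using b[of k] by (simp add: field_simps)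
    then show ?thesis by linarith
  next
    case False
    have "1 * b k \<le> C * b k" using s b[of k] by (intro mult_right_mono) (auto simp: C_def)
    then show ?thesis using k0[of k] False by simp
  qed
  then show ?thesis using s by (intro exI[of _ C]) (auto simp: C_def)
qed

lemma sum_indicator_less_le:
  fixes Y :: real
  assumes "Y \<ge> 0"
  shows "(\<Sum>k<n. if real k < Y then 1 else 0 :: real) \<le> Y + 1"
proof -
  have "(\<Sum>k<n. if real k < Y then 1 else 0 :: real) = card {k \<in> {..<n}. real k < Y}"
    by (subst sum.If_cases) (auto simp: Int_def)
  also have "\<dots> \<le> card {..<nat \<lceil>Y\<rceil>}"
    by (intro of_nat_mono card_mono) (auto simp: less_ceiling_iff zless_nat_eq_int_zless)
  also have "\<dots> \<le> Y + 1" using assms by simp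
  finally show ?thesis .
qed

text \<open>Borel-Cantelli: with \<open>X = ln (1 + cmod (\<xi> 0 \<omega>))\<close>, at most
  \<open>X / e + 1\<close> indices satisfy \<open>e * k < X\<close>, so the tail probabilities sum
  to at most the expectation of \<open>X / e + 1\<close>.\<close>

lemma (in prob_space) AE_subexponential:
  fixes \<xi> :: "nat \<Rightarrow> 'a \<Rightarrow> complex"
  assumes meas: "\<And>k. \<xi> k \<in> borel_measurable M"
    and id: "\<And>k. distr M borel (\<xi> k) = distr M borel (\<xi> 0)"
    and int: "integrable M (\<lambda>\<omega>. ln (1 + cmod (\<xi> 0 \<omega>)))"
  shows "AE \<omega> in M. \<forall>e>0. \<exists>C>0. \<forall>k. cmod (\<xi> k \<omega>) \<le> C * exp (e * real k)"
proof -
  note [measurable] = meas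
  let ?X = "\<lambda>\<omega>. ln (1 + cmod (\<xi> 0 \<omega>))"
  have one: "AE \<omega> in M. \<forall>\<^sub>F k in sequentially. cmod (\<xi> k \<omega>) \<le> exp (e * real k)" if e: "e > 0" for e
  proof -
    let ?A = "\<lambda>k. {\<omega> \<in> space M. e * real k < ln (1 + cmod (\<xi> k \<omega>))}"
    have eq: "prob (?A k) = prob {\<omega> \<in> space M. e * real k < ?X \<omega>}" for k
    proof -
      let ?U = "{x::complex. e * real k < ln (1 + cmod x)}"
      have U: "?U \<in> sets borel" by measurable
      have "prob (?A k) = measure (distr M borel (\<xi> k)) ?U"
        by (subst measure_distr) (use U in \<open>auto simp: vimage_def Int_def conj_commute\<close>)
      also have "\<dots> = measure (distr M borel (\<xi> 0)) ?U" by (simp only: id[of k])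
      also have "\<dots> = prob {\<omega> \<in> space M. e * real k < ?X \<omega>}"
        by (subst measure_distr) (use U in \<open>auto simp: vimage_def Int_def conj_commute\<close>)
      finally show ?thesis .
    qed
    have "summable (\<lambda>k. prob (?A k))"
    proof (rule summableI_nonneg_bounded)
      fix n
      have "(\<Sum>k<n. prob (?A k)) = (\<Sum>k<n. expectation (indicator {\<omega> \<in> space M. e * real k < ?X \<omega>}))"
        unfolding eq by (intro sum.cong refl) (simp add: Int_absorb1)
      also have "\<dots> = expectation (\<lambda>\<omega>. \<Sum>k<n. indicator {\<omega> \<in> space M. e * real k < ?X \<omega>} \<omega>)"
        by (rule Bochner_Integration.integral_sum[symmetric]) (simp add: emeasure_eq_measure)
      also have "\<dots> \<le> expectation (\<lambda>\<omega>. ?X \<omega> / e + 1)"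
      proof (rule integral_mono)
        fix \<omega> assume w: "\<omega> \<in> space M"
        have "(\<Sum>k<n. indicator {\<omega> \<in> space M. e * real k < ?X \<omega>} \<omega>) = (\<Sum>k<n. if real k < ?X \<omega> / e then 1 else 0 :: real)"
          using e w by (intro sum.cong) (auto simp: indicator_def field_simps)
        also have "\<dots> \<le> ?X \<omega> / e + 1" using e by (intro sum_indicator_less_le) auto
        finally show "(\<Sum>k<n. indicator {\<omega> \<in> space M. e * real k < ?X \<omega>} \<omega>) \<le> ?X \<omega> / e + 1" .
      qed (use int in \<open>auto simp: emeasure_eq_measure\<close>)
      finally show "(\<Sum>k<n. prob (?A k)) \<le> expectation (\<lambda>\<omega>. ?X \<omega> / e + 1)" .
    qed simp
    then have "AE \<omega> in M. \<forall>\<^sub>F k in sequentially. \<omega> \<in> space M - ?A k"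
      by (intro borel_cantelli_AE1) (auto simp: emeasure_eq_measure)
    then show ?thesis
    proof eventually_elim
      case (elim \<omega>)
      then show ?case
      proof eventually_elim
        case (elim k)
        then have "ln (1 + cmod (\<xi> k \<omega>)) \<le> e * real k" by auto
        then have "exp (ln (1 + cmod (\<xi> k \<omega>))) \<le> exp (e * real k)" by (simp only: exp_le_cancel_iff)
        then show ?case by (simp add: add_pos_nonneg)
      qed
    qed
  qed
  \<comment> \<open>Countably many rates suffice, so one null set serves all
    \<open>e\<close>.\<close>
  have "AE \<omega> in M. \<forall>m::nat. \<forall>\<^sub>F k in sequentially. cmod (\<xi> k \<omega>) \<le> exp (inverse (real (Suc m)) * real k)"
    by (subst AE_all_countable) (auto intro!: one)
  then show ?thesis
  proof eventually_elim
    case (elim \<omega>)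
    show ?case
    proof (intro allI impI)
      fix e :: real assume "e > 0"
      then obtain m where m: "inverse (real (Suc m)) < e" using reals_Archimedean by blast
      have "\<forall>\<^sub>F k in sequentially. cmod (\<xi> k \<omega>) \<le> exp (e * real k)"
        using elim[rule_format, of m]
      proof eventually_elim
        case (elim k)
        have "exp (inverse (real (Suc m)) * real k) \<le> exp (e * real k)" using m by (simp add: mult_right_mono)
        then show ?case using elim by linarith
      qed
      then show "\<exists>C>0. \<forall>k. cmod (\<xi> k \<omega>) \<le> C * exp (e * real k)"
        by (rule eventually_le_imp_le_mult) simp
    qed
  qed
qed

section \<open>Size of single terms of the series\<close>

abbreviation zoom :: "real \<Rightarrow> real \<Rightarrow> nat \<Rightarrow> real" where
  "zoom \<alpha> \<beta> n \<equiv> exp \<beta> * real n powr \<alpha>"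

abbreviation growth :: "real \<Rightarrow> complex \<Rightarrow> real" where
  "growth \<alpha> z \<equiv> \<alpha> * cmod z powr (1 / \<alpha>)"

definition coeff_size :: "real \<Rightarrow> real \<Rightarrow> nat \<Rightarrow> real" where
  "coeff_size \<alpha> \<beta> k = - \<alpha> * (real k * ln (real k) - real k) - \<beta> * real k"

lemma coeff_upper:
  assumes o: "(\<lambda>k. ln (cmod (w k)) - coeff_size \<alpha> \<beta> k) \<in> o(\<lambda>k. real k)" and e: "e > 0"
  shows "\<exists>C>0. \<forall>k. cmod (w k) \<le> C * exp (coeff_size \<alpha> \<beta> k + e * real k)"
proof (rule eventually_le_imp_le_mult)
  have "\<forall>\<^sub>F k in sequentially. norm (ln (cmod (w k)) - coeff_size \<alpha> \<beta> k) \<le> e * norm (real k)"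
    using landau_o.smallD[OF o e] .
  then show "\<forall>\<^sub>F k in sequentially. cmod (w k) \<le> exp (coeff_size \<alpha> \<beta> k + e * real k)"
  proof eventually_elim
    case (elim k)
    then have le: "ln (cmod (w k)) \<le> coeff_size \<alpha> \<beta> k + e * real k" by simp
    show ?case
    proof (cases "w k = 0")
      case False
      have "cmod (w k) = exp (ln (cmod (w k)))" using False by simp
      also have "\<dots> \<le> exp (coeff_size \<alpha> \<beta> k + e * real k)" using le by (simp only: exp_le_cancel_iff)
      finally show ?thesis .
    qed simp
  qed
qed simp

text \<open>A vanishing coefficient has \<open>ln \<bar>w k\<bar> = 0\<close> in HOL, which is incompatible with the
  asymptotics once \<open>k\<close> is large.\<close>

lemma coeff_lower:
  assumes o: "(\<lambda>k. ln (cmod (w k)) - coeff_size \<alpha> \<beta> k) \<in> o(\<lambda>k. real k)" and e: "e > 0" and \<alpha>: "\<alpha> > 0"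
  shows "\<forall>\<^sub>F k in sequentially. exp (coeff_size \<alpha> \<beta> k - e * real k) \<le> cmod (w k)"
proof -
  have "\<forall>\<^sub>F k in sequentially. norm (ln (cmod (w k)) - coeff_size \<alpha> \<beta> k) \<le> e * norm (real k)"
    using landau_o.smallD[OF o e] .
  moreover have "\<forall>\<^sub>F k in sequentially. coeff_size \<alpha> \<beta> k + e * real k < 0"
    unfolding coeff_size_def using \<alpha> by real_asymp
  ultimately show ?thesis
  proof eventually_elim
    case (elim k)
    then have le: "\<bar>ln (cmod (w k)) - coeff_size \<alpha> \<beta> k\<bar> \<le> e * real k" by simp
    have "w k \<noteq> 0"
    proof
      assume "w k = 0"
      then show False using le elim(2) by simp
    qed
    then have "cmod (w k) = exp (ln (cmod (w k)))" by simp
    moreover have "coeff_size \<alpha> \<beta> k - e * real k \<le> ln (cmod (w k))" using le by linarith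
    ultimately show ?case by (metis exp_le_cancel_iff)
  qed
qed

text \<open>This explains the zoom factor. With \<open>y = n * t powr (1 / \<alpha>)\<close> all
  parameters combine into \<open>k * ln (y / k) + k\<close>, whose maximum over real
  \<open>k\<close> is \<open>y\<close>, so the largest term has exponent
  \<open>n * \<alpha> * t powr (1 / \<alpha>)\<close>.\<close>

lemma coeff_size_scaled:
  assumes \<alpha>: "\<alpha> > 0" and n: "n > 0" and t: "t > 0"
  shows "exp (coeff_size \<alpha> \<beta> k) * (zoom \<alpha> \<beta> n * t) ^ k
     = exp (\<alpha> * (real k * ln (real n * t powr (1 / \<alpha>) / real k) + real k))"
proof (cases "k = 0")
  case True
  then show ?thesis by (simp add: coeff_size_def)
next
  case False
  have pos: "zoom \<alpha> \<beta> n * t > 0" using n t by simp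
  have "(zoom \<alpha> \<beta> n * t) ^ k = exp (real k * ln (zoom \<alpha> \<beta> n * t))"
    using pos by (simp add: exp_of_nat_mult)
  also have "ln (zoom \<alpha> \<beta> n * t) = \<beta> + \<alpha> * ln (real n) + ln t"
    using n t by (simp add: ln_mult ln_powr)
  finally have 1: "(zoom \<alpha> \<beta> n * t) ^ k = exp (real k * (\<beta> + \<alpha> * ln (real n) + ln t))" .
  have l: "ln (real n * t powr (1 / \<alpha>) / real k) = ln (real n) + ln t / \<alpha> - ln (real k)"
    using n t False by (simp add: ln_mult ln_div ln_powr)
  have "\<alpha> * (real k * ln (real n * t powr (1 / \<alpha>) / real k) + real k)
     = coeff_size \<alpha> \<beta> k + real k * (\<beta> + \<alpha> * ln (real n) + ln t)"
    unfolding l using \<alpha> by (simp add: coeff_size_def field_simps)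
  then show ?thesis unfolding 1 by (simp add: exp_add)
qed

lemma mult_ln_div_le:
  assumes y: "y > 0"
  shows "real k * ln (y / real k) + real k \<le> y"
proof (cases "k = 0")
  case False
  have "ln (y / real k) \<le> y / real k - 1" using False y by (intro ln_le_minus_one) simp
  then have "real k * ln (y / real k) \<le> real k * (y / real k - 1)" by (intro mult_left_mono) auto
  also have "\<dots> = y - real k" using False by (simp add: field_simps)
  finally show ?thesis by simp
qed (use y in simp)

text \<open>The drop from the maximum at \<open>k = y\<close> is quadratic: indices within a small
  multiple \<open>\<delta> * n\<close> of \<open>y\<close> lose only order
  \<open>\<delta>\<^sup>2 * n\<close>. Both bounds come from \<open>ln u \<le> u - 1\<close>, here
  with \<open>u = k / y\<close>.\<close>

lemma mult_ln_div_ge: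
  assumes y: "y > 0" and k: "k > 0"
  shows "real k * ln (y / real k) + real k \<ge> y - (real k - y)\<^sup>2 / y"
proof -
  have "ln (real k / y) \<le> real k / y - 1" using k y by (intro ln_le_minus_one) simp
  moreover have "ln (y / real k) = - ln (real k / y)" using k y by (simp add: ln_div)
  ultimately have "ln (y / real k) \<ge> 1 - real k / y" by linarith
  then have "real k * ln (y / real k) \<ge> real k * (1 - real k / y)" by (intro mult_left_mono) auto
  moreover have "real k * (1 - real k / y) + real k = y - (real k - y)\<^sup>2 / y"
    using y by (simp add: field_simps power2_eq_square)
  ultimately show ?thesis by linarith
qed

text \<open>The random and the deterministic coefficient each contribute an error
  \<open>e * k\<close>; one more is spent to gain the summable factor \<open>exp (- e * k)\<close>.
  All three are absorbed by enlarging \<open>t\<close> to \<open>t * exp (3 * e)\<close>, which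
  multiplies the growth by \<open>exp (3 * e / \<alpha>)\<close>.\<close>

lemma term_upper:
  assumes \<alpha>: "\<alpha> > 0" and n: "n > 0" and e: "e > 0" and t: "t \<ge> 0"
  shows "exp (coeff_size \<alpha> \<beta> k + 2 * e * real k) * (zoom \<alpha> \<beta> n * t) ^ k
     \<le> exp (- e * real k) * exp (real n * (\<alpha> * t powr (1 / \<alpha>) * exp (3 * e / \<alpha>)))"
proof (cases "t = 0")
  case True
  then show ?thesis by (cases "k = 0") (simp_all add: coeff_size_def zero_power)
next
  case False
  then have t: "t > 0" using t by simp
  let ?s = "t * exp (3 * e)"
  have e1: "(zoom \<alpha> \<beta> n * ?s) ^ k = (zoom \<alpha> \<beta> n * t) ^ k * exp (3 * e * real k)"
    by (simp add: power_mult_distrib exp_of_nat2_mult[symmetric] mult.assoc)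
  have e2: "exp (coeff_size \<alpha> \<beta> k + 2 * e * real k)
      = exp (- e * real k) * exp (coeff_size \<alpha> \<beta> k) * exp (3 * e * real k)"
    by (simp add: mult_exp_exp algebra_simps)
  have "exp (coeff_size \<alpha> \<beta> k + 2 * e * real k) * (zoom \<alpha> \<beta> n * t) ^ k
      = exp (- e * real k) * (exp (coeff_size \<alpha> \<beta> k) * (zoom \<alpha> \<beta> n * ?s) ^ k)"
    unfolding e1 e2 by (simp only: ac_simps)
  also have "\<dots> = exp (- e * real k) * exp (\<alpha> * (real k * ln (real n * ?s powr (1 / \<alpha>) / real k) + real k))"
    by (subst coeff_size_scaled[OF \<alpha> n]) (use t in auto)
  also have "\<dots> \<le> exp (- e * real k) * exp (\<alpha> * (real n * ?s powr (1 / \<alpha>)))"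
    using \<alpha> n t by (intro mult_left_mono iffD2[OF exp_le_cancel_iff] mult_ln_div_le) auto
  also have "?s powr (1 / \<alpha>) = t powr (1 / \<alpha>) * exp (3 * e / \<alpha>)"
    using t by (simp add: powr_def ln_mult add_divide_distrib exp_add)
  finally show ?thesis by (simp add: ac_simps)
qed

text \<open>Termwise domination by a geometric series in \<open>exp (- e)\<close>; \<open>n\<close>
  and \<open>z\<close> enter only through the common exponential, so one \<open>C\<close> serves all
  of them.\<close>

lemma series_upper:
  assumes o: "(\<lambda>k. ln (cmod (w k)) - coeff_size \<alpha> \<beta> k) \<in> o(\<lambda>k. real k)" and \<alpha>: "\<alpha> > 0"
    and x: "\<And>e. e > 0 \<Longrightarrow> \<exists>C>0. \<forall>k. cmod (x k) \<le> C * exp (e * real k)" and e: "e > 0"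
  shows "\<exists>C>0. \<forall>n>0. \<forall>z. summable (\<lambda>k. norm (x k * w k * (of_real (zoom \<alpha> \<beta> n) * z) ^ k)) \<and>
    cmod (\<Sum>k. x k * w k * (of_real (zoom \<alpha> \<beta> n) * z) ^ k)
      \<le> C * exp (real n * (growth \<alpha> z * exp (3 * e / \<alpha>)))"
proof -
  obtain C1 where C1: "C1 > 0" "\<And>k. cmod (x k) \<le> C1 * exp (e * real k)" using x[OF e] by blast
  obtain C2 where C2: "C2 > 0" "\<And>k. cmod (w k) \<le> C2 * exp (coeff_size \<alpha> \<beta> k + e * real k)"
    using coeff_upper[OF o e] by blast
  let ?D = "C1 * C2 / (1 - exp (- e))"
  have ge: "norm (exp (- e)) < 1" using e by simp
  show ?thesis
  proof (intro exI[of _ ?D] conjI allI impI)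
    show "?D > 0" using C1 C2 e by simp
    fix n :: nat and z :: complex assume n: "n > 0"
    let ?E = "exp (real n * (growth \<alpha> z * exp (3 * e / \<alpha>)))"
    let ?a = "\<lambda>k. x k * w k * (of_real (zoom \<alpha> \<beta> n) * z) ^ k"
    have le: "norm (?a k) \<le> C1 * C2 * ?E * exp (- e) ^ k" for k
    proof -
      have "norm (?a k) = cmod (x k) * cmod (w k) * (zoom \<alpha> \<beta> n * cmod z) ^ k"
        by (simp add: norm_mult norm_power)
      also have "\<dots> \<le> (C1 * exp (e * real k)) * (C2 * exp (coeff_size \<alpha> \<beta> k + e * real k)) * (zoom \<alpha> \<beta> n * cmod z) ^ k"
        using C1 C2 by (intro mult_right_mono mult_mono) auto
      also have "\<dots> = C1 * C2 * (exp (coeff_size \<alpha> \<beta> k + 2 * e * real k) * (zoom \<alpha> \<beta> n * cmod z) ^ k)"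
        by (simp add: mult_exp_exp ac_simps)
      also have "\<dots> \<le> C1 * C2 * (exp (- e * real k) * ?E)"
        using C1 C2 by (intro mult_left_mono term_upper[OF \<alpha> n e]) auto
      also have "\<dots> = C1 * C2 * ?E * exp (- e) ^ k"
        by (simp add: exp_of_nat2_mult[symmetric])
      finally show ?thesis .
    qed
    have geo: "(\<lambda>k. C1 * C2 * ?E * exp (- e) ^ k) sums (C1 * C2 * ?E * (1 / (1 - exp (- e))))"
      by (intro sums_mult geometric_sums ge)
    show s: "summable (\<lambda>k. norm (?a k))"
      by (rule summable_comparison_test[OF _ sums_summable[OF geo]]) (use le in auto)
    have "cmod (\<Sum>k. ?a k) \<le> (\<Sum>k. norm (?a k))" by (rule summable_norm[OF s])
    also have "\<dots> \<le> (\<Sum>k. C1 * C2 * ?E * exp (- e) ^ k)"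
      by (rule suminf_le[OF le s sums_summable[OF geo]])
    also have "\<dots> = ?D * ?E" using sums_unique[OF geo] by simp
    finally show "cmod (\<Sum>k. ?a k) \<le> ?D * ?E" .
  qed
qed

section \<open>Small values at two points\<close>

text \<open>Two monomials of different degrees cannot almost cancel on two circles, as their ratio changes
  by at least the factor \<open>Q\<close> between the circles.\<close>

lemma two_radii_contradiction:
  fixes u v A Q L \<rho>1 \<rho>2 :: real
  assumes Q: "Q > 1" and L: "L > 2" "1 + 2 / L \<le> Q * (1 - 2 / L)" and m: "m > 0"
    and pos: "v > 0" "A > 0" and big: "L * \<rho>1 \<le> v" "L * \<rho>2 \<le> v * A * Q ^ m"
    and close: "\<bar>u - v\<bar> < 2 * \<rho>1" "\<bar>u * A - v * A * Q ^ m\<bar> < 2 * \<rho>2"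
  shows False
proof -
  \<comment> \<open>The first circle gives \<open>u < v * (1 + 2 / L)\<close>, the second
    \<open>u > v * Q ^ m * (1 - 2 / L)\<close>; already for \<open>m = 1\<close> these are
    incompatible.\<close>
  have "\<rho>1 \<le> v / L" "\<rho>2 \<le> v * A * Q ^ m / L" using big L by (auto simp: field_simps)
  then have 1: "u < v + 2 * (v / L)" and 2: "u * A > v * A * Q ^ m - 2 * (v * A * Q ^ m / L)"
    using close by linarith+
  have "v * A * Q ^ m - 2 * (v * A * Q ^ m / L) < (v + 2 * (v / L)) * A"
    using 2 mult_strict_right_mono[OF 1 pos(2)] by linarith
  then have "(v * A) * (Q ^ m * (1 - 2 / L)) < (v * A) * (1 + 2 / L)" by (simp add: algebra_simps)
  then have "Q ^ m * (1 - 2 / L) < 1 + 2 / L" using pos by simp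
  moreover have "Q * (1 - 2 / L) \<le> Q ^ m * (1 - 2 / L)"
    using Q L m self_le_power[of Q m] by (intro mult_right_mono) auto
  ultimately show False using L by linarith
qed

lemma suminf_two_updates:
  fixes x b :: "nat \<Rightarrow> complex"
  assumes s: "summable (\<lambda>m. (x(j := y)) m * b m)" "summable (\<lambda>m. (x(k := y)) m * b m)"
  shows "(\<Sum>m. (x(j := y)) m * b m) - (\<Sum>m. (x(k := y)) m * b m) = (y - x j) * b j - (y - x k) * b k"
proof -
  have eq: "(\<lambda>m. (x(j := y)) m * b m - (x(k := y)) m * b m)
      = (\<lambda>m. (if m = j then (y - x m) * b m else 0) - (if m = k then (y - x m) * b m else 0))"
  proof
    fix m
    show "(x(j := y)) m * b m - (x(k := y)) m * b m
      = (if m = j then (y - x m) * b m else 0) - (if m = k then (y - x m) * b m else 0)"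
      by (cases "m = j"; cases "m = k") (simp_all add: left_diff_distrib)
  qed
  have "(\<lambda>m. (if m = j then (y - x m) * b m else 0) - (if m = k then (y - x m) * b m else 0))
      sums ((y - x j) * b j - (y - x k) * b k)"
    by (intro sums_diff sums_single)
  then show ?thesis
    by (rule sums_unique2[OF sums_diff[OF summable_sums[OF s(1)] summable_sums[OF s(2)], unfolded eq]])
qed

lemma card_nat_interval_ge:
  fixes a b :: real
  assumes "0 \<le> a"
  shows "finite {k. a \<le> real k \<and> real k \<le> b}" "real (card {k. a \<le> real k \<and> real k \<le> b}) \<ge> b - a - 1"
proof -
  have "{k. a \<le> real k \<and> real k \<le> b} \<subseteq> {..nat \<lfloor>b\<rfloor>}" by (auto simp: le_nat_floor)
  then show fin: "finite {k. a \<le> real k \<and> real k \<le> b}" by (rule finite_subset) simp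
  show "real (card {k. a \<le> real k \<and> real k \<le> b}) \<ge> b - a - 1"
  proof (cases "b - a - 1 \<le> 0")
    case False
    have "{nat \<lceil>a\<rceil>..nat \<lfloor>b\<rfloor>} \<subseteq> {k. a \<le> real k \<and> real k \<le> b}"
    proof
      fix k assume k: "k \<in> {nat \<lceil>a\<rceil>..nat \<lfloor>b\<rfloor>}"
      have "a \<le> real k" using k assms by (simp add: nat_le_iff ceiling_le_iff)
      moreover have "real k \<le> b" using k False assms by (simp add: le_nat_iff le_floor_iff)
      ultimately show "k \<in> {k. a \<le> real k \<and> real k \<le> b}" by simp
    qed
    then have "card {nat \<lceil>a\<rceil>..nat \<lfloor>b\<rfloor>} \<le> card {k. a \<le> real k \<and> real k \<le> b}" by (intro card_mono fin)
    moreover have "real (card {nat \<lceil>a\<rceil>..nat \<lfloor>b\<rfloor>}) \<ge> b - a - 1"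
    proof -
      have "real (nat \<lfloor>b\<rfloor>) \<ge> b - 1" using False assms by linarith
      moreover have "real (nat \<lceil>a\<rceil>) \<le> a + 1" using assms by linarith
      ultimately show ?thesis by (simp add: of_nat_diff)
    qed
    ultimately show ?thesis by linarith
  qed auto
qed

text \<open>For \<open>k / n\<close> and \<open>t powr (1 / \<alpha>)\<close> both in
  \<open>{s1..s2}\<close>, the quadratic drop costs at most \<open>n * e / 2\<close> by
  \<open>sep\<close>, and the \<open>o(k)\<close> error \<open>n * e / 4\<close>. The remaining
  quarter of \<open>e\<close> later gives these terms an exponentially large advantage over the
  threshold.\<close>

lemma term_lower:
  assumes o: "(\<lambda>k. ln (cmod (w k)) - coeff_size \<alpha> \<beta> k) \<in> o(\<lambda>k. real k)" and \<alpha>: "\<alpha> > 0"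
    and s: "0 < s1" "s1 < s2" and e: "e > 0" and sep: "\<alpha> * ((s2 - s1)\<^sup>2 / s1) \<le> e / 2"
  shows "\<forall>\<^sub>F n in sequentially. \<forall>k. real n * s1 \<le> real k \<and> real k \<le> real n * s2 \<longrightarrow>
     (\<forall>t>0. s1 \<le> t powr (1 / \<alpha>) \<and> t powr (1 / \<alpha>) \<le> s2 \<longrightarrow>
       exp (real n * (\<alpha> * t powr (1 / \<alpha>) - 3 * e / 4)) \<le> cmod (w k) * (zoom \<alpha> \<beta> n * t) ^ k)"
proof -
  \<comment> \<open>Chosen so that \<open>e' * k \<le> n * e / 4\<close> for all
    \<open>k \<le> n * s2\<close>.\<close>
  define e' where "e' = e / (4 * s2)"
  have e': "e' > 0" using e s by (simp add: e'_def)
  obtain k0 where k0: "\<And>k. k \<ge> k0 \<Longrightarrow> exp (coeff_size \<alpha> \<beta> k - e' * real k) \<le> cmod (w k)"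
    using coeff_lower[OF o e' \<alpha>] by (auto simp: eventually_sequentially)
  have "\<forall>\<^sub>F n in sequentially. real n > real k0 / s1"
    by (rule eventually_compose_filterlim[OF eventually_gt_at_top filterlim_real_sequentially])
  then show ?thesis using eventually_gt_at_top[of 0]
  proof (eventually_elim, intro allI impI, elim conjE)
    fix n k :: nat and t :: real
    assume n0: "real k0 / s1 < real n" "0 < n" and k: "real n * s1 \<le> real k" "real k \<le> real n * s2"
      and t: "t > 0" "s1 \<le> t powr (1 / \<alpha>)" "t powr (1 / \<alpha>) \<le> s2"
    define y where "y = real n * t powr (1 / \<alpha>)"
    have y: "y > 0" "real n * s1 \<le> y" "y \<le> real n * s2" using n0 t s by (auto simp: y_def)
    have "real k0 < real n * s1" using n0 s by (simp add: field_simps)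
    then have kk: "k \<ge> k0" using k by linarith
    have "0 < real n * s1" using n0 s by simp
    then have kpos: "k > 0" using k by (metis gr0I leD of_nat_0)
    have "\<bar>real k - y\<bar> \<le> real n * (s2 - s1)" using k y by (simp add: abs_le_iff algebra_simps)
    then have "(real k - y)\<^sup>2 \<le> (real n * (s2 - s1))\<^sup>2" by (metis abs_ge_zero power2_abs power_mono)
    then have "(real k - y)\<^sup>2 / y \<le> (real n * (s2 - s1))\<^sup>2 / (real n * s1)"
      using y \<open>0 < real n * s1\<close> by (intro frac_le) auto
    also have "\<dots> = real n * ((s2 - s1)\<^sup>2 / s1)"
      using n0 by (simp add: power_mult_distrib power2_eq_square)
    finally have q: "(real k - y)\<^sup>2 / y \<le> real n * ((s2 - s1)\<^sup>2 / s1)" .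
    have "\<alpha> * ((real k - y)\<^sup>2 / y) \<le> real n * (\<alpha> * ((s2 - s1)\<^sup>2 / s1))"
      using mult_left_mono[OF q, of \<alpha>] \<alpha> by (simp add: mult.left_commute)
    also have "\<dots> \<le> real n * (e / 2)" using sep by (intro mult_left_mono) auto
    finally have a1: "\<alpha> * ((real k - y)\<^sup>2 / y) \<le> real n * (e / 2)" .
    have "e' * real k \<le> e' * (real n * s2)" using k e' by (intro mult_left_mono) auto
    also have "\<dots> = real n * (e / 4)" using s by (simp add: e'_def)
    finally have a2: "e' * real k \<le> real n * (e / 4)" .
    have "\<alpha> * (y - (real k - y)\<^sup>2 / y) \<le> \<alpha> * (real k * ln (y / real k) + real k)"
      using \<alpha> by (intro mult_left_mono mult_ln_div_ge y kpos) auto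
    then have "\<alpha> * y - real n * (e / 2) \<le> \<alpha> * (real k * ln (y / real k) + real k)"
      using a1 by (simp add: right_diff_distrib)
    then have "real n * (\<alpha> * t powr (1 / \<alpha>) - 3 * e / 4) \<le> \<alpha> * (real k * ln (y / real k) + real k) - e' * real k"
      using a2 by (simp add: y_def algebra_simps)
    then have "exp (real n * (\<alpha> * t powr (1 / \<alpha>) - 3 * e / 4)) \<le> exp (\<alpha> * (real k * ln (y / real k) + real k) - e' * real k)"
      by simp
    also have "\<dots> = exp (coeff_size \<alpha> \<beta> k) * (zoom \<alpha> \<beta> n * t) ^ k * exp (- e' * real k)"
      unfolding coeff_size_scaled[OF \<alpha> n0(2) t(1)] y_def by (simp add: mult_exp_exp)
    also have "\<dots> = exp (coeff_size \<alpha> \<beta> k - e' * real k) * (zoom \<alpha> \<beta> n * t) ^ k"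
      by (simp add: exp_diff exp_minus field_simps)
    also have "\<dots> \<le> cmod (w k) * (zoom \<alpha> \<beta> n * t) ^ k"
      using t by (intro mult_right_mono k0 kk) auto
    finally show "exp (real n * (\<alpha> * t powr (1 / \<alpha>) - 3 * e / 4)) \<le> cmod (w k) * (zoom \<alpha> \<beta> n * t) ^ k" .
  qed
qed

text \<open>The event lives on all coefficient sequences, including those for which the series
  diverges and \<open>suminf\<close> says nothing. Summability is made part of it because two such
  series are subtracted in the resampling step.\<close>

definition small_event :: "(nat \<Rightarrow> complex) \<Rightarrow> real \<Rightarrow> real \<Rightarrow> real \<Rightarrow> nat \<Rightarrow> complex set \<Rightarrow> (nat \<Rightarrow> complex) set" where
  "small_event w \<alpha> \<beta> e n Z = {x. \<forall>z\<in>Z.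
     summable (\<lambda>k. x k * (w k * (of_real (zoom \<alpha> \<beta> n) * z) ^ k)) \<and>
     cmod (\<Sum>k. x k * (w k * (of_real (zoom \<alpha> \<beta> n) * z) ^ k)) < exp (real n * (growth \<alpha> z - e))}"

lemma small_event_sets:
  assumes "finite Z"
  shows "small_event w \<alpha> \<beta> e n Z \<in> sets (Pi\<^sub>M UNIV (\<lambda>_::nat. borel :: complex measure))"
proof -
  let ?P = "Pi\<^sub>M UNIV (\<lambda>_::nat. borel :: complex measure)"
  let ?a = "\<lambda>z x k. x k * (w k * (of_real (zoom \<alpha> \<beta> n) * z) ^ k)"
  have [measurable]: "(\<lambda>x. ?a z x k) \<in> borel_measurable ?P" for z k
    by (intro borel_measurable_times measurable_component_singleton) auto
  have s: "{x \<in> space ?P. summable (?a z x)} \<in> sets ?P" for z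
    unfolding summable_iff_convergent Cauchy_convergent_iff[symmetric] by measurable
  have c: "{x \<in> space ?P. cmod (\<Sum>k. ?a z x k) < r} \<in> sets ?P" for z r
    by measurable
  have "small_event w \<alpha> \<beta> e n Z = {x \<in> space ?P. \<forall>z\<in>Z. summable (?a z x) \<and>
      cmod (\<Sum>k. ?a z x k) < exp (real n * (growth \<alpha> z - e))}"
    by (auto simp: small_event_def space_PiM)
  also have "\<dots> \<in> sets ?P"
    using s c assms by (intro sets.sets_Collect_finite_All sets.sets_Collect_conj) auto
  finally show ?thesis .
qed

text \<open>Anti-concentration over the indices \<open>k\<close> with
  \<open>n * s1 \<le> k \<le> n * s2\<close>. If resampling either of two of them led into the
  event, the two changes would nearly cancel at \<open>z1\<close> and at \<open>z2\<close>,
  contradicting the two radii.\<close>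

lemma small_event_bound:
  assumes N: "prob_space N" "sets N = sets borel"
    and c: "\<And>x. measure N {y. d \<le> dist x y} \<ge> c" "c > 0" and d: "d > 0"
    and o: "(\<lambda>k. ln (cmod (w k)) - coeff_size \<alpha> \<beta> k) \<in> o(\<lambda>k. real k)" and \<alpha>: "\<alpha> > 0" and e: "e > 0"
    and z: "0 < cmod z1" "cmod z1 < cmod z2"
    and sep: "\<alpha> * ((cmod z2 powr (1 / \<alpha>) - cmod z1 powr (1 / \<alpha>))\<^sup>2 / cmod z1 powr (1 / \<alpha>)) \<le> e / 2"
  shows "\<exists>K. \<forall>\<^sub>F n in sequentially. measure (Pi\<^sub>M UNIV (\<lambda>_::nat. N)) (small_event w \<alpha> \<beta> e n {z1, z2}) \<le> K / real n"
proof -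
  define s1 where "s1 = cmod z1 powr (1 / \<alpha>)"
  define s2 where "s2 = cmod z2 powr (1 / \<alpha>)"
  have s: "0 < s1" "s1 < s2" using z \<alpha> by (auto simp: s1_def s2_def intro!: powr_less_mono2)
  define Q where "Q = cmod z2 / cmod z1"
  have Q: "Q > 1" using z by (simp add: Q_def)
  \<comment> \<open>A changed term is at least \<open>d\<close> times the advantage
    \<open>exp (n * e / 4)\<close> over the threshold. As this ratio tends to infinity,
    \<open>Q * (1 - 2 / L) - (1 + 2 / L)\<close> tends to \<open>Q - 1 > 0\<close>, so any two
    distinct radii are eventually good enough.\<close>
  let ?L = "\<lambda>n::nat. d * exp (real n * (e / 4))"
  have L: "filterlim ?L at_top sequentially" using d e by real_asymp
  have "((\<lambda>x. Q * (1 - 2 / x) - (1 + 2 / x)) \<longlongrightarrow> Q * (1 - 0) - (1 + 0)) at_top"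
    by (intro tendsto_intros tendsto_divide_0[OF tendsto_const] filterlim_at_top_imp_at_infinity filterlim_ident)
  then have "\<forall>\<^sub>F x in at_top. Q * (1 - 2 / x) - (1 + 2 / x) > (0::real)"
    by (rule order_tendstoD) (use Q in simp)
  then have evL: "\<forall>\<^sub>F n in sequentially. Q * (1 - 2 / ?L n) - (1 + 2 / ?L n) > 0"
    by (rule eventually_compose_filterlim[OF _ L])
  have evL2: "\<forall>\<^sub>F n in sequentially. ?L n > 2"
    by (rule eventually_compose_filterlim[OF eventually_gt_at_top L])
  have evn: "\<forall>\<^sub>F n in sequentially. real n > 2 / (s2 - s1)"
    by (rule eventually_compose_filterlim[OF eventually_gt_at_top filterlim_real_sequentially])
  have "\<forall>\<^sub>F n in sequentially. measure (Pi\<^sub>M UNIV (\<lambda>_::nat. N)) (small_event w \<alpha> \<beta> e n {z1, z2}) \<le> (2 / (c * (s2 - s1))) / real n"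
    using term_lower[OF o \<alpha> s e sep[folded s1_def s2_def]] evL evL2 evn eventually_gt_at_top[of 0]
  proof eventually_elim
    case (elim n)
    let ?A = "small_event w \<alpha> \<beta> e n {z1, z2}"
    let ?R = "zoom \<alpha> \<beta> n"
    let ?B = "{k. real n * s1 \<le> real k \<and> real k \<le> real n * s2}"
    let ?b = "\<lambda>k z. w k * (of_real ?R * z) ^ k"
    let ?\<rho> = "\<lambda>z. exp (real n * (growth \<alpha> z - e))"
    note B = card_nat_interval_ge[of "real n * s1" "real n * s2"]
    have R: "?R > 0" using elim(5) by simp
    have nb: "cmod (?b k z) = cmod (w k) * (?R * cmod z) ^ k" for k z
      using R by (simp add: norm_mult norm_power)
    have big: "exp (real n * (e / 4)) * ?\<rho> z \<le> cmod (?b k z)" if "k \<in> ?B" "z \<in> {z1, z2}" for k z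
    proof -
      have "exp (real n * (e / 4)) * ?\<rho> z = exp (real n * (growth \<alpha> z - 3 * e / 4))"
        by (simp add: mult_exp_exp algebra_simps)
      also have "\<dots> \<le> cmod (w k) * (?R * cmod z) ^ k"
        using elim(1) that z(1) less_trans[OF z] s by (auto simp: s1_def s2_def)
      finally show ?thesis unfolding nb .
    qed
    have "real (card ?B) * c * measure (Pi\<^sub>M UNIV (\<lambda>_::nat. N)) ?A \<le> 1"
    proof (rule iid_anti_concentration[OF N c])
      have "sets (Pi\<^sub>M UNIV (\<lambda>_::nat. N)) = sets (Pi\<^sub>M UNIV (\<lambda>_::nat. borel))"
        by (intro sets_PiM_cong refl N)
      then show "?A \<in> sets (Pi\<^sub>M UNIV (\<lambda>_::nat. N))" using small_event_sets[of "{z1, z2}"] by simp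
      show "finite ?B" using B(1) s by simp
      fix x y j k
      assume jk: "j \<in> ?B" "k \<in> ?B" "j < k" and A: "x(j := y) \<in> ?A" "x(k := y) \<in> ?A"
        and dd: "d \<le> dist (x j) y" "d \<le> dist (x k) y"
      have close: "\<bar>cmod (y - x j) * cmod (?b j z) - cmod (y - x k) * cmod (?b k z)\<bar> < 2 * ?\<rho> z" if zz: "z \<in> {z1, z2}" for z
      proof -
        have sm: "summable (\<lambda>m. (x(j := y)) m * ?b m z)" "summable (\<lambda>m. (x(k := y)) m * ?b m z)"
          and le: "cmod (\<Sum>m. (x(j := y)) m * ?b m z) < ?\<rho> z" "cmod (\<Sum>m. (x(k := y)) m * ?b m z) < ?\<rho> z"
          using A zz unfolding small_event_def by blast+
        have "\<bar>cmod ((y - x j) * ?b j z) - cmod ((y - x k) * ?b k z)\<bar> \<le> cmod ((y - x j) * ?b j z - (y - x k) * ?b k z)"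
          by (rule norm_triangle_ineq3)
        also have "\<dots> = cmod ((\<Sum>m. (x(j := y)) m * ?b m z) - (\<Sum>m. (x(k := y)) m * ?b m z))"
          by (simp only: suminf_two_updates[OF sm])
        also have "\<dots> \<le> cmod (\<Sum>m. (x(j := y)) m * ?b m z) + cmod (\<Sum>m. (x(k := y)) m * ?b m z)"
          by (rule norm_triangle_ineq4)
        also have "\<dots> < 2 * ?\<rho> z" using le by linarith
        finally show ?thesis by (simp only: norm_mult)
      qed
      let ?v = "cmod (y - x k) * cmod (?b k z1)" and ?u = "cmod (y - x j) * cmod (?b j z1)"
      have z2: "(?R * cmod z2) ^ m = (?R * cmod z1) ^ m * Q ^ m" for m
      proof -
        have zq: "cmod z2 = cmod z1 * Q" using z by (simp add: Q_def)
        show ?thesis unfolding zq by (simp only: power_mult_distrib mult.assoc)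
      qed
      have Qk: "Q ^ k = Q ^ j * Q ^ (k - j)" using jk(3) by (simp add: power_add[symmetric])
      have v2: "cmod (y - x k) * cmod (?b k z2) = ?v * Q ^ j * Q ^ (k - j)"
        unfolding nb z2 Qk by (simp only: mult.assoc)
      have u2: "cmod (y - x j) * cmod (?b j z2) = ?u * Q ^ j"
        unfolding nb z2 by (simp only: mult.assoc)
      have Lv: "?L n * ?\<rho> z \<le> cmod (y - x k) * cmod (?b k z)" if "z \<in> {z1, z2}" for z
      proof -
        have "d * (exp (real n * (e / 4)) * ?\<rho> z) \<le> cmod (y - x k) * cmod (?b k z)"
          using dd(2) d by (intro mult_mono big jk that) (auto simp: dist_norm norm_minus_commute)
        then show ?thesis by (simp only: mult.assoc)
      qed
      show False
      proof (rule two_radii_contradiction[of Q "?L n" "k - j" ?v "Q ^ j" "?\<rho> z1" "?\<rho> z2" ?u])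
        show "1 < Q" "2 < ?L n" "1 + 2 / ?L n \<le> Q * (1 - 2 / ?L n)" "0 < k - j" "0 < Q ^ j"
          using Q elim(2,3) jk(3) by auto
        show "?L n * ?\<rho> z1 \<le> ?v" by (rule Lv) simp
        then show "0 < ?v" using elim(3) by (smt (verit) exp_gt_zero mult_pos_pos)
        show "?L n * ?\<rho> z2 \<le> ?v * Q ^ j * Q ^ (k - j)" unfolding v2[symmetric] by (rule Lv) simp
        show "\<bar>?u - ?v\<bar> < 2 * ?\<rho> z1" by (rule close) simp
        show "\<bar>?u * Q ^ j - ?v * Q ^ j * Q ^ (k - j)\<bar> < 2 * ?\<rho> z2"
          unfolding v2[symmetric] u2[symmetric] by (rule close) simp
      qed
    qed
    \<comment> \<open>Rounding loses at most one index, and by \<open>evn\<close> one is at most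
      half of the interval length.\<close>
    moreover have "real n * (s2 - s1) / 2 \<le> real (card ?B)"
    proof -
      have half: "X / 2 \<le> X - 1" if "2 < X" for X :: real using that by simp
      have "2 < real n * (s2 - s1)" using elim(4) s by (simp add: field_simps)
      then have "real n * (s2 - s1) / 2 \<le> real n * s2 - real n * s1 - 1"
        using half[of "real n * (s2 - s1)"] by (simp only: right_diff_distrib)
      then show ?thesis using B(2) s by (meson less_eq_real_def mult_nonneg_nonneg of_nat_0_le_iff order_trans)
    qed
    then have "real n * (s2 - s1) / 2 * c * measure (Pi\<^sub>M UNIV (\<lambda>_::nat. N)) ?A
        \<le> real (card ?B) * c * measure (Pi\<^sub>M UNIV (\<lambda>_::nat. N)) ?A"
      using c(2) by (intro mult_right_mono) auto
    ultimately have "real n * (s2 - s1) / 2 * c * measure (Pi\<^sub>M UNIV (\<lambda>_::nat. N)) ?A \<le> 1" by linarith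
    then show ?case using s c(2) elim(5) by (simp add: field_simps)
  qed
  then show ?thesis by blast
qed

section \<open>Almost sure lower bound at some point of a disc\<close>

lemma two_radii_exist:
  fixes a :: complex
  assumes d: "d > 0" and e: "e > 0" and p: "p > 0" and \<alpha>: "\<alpha> > 0"
  shows "\<exists>z1\<in>ball a d. \<exists>z2\<in>ball a d. 0 < cmod z1 \<and> cmod z1 < cmod z2 \<and>
    \<alpha> * ((cmod z2 powr p - cmod z1 powr p)\<^sup>2 / cmod z1 powr p) \<le> e"
proof -
  \<comment> \<open>Both points lie on the ray through \<open>a\<close>, any ray if
    \<open>a = 0\<close>, at radii \<open>r\<close> and \<open>r + h\<close>. Moving outwards by
    \<open>d / 3\<close> makes the smaller radius positive; as \<open>h\<close> tends to 0 the
    separation term does too.\<close>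
  define u where "u = (if a = 0 then 1 else a / of_real (cmod a))"
  have u: "cmod u = 1" "a = of_real (cmod a) * u" by (auto simp: u_def norm_divide)
  define r where "r = cmod a + d / 3"
  have r: "r > 0" using d by (simp add: r_def add_nonneg_pos)
  have "((\<lambda>h. \<alpha> * (((r + h) powr p - r powr p)\<^sup>2 / r powr p)) \<longlongrightarrow> \<alpha> * (((r + 0) powr p - r powr p)\<^sup>2 / r powr p)) (at_right 0)"
    using r by (intro tendsto_intros) auto
  then have "\<forall>\<^sub>F h in at_right 0. \<alpha> * (((r + h) powr p - r powr p)\<^sup>2 / r powr p) < e"
    by (rule order_tendstoD) (use e in simp)
  moreover have "\<forall>\<^sub>F h in at_right (0::real). h < d / 3 \<and> h > 0"
    using d by (intro eventually_at_rightI[of 0 "d / 3"]) auto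
  ultimately have "\<forall>\<^sub>F h in at_right 0. \<alpha> * (((r + h) powr p - r powr p)\<^sup>2 / r powr p) < e \<and> h < d / 3 \<and> h > 0"
    by (rule eventually_conj)
  then obtain h where h: "\<alpha> * (((r + h) powr p - r powr p)\<^sup>2 / r powr p) < e" "h < d / 3" "h > 0"
    using eventually_happens trivial_limit_at_right_real by (metis (mono_tags, lifting))
  have nrm: "cmod (of_real x * u) = x" if "x > 0" for x using that u by (simp add: norm_mult)
  have "of_real r * u \<in> ball a d" "of_real (r + h) * u \<in> ball a d"
  proof -
    have dst: "dist a (of_real x * u) = \<bar>cmod a - x\<bar>" for x
    proof -
      have "a - of_real x * u = of_real (cmod a - x) * u" by (subst u(2)) (simp add: algebra_simps)
      then show ?thesis using u(1) by (simp add: dist_norm norm_mult del: of_real_diff)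
    qed
    show "of_real r * u \<in> ball a d" "of_real (r + h) * u \<in> ball a d"
      unfolding mem_ball dst using d h by (auto simp: r_def)
  qed
  moreover have "cmod (of_real (r + h) * u) = r + h" "cmod (of_real r * u) = r"
    using nrm[of "r + h"] nrm[of r] r h by (simp_all del: of_real_add)
  ultimately show ?thesis using h r by (intro bexI[of _ "of_real r * u"] bexI[of _ "of_real (r + h) * u"]) auto
qed

text \<open>A bound of order \<open>1 / n\<close> is summable only along a subsequence such as the
  squares. For other \<open>n\<close> the good point belonging to the largest square below
  \<open>n\<close> is rescaled; it moves little and stays in the open disc.\<close>

lemma (in prob_space) AE_large_point:
  fixes \<xi> :: "nat \<Rightarrow> 'a \<Rightarrow> complex"
  assumes indep: "indep_vars (\<lambda>_. borel) \<xi> UNIV"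
    and id: "\<And>k. distr M borel (\<xi> k) = distr M borel (\<xi> 0)" and nd: "nondegenerate M (\<xi> 0)"
    and o: "(\<lambda>k. ln (cmod (w k)) - coeff_size \<alpha> \<beta> k) \<in> o(\<lambda>k. real k)" and \<alpha>: "\<alpha> > 0"
    and sum: "AE \<omega> in M. \<forall>n>0. \<forall>z. summable (\<lambda>k. norm (\<xi> k \<omega> * w k * (of_real (zoom \<alpha> \<beta> n) * z) ^ k))"
    and d: "d > 0" and e: "e > 0"
  shows "AE \<omega> in M. \<forall>\<^sub>F n in sequentially. \<exists>z\<in>ball a d.
     exp (real n * (growth \<alpha> z - e)) \<le> cmod (random_series \<xi> w \<omega> (of_real (zoom \<alpha> \<beta> n) * z))"
proof -
  have meas: "\<xi> k \<in> borel_measurable M" for k using indep unfolding indep_vars_def by auto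
  let ?N = "distr M borel (\<xi> 0)"
  let ?P = "Pi\<^sub>M UNIV (\<lambda>_::nat. ?N)"
  let ?R = "\<lambda>n::nat. complex_of_real (zoom \<alpha> \<beta> n)"
  have N: "prob_space ?N" by (rule prob_space_distr[OF meas])
  have "\<not> (\<exists>c. AE x in ?N. x = c)"
    using nd meas[of 0] unfolding nondegenerate_def by (subst AE_distr_iff) auto
  then obtain c d0 where c: "c > 0" "d0 > 0" "\<And>x. measure ?N {y. d0 \<le> dist x y} \<ge> c"
    using nondegenerate_spread[OF N] by auto
  obtain z1 z2 where z: "z1 \<in> ball a d" "z2 \<in> ball a d" "0 < cmod z1" "cmod z1 < cmod z2"
    and sep: "\<alpha> * ((cmod z2 powr (1 / \<alpha>) - cmod z1 powr (1 / \<alpha>))\<^sup>2 / cmod z1 powr (1 / \<alpha>)) \<le> e / 2"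
    using two_radii_exist[OF d, of "e / 2" "1 / \<alpha>" \<alpha> a] e \<alpha> by auto
  let ?A = "\<lambda>n. small_event w \<alpha> \<beta> e n {z1, z2}"
  obtain K where K: "\<forall>\<^sub>F n in sequentially. measure ?P (?A n) \<le> K / real n"
    using small_event_bound[OF N _ c(3,1,2) o \<alpha> e z(3,4) sep] by auto
  let ?X = "\<lambda>\<omega> k. \<xi> k \<omega>"
  have X: "?X \<in> measurable M (Pi\<^sub>M UNIV (\<lambda>_. borel))"
    by (intro measurable_PiM_single') (use meas in auto)
  have "distr M (Pi\<^sub>M UNIV (\<lambda>_. borel)) ?X = Pi\<^sub>M UNIV (\<lambda>i. distr M borel (\<xi> i))"
    using indep_vars_iff_distr_eq_PiM'[where I = UNIV and M' = "\<lambda>_. borel" and X = \<xi>] indep meas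
    by (simp add: restrict_UNIV)
  also have "\<dots> = ?P" by (intro PiM_cong refl id)
  finally have PX: "distr M (Pi\<^sub>M UNIV (\<lambda>_. borel)) ?X = ?P" .
  define E where "E j = {\<omega> \<in> space M. ?X \<omega> \<in> ?A (j\<^sup>2)}" for j
  have E: "E j \<in> sets M" for j
  proof -
    have "?X -` ?A (j\<^sup>2) \<inter> space M \<in> sets M"
      by (rule measurable_sets[OF X small_event_sets]) simp
    then show ?thesis by (simp add: E_def vimage_def Int_def conj_commute)
  qed
  have PE: "prob (E j) = measure ?P (?A (j\<^sup>2))" for j
    unfolding PX[symmetric] by (subst measure_distr[OF X small_event_sets]) (auto simp: E_def vimage_def Int_def conj_commute)
  have "summable (\<lambda>j. prob (E j))"
  proof (rule summable_comparison_test_ev)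
    have "filterlim (\<lambda>j::nat. j\<^sup>2) sequentially sequentially"
      by (rule filterlim_subseq) (auto simp: strict_mono_def power_strict_mono)
    from eventually_compose_filterlim[OF K this]
    show "\<forall>\<^sub>F j in sequentially. norm (prob (E j)) \<le> K * inverse (real j ^ 2)"
      by eventually_elim (simp add: PE divide_inverse)
    show "summable (\<lambda>j. K * inverse (real j ^ 2))"
      by (intro summable_mult inverse_power_summable) simp
  qed
  then have BC: "AE \<omega> in M. \<forall>\<^sub>F j in sequentially. \<omega> \<in> space M - E j"
    by (intro borel_cantelli_AE1 E) (auto simp: emeasure_eq_measure)
  define g where "g n = nat \<lfloor>sqrt (real n)\<rfloor>" for n :: nat
  \<comment> \<open>The factor by which the zoom changes from \<open>n\<close> down to the square
    \<open>(g n)\<^sup>2\<close>: multiplying the point by \<open>h n\<close> yields the same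
    argument of the series.\<close>
  define h where "h n = ((real (g n))\<^sup>2 / real n) powr \<alpha>" for n
  have rg: "real (g n) = real_of_int \<lfloor>sqrt (real n)\<rfloor>" for n by (simp add: g_def)
  have "filterlim (\<lambda>n. real (g n)) at_top sequentially" unfolding rg by real_asymp
  then have g: "filterlim g sequentially sequentially" by (simp add: filterlim_sequentially_iff_filterlim_real)
  have "(\<lambda>n. (real (g n))\<^sup>2 / real n) \<longlonglongrightarrow> 1" unfolding rg by real_asymp
  then have "h \<longlonglongrightarrow> 1 powr \<alpha>" unfolding h_def by (intro tendsto_powr tendsto_const) auto
  then have h: "h \<longlonglongrightarrow> 1" by simp
  have near: "\<forall>\<^sub>F n in sequentially. of_real (h n) * z \<in> ball a d" if "z \<in> ball a d" for z
  proof -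
    have "(\<lambda>n. of_real (h n) * z) \<longlonglongrightarrow> of_real 1 * z" by (intro tendsto_intros h)
    then show ?thesis using that by (intro topological_tendstoD[of _ "of_real 1 * z"]) auto
  qed
  from BC sum show ?thesis
  proof eventually_elim
    case (elim \<omega>)
    note sm = elim(2)
    have "\<forall>\<^sub>F j in sequentially. \<exists>z\<in>{z1, z2}. exp (real (j\<^sup>2) * (growth \<alpha> z - e)) \<le> cmod (random_series \<xi> w \<omega> (?R (j\<^sup>2) * z))"
      using elim(1) eventually_gt_at_top[of 0]
    proof eventually_elim
      case (elim j)
      define S where "S z = (\<lambda>k. \<xi> k \<omega> * (w k * (?R (j\<^sup>2) * z) ^ k))" for z
      define Lt where "Lt z \<longleftrightarrow> cmod (\<Sum>k. S z k) < exp (real (j\<^sup>2) * (growth \<alpha> z - e))" for z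
      have notin: "?X \<omega> \<notin> ?A (j\<^sup>2)" using elim(1) by (simp add: E_def)
      have "\<not> (\<forall>z\<in>{z1, z2}. summable (S z) \<and> Lt z)"
        using notin unfolding small_event_def mem_Collect_eq S_def Lt_def .
      moreover have Ssum: "summable (S z)" for z
      proof -
        have "j\<^sup>2 > 0" using elim(2) by simp
        note sj = sm[rule_format, OF this]
        have "summable (\<lambda>k. norm (\<xi> k \<omega> * w k * (?R (j\<^sup>2) * z) ^ k))" by (rule sj)
        from summable_norm_cancel[OF this] show ?thesis unfolding S_def mult.assoc .
      qed
      ultimately have "\<exists>z\<in>{z1, z2}. \<not> Lt z" by (simp only: bex_simps ball_simps) simp
      then obtain z where z: "z \<in> {z1, z2}" "\<not> Lt z" by (rule bexE)
      have "random_series \<xi> w \<omega> (?R (j\<^sup>2) * z) = (\<Sum>k. S z k)"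
        unfolding random_series_def S_def by (simp only: mult.assoc)
      then show ?case using z(2) by (intro bexI[OF _ z(1)]) (simp only: Lt_def not_less)
    qed
    from eventually_compose_filterlim[OF this g] near[OF z(1)] near[OF z(2)] eventually_gt_at_top[of 0]
    show ?case
    proof eventually_elim
      case (elim n)
      from elim(1) obtain z where zz: "z \<in> {z1, z2}"
        and le: "exp (real ((g n)\<^sup>2) * (growth \<alpha> z - e)) \<le> cmod (random_series \<xi> w \<omega> (?R ((g n)\<^sup>2) * z))"
        by (rule bexE)
      let ?z = "of_real (h n) * z"
      have zb: "?z \<in> ball a d" using zz elim(2,3) by (elim insertE emptyE) simp_all
      have "zoom \<alpha> \<beta> n * h n = exp \<beta> * real ((g n)\<^sup>2) powr \<alpha>"
        using elim(4) by (simp add: h_def powr_divide)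
      then have R: "?R n * ?z = ?R ((g n)\<^sup>2) * z" by (simp only: mult.assoc[symmetric] of_real_mult[symmetric])
      have "cmod ?z powr (1 / \<alpha>) = h n powr (1 / \<alpha>) * cmod z powr (1 / \<alpha>)"
        by (simp add: norm_mult powr_mult h_def)
      also have "h n powr (1 / \<alpha>) = (real (g n))\<^sup>2 / real n" using \<alpha> by (simp add: h_def powr_powr)
      finally have A: "real n * (\<alpha> * cmod ?z powr (1 / \<alpha>)) = real ((g n)\<^sup>2) * (growth \<alpha> z)"
        using elim(4) by simp
      \<comment> \<open>The growth terms match exactly by homogeneity, and since
        \<open>(g n)\<^sup>2 \<le> n\<close> the tolerance only becomes weaker.\<close>
      have B: "real ((g n)\<^sup>2) * e \<le> real n * e"
      proof -
        have "real (g n) \<le> sqrt (real n)" unfolding rg by simp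
        then have "(real (g n))\<^sup>2 \<le> (sqrt (real n))\<^sup>2" by (intro power_mono) auto
        then show ?thesis using e by (intro mult_right_mono) auto
      qed
      have "exp (real n * (\<alpha> * cmod ?z powr (1 / \<alpha>) - e)) \<le> exp (real ((g n)\<^sup>2) * (growth \<alpha> z - e))"
        unfolding exp_le_cancel_iff right_diff_distrib A by (rule diff_left_mono[OF B])
      then have "exp (real n * (\<alpha> * cmod ?z powr (1 / \<alpha>) - e)) \<le> cmod (random_series \<xi> w \<omega> (?R n * ?z))"
        unfolding R using le by linarith
      then show ?case by (rule bexI[OF _ zb])
    qed
  qed
qed

section \<open>From the random series to its zero measure\<close>

lemma entire_power_series:
  assumes "\<And>z::complex. summable (\<lambda>k. c k * z ^ k)"
  shows "(\<lambda>z. \<Sum>k. c k * z ^ k) holomorphic_on UNIV"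
  using termdiffs_strong_converges_everywhere[of c] assms
  by (auto simp: holomorphic_on_def field_differentiable_def)

lemma scale_measure_eq_density: "scale_measure r M = density M (\<lambda>_. r)"
  by (rule measure_eqI) (simp_all add: emeasure_density_const)

text \<open>Dilating the zero measure of \<open>G\<close> amounts to taking the zeros of
  \<open>G (of_real c * z)\<close>, with unchanged multiplicities; the bounded support of \<phi>
  reduces the integral to finitely many of them.\<close>

lemma integral_scaled_zero_measure:
  fixes \<phi> :: "complex \<Rightarrow> real"
  assumes G: "G holomorphic_on UNIV" and nz: "\<exists>z. G z \<noteq> 0" and c: "c > 0" and n: "n > 0"
    and phi: "\<phi> \<in> borel_measurable borel" and supp: "\<And>z. cmod z \<ge> T \<Longrightarrow> \<phi> z = 0"
  shows "(\<integral>z. \<phi> z \<partial>scale_measure (ennreal (1 / real n)) (dilate_measure c (zero_measure G)))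
    = (\<Sum>b\<in>{z \<in> ball 0 T. G (of_real c * z) = 0}. nat (zorder (\<lambda>z. G (of_real c * z)) b) / real n * \<phi> b)"
proof -
  let ?Z = "{z. G z = 0}" and ?m = "\<lambda>z. real (nat (zorder G z))"
  let ?B = "{z \<in> ball 0 T. G (of_real c * z) = 0}"
  have c0: "complex_of_real c \<noteq> 0" using c by simp
  have phic: "(\<lambda>z. \<phi> (z / of_real c)) \<in> borel_measurable borel"
    by (rule measurable_compose[OF _ phi]) (use c0 in \<open>auto intro!: borel_measurable_continuous_onI continuous_intros\<close>)
  have Gc: "(\<lambda>z. G (of_real c * z)) holomorphic_on UNIV"
    using holomorphic_on_compose[of "\<lambda>z. of_real c * z" UNIV G] G
    by (auto simp: o_def intro!: holomorphic_intros holomorphic_on_subset[OF G])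
  have "\<exists>z. G (of_real c * z) \<noteq> 0"
  proof -
    obtain z where "G z \<noteq> 0" using nz by blast
    then have "G (of_real c * (z / of_real c)) \<noteq> 0" using c0 by simp
    then show ?thesis by blast
  qed
  then have fin: "finite ?B" by (rule finite_zeros_ball[OF Gc])
  have "(\<integral>z. \<phi> z \<partial>scale_measure (ennreal (1 / real n)) (dilate_measure c (zero_measure G)))
      = (\<integral>z. (1 / real n) *\<^sub>R \<phi> z \<partial>dilate_measure c (zero_measure G))"
    unfolding scale_measure_eq_density
    by (rule integral_density) (use phi in \<open>auto simp: dilate_measure_def\<close>)
  also have "\<dots> = 1 / real n * (\<integral>z. \<phi> z \<partial>dilate_measure c (zero_measure G))" by simp
  also have "(\<integral>z. \<phi> z \<partial>dilate_measure c (zero_measure G)) = (\<integral>z. \<phi> (z / of_real c) \<partial>zero_measure G)"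
    unfolding dilate_measure_def
    by (rule integral_distr[OF _ phi]) (use c0 in \<open>auto simp: zero_measure_def intro!: borel_measurable_continuous_onI continuous_intros\<close>)
  also have "\<dots> = (\<integral>z. \<phi> (z / of_real c) \<partial>density (count_space ?Z) (\<lambda>z. ennreal (?m z)))"
    unfolding zero_measure_def ennreal_of_nat_eq_real_of_nat
    by (rule integral_distr[OF _ phic]) (simp add: measurable_def)
  also have "\<dots> = (\<integral>z. ?m z *\<^sub>R \<phi> (z / of_real c) \<partial>count_space ?Z)"
    by (rule integral_density) auto
  also have "\<dots> = (\<Sum>z\<in>(\<lambda>b. of_real c * b) ` ?B. ?m z * \<phi> (z / of_real c))"
  proof -
    have sub: "{z \<in> ?Z. ?m z *\<^sub>R \<phi> (z / of_real c) \<noteq> 0} \<subseteq> (\<lambda>b. of_real c * b) ` ?B"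
    proof
      fix z assume z: "z \<in> {z \<in> ?Z. ?m z *\<^sub>R \<phi> (z / of_real c) \<noteq> 0}"
      then have "\<not> cmod (z / of_real c) \<ge> T" using supp[of "z / of_real c"] by auto
      then have "z / of_real c \<in> ?B" using z c0 by auto
      moreover have "z = of_real c * (z / of_real c)" using c0 by simp
      ultimately show "z \<in> (\<lambda>b. of_real c * b) ` ?B" by blast
    qed
    then have f: "finite {z \<in> ?Z. ?m z *\<^sub>R \<phi> (z / of_real c) \<noteq> 0}" using fin finite_subset by blast
    have "(\<integral>z. ?m z *\<^sub>R \<phi> (z / of_real c) \<partial>count_space ?Z) = (\<Sum>z | z \<in> ?Z \<and> ?m z *\<^sub>R \<phi> (z / of_real c) \<noteq> 0. ?m z *\<^sub>R \<phi> (z / of_real c))"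
      by (rule lebesgue_integral_count_space_finite_support[OF f])
    also have "\<dots> = (\<Sum>z\<in>(\<lambda>b. of_real c * b) ` ?B. ?m z * \<phi> (z / of_real c))"
      using sub fin by (intro sum.mono_neutral_cong_left) auto
    finally show ?thesis .
  qed
  also have "\<dots> = (\<Sum>b\<in>?B. ?m (of_real c * b) * \<phi> b)"
    using c0 by (subst sum.reindex) (auto simp: inj_on_def)
  also have "\<dots> = (\<Sum>b\<in>?B. real (nat (zorder (\<lambda>z. G (of_real c * z)) b)) * \<phi> b)"
  proof (rule sum.cong[OF refl])
    fix b
    have "G meromorphic_on {of_real c * b}"
      by (intro analytic_on_imp_meromorphic_on holomorphic_on_imp_analytic_at[OF G]) auto
    then have "zorder (\<lambda>z. G (of_real c * z)) b = zorder G (of_real c * b)"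
      by (rule Meromorphic.zorder_scale[OF _ c0])
    then show "?m (of_real c * b) * \<phi> b = real (nat (zorder (\<lambda>z. G (of_real c * z)) b)) * \<phi> b" by simp
  qed
  finally show ?thesis by (simp add: sum_distrib_left sum_divide_distrib)
qed

lemma integral_radial_measure_support:
  fixes \<phi> :: "complex \<Rightarrow> real"
  assumes p: "p > 0" and phi: "\<phi> \<in> borel_measurable borel" and supp: "\<And>z. cmod z \<ge> T \<Longrightarrow> \<phi> z = 0"
  shows "(\<integral>z. \<phi> z \<partial>radial_measure p T) = (\<integral>z. \<phi> z \<partial>density lborel (\<lambda>z. ennreal (radial_density p z)))"
proof -
  have "(\<integral>z. \<phi> z \<partial>radial_measure p T) = (\<integral>z. (radial_density p z * indicator (ball 0 T) z) *\<^sub>R \<phi> z \<partial>lborel)"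
    unfolding radial_measure_def
    by (rule integral_density) (use p phi in \<open>auto intro!: AE_I2 mult_nonneg_nonneg borel_measurable_times borel_measurable_indicator radial_density_nonneg\<close>)
  also have "\<dots> = (\<integral>z. radial_density p z *\<^sub>R \<phi> z \<partial>lborel)"
    by (intro Bochner_Integration.integral_cong refl) (use supp in \<open>auto simp: indicator_def\<close>)
  also have "\<dots> = (\<integral>z. \<phi> z \<partial>density lborel (\<lambda>z. ennreal (radial_density p z)))"
    by (rule integral_density[symmetric]) (use p phi in \<open>auto intro!: radial_density_nonneg\<close>)
  finally show ?thesis .
qed

lemma log_asymptotics_series:
  assumes o: "(\<lambda>k. ln (cmod (w k)) - coeff_size \<alpha> \<beta> k) \<in> o(\<lambda>k. real k)" and \<alpha>: "\<alpha> > 0"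
    and x: "\<And>e. e > 0 \<Longrightarrow> \<exists>C>0. \<forall>k. cmod (x k) \<le> C * exp (e * real k)"
    and W: "\<And>z. W z = (\<Sum>k. x k * w k * z ^ k)" and hol: "W holomorphic_on UNIV"
    and lower: "\<And>a d e. d > 0 \<Longrightarrow> e > 0 \<Longrightarrow> \<forall>\<^sub>F n in sequentially. \<exists>z\<in>ball a d.
      exp (real n * (growth \<alpha> z - e)) \<le> cmod (W (of_real (zoom \<alpha> \<beta> n) * z))"
  shows "log_asymptotics (\<lambda>n z. W (of_real (zoom \<alpha> \<beta> n) * z)) (\<lambda>z. cmod z powr (1 / \<alpha>) / (1 / \<alpha>))"
proof
  let ?R = "\<lambda>n::nat. complex_of_real (zoom \<alpha> \<beta> n)"
  show "(\<lambda>z. W (?R n * z)) holomorphic_on UNIV" for n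
    using holomorphic_on_compose[of "\<lambda>z. ?R n * z" UNIV W]
    by (auto simp: o_def intro!: holomorphic_intros holomorphic_on_subset[OF hol])
  show "continuous_on UNIV (\<lambda>z::complex. cmod z powr (1 / \<alpha>) / (1 / \<alpha>))"
    using \<alpha> by (intro continuous_intros continuous_on_powr') auto
  show "\<forall>\<^sub>F n in sequentially. \<exists>z\<in>ball a d. exp (real n * (cmod z powr (1 / \<alpha>) / (1 / \<alpha>) - e)) \<le> cmod (W (?R n * z))"
    if "d > 0" "e > 0" for a d e
    using lower[OF that, of a] by (simp add: mult.commute)
  fix T e :: real assume e: "e > 0"
  \<comment> \<open>\<open>M\<close> bounds the growth on \<open>ball 0 T\<close>, so a small
    \<open>h\<close> makes the factor \<open>exp (3 * h / \<alpha>)\<close> cost less than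
    \<open>e / 2\<close> there. The other \<open>e / 2\<close> absorbs the constant \<open>C\<close>
    once \<open>n > ln C / (e / 2)\<close>.\<close>
  define M where "M = \<alpha> * \<bar>T\<bar> powr (1 / \<alpha>)"
  have M: "M \<ge> 0" using \<alpha> by (simp add: M_def)
  have "((\<lambda>h. M * (exp (3 * h / \<alpha>) - 1)) \<longlongrightarrow> M * (exp (3 * 0 / \<alpha>) - 1)) (at_right 0)"
    using \<alpha> by (intro tendsto_intros) auto
  then have "\<forall>\<^sub>F h in at_right 0. M * (exp (3 * h / \<alpha>) - 1) < e / 2"
    by (rule order_tendstoD) (use e in simp)
  then have "\<forall>\<^sub>F h in at_right 0. M * (exp (3 * h / \<alpha>) - 1) < e / 2 \<and> h > 0"
    by (intro eventually_conj eventually_at_right_less)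
  then obtain h where h: "M * (exp (3 * h / \<alpha>) - 1) < e / 2" "h > 0"
    using eventually_happens trivial_limit_at_right_real by (metis (mono_tags, lifting))
  obtain C where C: "C > 0" "\<And>n z. n > 0 \<Longrightarrow> cmod (W (?R n * z)) \<le> C * exp (real n * (growth \<alpha> z * exp (3 * h / \<alpha>)))"
    using series_upper[OF o \<alpha> x h(2)] unfolding W by blast
  have "\<forall>\<^sub>F n in sequentially. real n > ln C / (e / 2)"
    by (rule eventually_compose_filterlim[OF eventually_gt_at_top filterlim_real_sequentially])
  then show "\<forall>\<^sub>F n in sequentially. \<forall>z\<in>ball 0 T. cmod (W (?R n * z)) \<le> exp (real n * (cmod z powr (1 / \<alpha>) / (1 / \<alpha>) + e))"
    using eventually_gt_at_top[of 0]
  proof (eventually_elim, intro ballI)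
    fix n and z :: complex assume n: "ln C / (e / 2) < real n" "0 < n" and z: "z \<in> ball 0 T"
    let ?j = "growth \<alpha> z"
    have jM: "?j \<le> M" unfolding M_def using z \<alpha> by (intro mult_left_mono powr_mono2) auto
    have "?j * (exp (3 * h / \<alpha>) - 1) \<le> M * (exp (3 * h / \<alpha>) - 1)"
      using jM h \<alpha> by (intro mult_right_mono) auto
    then have "?j * exp (3 * h / \<alpha>) \<le> ?j + e / 2" using h by (simp add: algebra_simps)
    then have "real n * (?j * exp (3 * h / \<alpha>)) \<le> real n * (?j + e / 2)" by (intro mult_left_mono) auto
    moreover have "ln C \<le> real n * (e / 2)" using n e by (simp add: field_simps)
    ultimately have "ln C + real n * (?j * exp (3 * h / \<alpha>)) \<le> real n * (?j + e)" by (simp add: algebra_simps)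
    then have "exp (ln C + real n * (?j * exp (3 * h / \<alpha>))) \<le> exp (real n * (?j + e))" by simp
    then have "C * exp (real n * (?j * exp (3 * h / \<alpha>))) \<le> exp (real n * (?j + e))" using C(1) by (simp add: exp_add)
    then show "cmod (W (?R n * z)) \<le> exp (real n * (cmod z powr (1 / \<alpha>) / (1 / \<alpha>) + e))"
      using C(2)[OF n(2), of z] by (simp add: mult.commute)
  qed
qed

theorem theorem2p6:
  fixes M :: "'a measure"
    and \<xi> :: "nat \<Rightarrow> 'a \<Rightarrow> complex"
    and w :: "nat \<Rightarrow> complex"
    and \<alpha> \<beta> :: real
  assumes "prob_space M"
    and "prob_space.indep_vars M (\<lambda>_. borel) \<xi> UNIV"
    and "\<And>k. distr M borel (\<xi> k) = distr M borel (\<xi> 0)"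
    and "\<And>k. nondegenerate M (\<xi> k)"
    and "integrable M (\<lambda>\<omega>. ln (1 + cmod (\<xi> 0 \<omega>)))"
    and "\<alpha> > 0"
    and "(\<lambda>k. ln (cmod (w k)) - (- \<alpha> * (real k * ln (real k) - real k) - \<beta> * real k))
           \<in> o(\<lambda>k. real k)"
  shows "(AE \<omega> in M. (\<forall>z. summable (\<lambda>k. \<xi> k \<omega> * w k * z ^ k)) \<and>
                     (\<exists>z. random_series \<xi> w \<omega> z \<noteq> 0)) \<and>
         as_vague_limit M
           (\<lambda>n \<omega>. scale_measure (ennreal (1 / real n))
                    (dilate_measure (exp \<beta> * real n powr \<alpha>)
                      (zero_measure (random_series \<xi> w \<omega>))))
           (density lborel
             (\<lambda>z::complex. ennreal (1 / (2 * pi * \<alpha>) * cmod z powr (1 / \<alpha> - 2))))"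
proof -
  interpret prob_space M by (rule assms(1))
  note \<alpha> = assms(6)
  have meas: "\<xi> k \<in> borel_measurable M" for k using assms(2) unfolding indep_vars_def by auto
  have o: "(\<lambda>k. ln (cmod (w k)) - coeff_size \<alpha> \<beta> k) \<in> o(\<lambda>k. real k)"
    unfolding coeff_size_def by (rule assms(7))
  let ?R = "\<lambda>n::nat. complex_of_real (zoom \<alpha> \<beta> n)"
  have sub: "AE \<omega> in M. \<forall>e>0. \<exists>C>0. \<forall>k. cmod (\<xi> k \<omega>) \<le> C * exp (e * real k)"
    by (rule AE_subexponential[of \<xi>, OF meas assms(3,5)])
  then have sumR: "AE \<omega> in M. \<forall>n>0. \<forall>z. summable (\<lambda>k. norm (\<xi> k \<omega> * w k * (?R n * z) ^ k))"
  proof eventually_elim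
    case (elim \<omega>)
    have "\<exists>C>0. \<forall>n>0. \<forall>z. summable (\<lambda>k. norm (\<xi> k \<omega> * w k * (?R n * z) ^ k)) \<and>
        cmod (\<Sum>k. \<xi> k \<omega> * w k * (?R n * z) ^ k) \<le> C * exp (real n * (growth \<alpha> z * exp (3 * 1 / \<alpha>)))"
    proof (rule series_upper[OF o \<alpha> _ zero_less_one])
      show "\<exists>C>0. \<forall>k. cmod (\<xi> k \<omega>) \<le> C * exp (e * real k)" if "e > 0" for e
        using elim that by simp
    qed
    then obtain C where C: "\<forall>n>0. \<forall>z. summable (\<lambda>k. norm (\<xi> k \<omega> * w k * (?R n * z) ^ k)) \<and>
        cmod (\<Sum>k. \<xi> k \<omega> * w k * (?R n * z) ^ k) \<le> C * exp (real n * (growth \<alpha> z * exp (3 * 1 / \<alpha>)))"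
      by (elim exE conjE)
    show ?case by (intro allI impI, rule conjunct1[OF C[rule_format]])
  qed
  \<comment> \<open>The null set of the lower bound depends on the disc and on the tolerance.
    Countably many centres, radii and tolerances leave one null set, outside which every disc
    contains a listed smaller one.\<close>
  obtain D :: "complex set" where D: "countable D" "\<And>X. open X \<Longrightarrow> X \<noteq> {} \<Longrightarrow> \<exists>d\<in>D. d \<in> X"
    using countable_dense_exists[where 'a = complex] by metis
  have "AE \<omega> in M. \<forall>a\<in>D. \<forall>m::nat. \<forall>\<^sub>F n in sequentially. \<exists>z\<in>ball a (inverse (real (Suc m))).
     exp (real n * (growth \<alpha> z - inverse (real (Suc m)))) \<le> cmod (random_series \<xi> w \<omega> (?R n * z))"
    unfolding AE_ball_countable[OF D(1)] AE_all_countable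
    by (intro ballI allI AE_large_point assms(2-4) o \<alpha> sumR) auto
  with sub sumR have good: "AE \<omega> in M. (\<forall>z. summable (\<lambda>k. \<xi> k \<omega> * w k * z ^ k)) \<and>
      random_series \<xi> w \<omega> holomorphic_on UNIV \<and>
      log_asymptotics (\<lambda>n z. random_series \<xi> w \<omega> (?R n * z)) (\<lambda>z. cmod z powr (1 / \<alpha>) / (1 / \<alpha>))"
  proof eventually_elim
    case (elim \<omega>)
    have s: "summable (\<lambda>k. \<xi> k \<omega> * w k * z ^ k)" for z
    proof -
      \<comment> \<open>Summability is known for zoomed arguments; at \<open>n = 1\<close> the zoom
        is \<open>exp \<beta>\<close>, so these are all complex numbers.\<close>
      have "?R 1 \<noteq> 0" by simp
      then have "?R 1 * (z / ?R 1) = z" by (metis nonzero_mult_div_cancel_left times_divide_eq_right)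
      moreover have "summable (\<lambda>k. norm (\<xi> k \<omega> * w k * (?R 1 * (z / ?R 1)) ^ k))"
        by (rule elim(2)[rule_format, OF zero_less_one])
      ultimately have "summable (\<lambda>k. norm (\<xi> k \<omega> * w k * z ^ k))" by (simp only:)
      then show ?thesis by (rule summable_norm_cancel)
    qed
    have hol: "random_series \<xi> w \<omega> holomorphic_on UNIV"
      using entire_power_series[OF s] by (simp add: random_series_def[abs_def])
    have "log_asymptotics (\<lambda>n z. random_series \<xi> w \<omega> (?R n * z)) (\<lambda>z. cmod z powr (1 / \<alpha>) / (1 / \<alpha>))"
    proof (rule log_asymptotics_series[OF o \<alpha> _ _ hol])
      show "\<exists>C>0. \<forall>k. cmod (\<xi> k \<omega>) \<le> C * exp (e * real k)" if "e > 0" for e using elim(1) that by simp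
      show "random_series \<xi> w \<omega> z = (\<Sum>k. \<xi> k \<omega> * w k * z ^ k)" for z by (simp add: random_series_def)
      fix a d and e :: real assume "0 < (d::real)" "0 < e"
      \<comment> \<open>A listed centre within \<open>d / 2\<close> of \<open>a\<close> and a radius
        below \<open>d / 2\<close> keep the listed disc inside \<open>ball a d\<close>; the same
        number is a tolerance below \<open>e\<close>.\<close>
      then have "min (d / 2) e > 0" by simp
      then obtain m where m: "inverse (real (Suc m)) < min (d / 2) e" using reals_Archimedean by blast
      obtain a' where a': "a' \<in> D" "a' \<in> ball a (d / 2)" using D(2)[of "ball a (d / 2)"] \<open>0 < d\<close> by auto
      have "\<forall>\<^sub>F n in sequentially. \<exists>z\<in>ball a' (inverse (real (Suc m))).
        exp (real n * (growth \<alpha> z - inverse (real (Suc m)))) \<le> cmod (random_series \<xi> w \<omega> (?R n * z))"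
        by (rule elim(3)[rule_format, OF a'(1)])
      then show "\<forall>\<^sub>F n in sequentially. \<exists>z\<in>ball a d.
        exp (real n * (growth \<alpha> z - e)) \<le> cmod (random_series \<xi> w \<omega> (?R n * z))"
      proof eventually_elim
        case (elim n)
        then obtain z where z: "z \<in> ball a' (inverse (real (Suc m)))"
          "exp (real n * (growth \<alpha> z - inverse (real (Suc m)))) \<le> cmod (random_series \<xi> w \<omega> (?R n * z))" by (rule bexE)
        have dz: "z \<in> ball a d" using z(1) a'(2) m dist_triangle[of a z a'] by auto
        have le: "exp (real n * (growth \<alpha> z - e)) \<le> exp (real n * (growth \<alpha> z - inverse (real (Suc m))))"
          using m by (intro iffD2[OF exp_le_cancel_iff] mult_left_mono) auto
        show ?case by (rule bexI[OF _ dz]) (rule order_trans[OF le z(2)])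
      qed
    qed
    then show ?case using s hol by (intro conjI allI)
  qed
  \<comment> \<open>The lower bound at a single point already excludes the zero function, since an
    exponential is positive.\<close>
  have nonzero: "\<exists>z. random_series \<xi> w \<omega> z \<noteq> 0"
    if "log_asymptotics (\<lambda>n z. random_series \<xi> w \<omega> (?R n * z)) (\<lambda>z. cmod z powr (1 / \<alpha>) / (1 / \<alpha>))" for \<omega>
  proof -
    interpret log_asymptotics "\<lambda>n z. random_series \<xi> w \<omega> (?R n * z)" "\<lambda>z. cmod z powr (1 / \<alpha>) / (1 / \<alpha>)" by (rule that)
    obtain n z where "exp (real n * (cmod z powr (1 / \<alpha>) / (1 / \<alpha>) - 1)) \<le> cmod (random_series \<xi> w \<omega> (?R n * z))"
      using lower[of 1 1 0] by (auto dest!: eventually_happens)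
    then have "cmod (random_series \<xi> w \<omega> (?R n * z)) > 0" by (rule less_le_trans[OF exp_gt_zero])
    then show ?thesis by (intro exI[of _ "?R n * z"]) simp
  qed
  show ?thesis
  proof
    show "AE \<omega> in M. (\<forall>z. summable (\<lambda>k. \<xi> k \<omega> * w k * z ^ k)) \<and> (\<exists>z. random_series \<xi> w \<omega> z \<noteq> 0)"
      using good by eventually_elim (intro conjI nonzero; elim conjE; assumption)
    show "as_vague_limit M
           (\<lambda>n \<omega>. scale_measure (ennreal (1 / real n))
                    (dilate_measure (zoom \<alpha> \<beta> n)
                      (zero_measure (random_series \<xi> w \<omega>))))
           (density lborel
             (\<lambda>z::complex. ennreal (1 / (2 * pi * \<alpha>) * cmod z powr (1 / \<alpha> - 2))))"
      unfolding as_vague_limit_def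
    proof (intro allI impI, elim conjE)
      fix \<phi> :: "complex \<Rightarrow> real"
      assume cont: "continuous_on UNIV \<phi>" and comp: "compact (closure {z. \<phi> z \<noteq> 0})"
      have phim: "\<phi> \<in> borel_measurable borel" using cont by (rule borel_measurable_continuous_onI)
      have "bounded {z. \<phi> z \<noteq> 0}" using compact_imp_bounded[OF comp] bounded_subset closure_subset by blast
      then obtain b where b: "\<And>z. \<phi> z \<noteq> 0 \<Longrightarrow> cmod z \<le> b" unfolding bounded_iff by auto
      define T0 where "T0 = \<bar>b\<bar> + 1"
      have T0: "T0 > 0" by (simp add: T0_def)
      have supp: "\<phi> z = 0" if "cmod z \<ge> T0" for z using b[of z] that by (force simp: T0_def)
      define T where "T = T0 + 2"
      have suppT: "\<phi> z = 0" if "cmod z \<ge> T" for z using supp that by (simp add: T_def)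
      have p: "1 / \<alpha> > 0" using \<alpha> by simp
      have dens: "radial_density (1 / \<alpha>) = (\<lambda>z. 1 / (2 * pi * \<alpha>) * cmod z powr (1 / \<alpha> - 2))"
        by (simp add: radial_density_def fun_eq_iff mult.commute)
      show "AE \<omega> in M. (\<lambda>n. \<integral>z. \<phi> z \<partial>scale_measure (ennreal (1 / real n))
                    (dilate_measure (zoom \<alpha> \<beta> n) (zero_measure (random_series \<xi> w \<omega>))))
          \<longlonglongrightarrow> (\<integral>z. \<phi> z \<partial>density lborel (\<lambda>z::complex. ennreal (1 / (2 * pi * \<alpha>) * cmod z powr (1 / \<alpha> - 2))))"
        using good
      proof eventually_elim
        case (elim \<omega>)
        note good\<omega> = elim
        let ?W = "random_series \<xi> w \<omega>"
        have lim: "(\<lambda>n. \<Sum>b\<in>{z \<in> ball 0 T. ?W (?R n * z) = 0}. nat (zorder (\<lambda>z. ?W (?R n * z)) b) / real n * \<phi> b)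
            \<longlonglongrightarrow> (\<integral>z. \<phi> z \<partial>radial_measure (1 / \<alpha>) T)"
          by (rule zeros_equidistribution[OF p conjunct2[OF conjunct2[OF elim]] cont supp T0 T_def])
        have eq: "(\<integral>z. \<phi> z \<partial>radial_measure (1 / \<alpha>) T)
            = (\<integral>z. \<phi> z \<partial>density lborel (\<lambda>z::complex. ennreal (1 / (2 * pi * \<alpha>) * cmod z powr (1 / \<alpha> - 2))))"
          using integral_radial_measure_support[OF p phim suppT] unfolding dens by simp
        show ?case
        proof (rule Lim_transform_eventually[OF lim[unfolded eq]])
          show "\<forall>\<^sub>F n in sequentially. (\<Sum>b\<in>{z \<in> ball 0 T. ?W (?R n * z) = 0}. nat (zorder (\<lambda>z. ?W (?R n * z)) b) / real n * \<phi> b)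
              = (\<integral>z. \<phi> z \<partial>scale_measure (ennreal (1 / real n)) (dilate_measure (zoom \<alpha> \<beta> n) (zero_measure ?W)))"
            using eventually_gt_at_top[of 0]
          proof eventually_elim
            case (elim n)
            have "zoom \<alpha> \<beta> n > 0" using elim by simp
            then show ?case
              by (rule integral_scaled_zero_measure[symmetric, OF conjunct1[OF conjunct2[OF good\<omega>]]
                    nonzero[OF conjunct2[OF conjunct2[OF good\<omega>]]] _ elim phim suppT])
          qed
        qed
      qed
    qed
  qed
qed

end
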